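(* Fix an integer $i>0$. Let $r\ge 3$, let $p=\alpha n^{-(r-1)}$ where $\alpha=\alpha(n)=\Theta(1)$ satisfies $\sup_n\alpha(n)<\alpha^*_r$, and let $F\in\mathcal F^r_{n,p}$ be a random formula. Condition on the event $\mathcal E'_i$ that $F$ contains a full subformula, but no full subformula $F'$ with $\operatorname{ex}(F')<\operatorname{ex}'_i$. Then, with (conditional) probability $1-O(1/n)$ as $n\to\infty$, both of the following hold: (i) $F$ contains a unique minimal full subformula $F_0$ (i.e. exactly one subformula of $F$ is a minimal full formula); (ii) $F_0\in\mathcal F'_i$ (up to isomorphism), i.e. $\operatorname{ex}(F_0)=\operatorname{ex}'_i$. Moreover, (iii) for each $F'\in\mathcal F'_i$, the conditional probability given $\mathcal E'_i$ satisfies $$\Pr(F_0\cong F')\sim \frac1Z\cdot\frac{\alpha^{e(F')}2^{|F'|}}{|\operatorname{aut}F'|},\qquad\text{where } Z=\sum_{F'\in\mathcal F'_i}\frac{\alpha^{e(F')}2^{|F'|}}{|\operatorname{aut}F'|},$$ the sum being over isomorphism classes in $\mathcal F'_i$, and $\sim$ meaning that the ratio of the two sides tends to $1$ as $n\to\infty$.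
   Context: An $r$-SAT formula consists of a finite set of variables and a set of clauses, each clause consisting of $r$ literals (variables or negated variables) on $r$ distinct variables of the formula. On $n$ variables there are $2^r\binom nr$ possible clauses. The random formula $\mathcal F^r_{n,p}$ has $n$ variables, each of the $2^r\binom nr$ possible clauses being present independently with probability $p$. For a formula $H$: the order $|H|$ is the number of variables, the size $e(H)$ is the number of clauses, and the excess is $\operatorname{ex}(H)=(r-1)e(H)-|H|$. Two formulae of the same order $m$ are isomorphic ($\cong$) if one is obtained from the other by a bijection of variables together with flipping the signs of some variables (the acting group has $2^m m!$ elements); $\operatorname{aut}H$ is the group of isomorphisms from $H$ to itself. $H$ is a (proper) subformula of $F$ if its variable and clause sets are subsets of those of $F$ (at least one containment being proper). A formula is full if it has at least one clause and, for each of its variables $v$, both literals $v$ and $\neg v$ appear in clauses of it. A minimal full formula (MFF) is a full formula with no full proper subformula. The values of excess attained by $r$-SAT MFFs are positive integers, listed as $\operatorname{ex}'_1<\operatorname{ex}'_2<\cdots$; $\mathcal F'_s$ denotes the (finite) set of isomorphism classes of MFFs $F'$ with $\operatorname{ex}(F')=\operatorname{ex}'_s$. The pure literal threshold is $\displaystyle\alpha^*_r=\min_{y>0}\frac{(r-1)!\,y}{2^{r-1}(1-e^{-y})^{r-1}}$. *)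

theory Defs
  imports "HOL-Probability.Probability" "HOL-Combinatorics.Permutations"
    "HOL-Library.Landau_Symbols" "HOL-Library.Infinite_Set"
begin

(* (v, True) is the positive literal of the variable v and (v, False) its negation.
   The variable set is recorded separately because a formula may have variables
   that occur in none of its clauses. *)
type_synonym 'a literal = "'a \<times> bool"
type_synonym 'a formula = "'a set \<times> 'a literal set set"

abbreviation vars :: "'a formula \<Rightarrow> 'a set" where
  "vars H \<equiv> fst H"

abbreviation clauses :: "'a formula \<Rightarrow> 'a literal set set" where
  "clauses H \<equiv> snd H"

definition possible_clauses :: "nat \<Rightarrow> 'a set \<Rightarrow> 'a literal set set" where
  "possible_clauses r V = {C. C \<subseteq> V \<times> UNIV \<and> card C = r \<and> inj_on fst C}"

definition sat_formula :: "nat \<Rightarrow> 'a formula \<Rightarrow> bool" where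
  "sat_formula r H \<longleftrightarrow> finite (vars H) \<and> clauses H \<subseteq> possible_clauses r (vars H)"

definition excess :: "nat \<Rightarrow> 'a formula \<Rightarrow> int" where
  "excess r H = (int r - 1) * int (card (clauses H)) - int (card (vars H))"

definition subformula :: "'a formula \<Rightarrow> 'a formula \<Rightarrow> bool" where
  "subformula H F \<longleftrightarrow> vars H \<subseteq> vars F \<and> clauses H \<subseteq> clauses F"

definition full :: "nat \<Rightarrow> 'a formula \<Rightarrow> bool" where
  "full r H \<longleftrightarrow> sat_formula r H \<and> clauses H \<noteq> {} \<and>
     (\<forall>v\<in>vars H. (\<exists>C\<in>clauses H. (v, True) \<in> C) \<and> (\<exists>C\<in>clauses H. (v, False) \<in> C))"

definition mff :: "nat \<Rightarrow> 'a formula \<Rightarrow> bool" where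
  "mff r H \<longleftrightarrow> full r H \<and> \<not> (\<exists>K. subformula K H \<and> K \<noteq> H \<and> full r K)"

definition mff_subformulas :: "nat \<Rightarrow> 'a formula \<Rightarrow> 'a formula set" where
  "mff_subformulas r F = {H. subformula H F \<and> mff r H}"

(* Rename variables by f and flip the signs of the variables in S. *)
definition map_literal :: "('a \<Rightarrow> 'b) \<Rightarrow> 'a set \<Rightarrow> 'a literal \<Rightarrow> 'b literal" where
  "map_literal f S = (\<lambda>(v, b). (f v, b \<noteq> (v \<in> S)))"

definition map_formula :: "('a \<Rightarrow> 'b) \<Rightarrow> 'a set \<Rightarrow> 'a formula \<Rightarrow> 'b formula" where
  "map_formula f S H = (f ` vars H, (\<lambda>C. map_literal f S ` C) ` clauses H)"

definition isomorphic :: "'a formula \<Rightarrow> 'b formula \<Rightarrow> bool"  (infix "\<simeq>\<^sub>f" 50) where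
  "H \<simeq>\<^sub>f K \<longleftrightarrow> (\<exists>f S. bij_betw f (vars H) (vars K) \<and> S \<subseteq> vars H \<and> map_formula f S H = K)"

(* Requiring "f permutes vars H" and "S \<subseteq> vars H" makes each of the 2^m m! signed
   permutations of the m variables correspond to exactly one pair (f, S). *)
definition aut :: "'a formula \<Rightarrow> (('a \<Rightarrow> 'a) \<times> 'a set) set" where
  "aut H = {(f, S). f permutes vars H \<and> S \<subseteq> vars H \<and> map_formula f S H = H}"

(* The excess values of MFFs in increasing order, indexed from s = 1.  They are enumerated
   as natural numbers, which loses nothing: a full H with m variables satisfies
   r e(H) \<ge> 2 m > 0, so its excess is positive for r \<ge> 3.  There are infinitely
   many values, so all s \<ge> 1 are meaningful.  Variables of type nat suffice, since
   every finite formula is isomorphic to one over nat. *)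
definition mff_excess :: "nat \<Rightarrow> nat \<Rightarrow> int" where
  "mff_excess r s =
     int (enumerate {k. \<exists>H :: nat formula. mff r H \<and> excess r H = int k} (s - 1))"

definition mffs_of_rank :: "nat \<Rightarrow> nat \<Rightarrow> nat formula set" where
  "mffs_of_rank r s = {H. mff r H \<and> excess r H = mff_excess r s}"

definition mff_classes :: "nat \<Rightarrow> nat \<Rightarrow> nat formula set set" where
  "mff_classes r s =
     mffs_of_rank r s // {(H, K). H \<in> mffs_of_rank r s \<and> K \<in> mffs_of_rank r s \<and> H \<simeq>\<^sub>f K}"

definition iso_weight :: "real \<Rightarrow> 'a formula \<Rightarrow> real" where
  "iso_weight a H = a ^ card (clauses H) * 2 ^ card (vars H) / real (card (aut H))"

(* iso_weight is constant on isomorphism classes, so any representative will do. *)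
definition total_weight :: "nat \<Rightarrow> nat \<Rightarrow> real \<Rightarrow> real" where
  "total_weight r s a = (\<Sum>c\<in>mff_classes r s. iso_weight a (SOME H. H \<in> c))"

(* The minimum over y > 0 is attained when r \<ge> 3, so it equals this infimum. *)
definition pure_literal_threshold :: "nat \<Rightarrow> real" where
  "pure_literal_threshold r =
     (INF y\<in>{0<..}. fact (r - 1) * y / (2 ^ (r - 1) * (1 - exp (- y)) ^ (r - 1)))"

(* bernoulli_pmf clamps its parameter to [0, 1], so this is meaningful for every real p. *)
definition random_formula :: "nat \<Rightarrow> nat \<Rightarrow> real \<Rightarrow> nat formula pmf" where
  "random_formula r n p =
     map_pmf (\<lambda>X. ({..<n}, {C \<in> possible_clauses r {..<n}. X C}))
       (Pi_pmf (possible_clauses r {..<n}) False (\<lambda>_. bernoulli_pmf p))"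

definition min_excess_event :: "nat \<Rightarrow> nat \<Rightarrow> nat formula \<Rightarrow> bool" where
  "min_excess_event r i F \<longleftrightarrow>
     (\<exists>H. subformula H F \<and> full r H) \<and>
     \<not> (\<exists>H. subformula H F \<and> full r H \<and> excess r H < mff_excess r i)"

end

theory Submission
  imports Defs "HOL-Real_Asymp.Real_Asymp"
begin

text \<open>
A full formula strictly gains excess over each of its proper subformulas, so two different minimal full
subformulas have a union of larger excess.  Since a fixed formula of excess e appears with probability of
order n to the power -e, the event of containing a full subformula but none of excess below e is dominated by
single copies of minimal full formulas of excess exactly e, and the expected number of copies gives the
limiting weights.

What remains is to exclude large minimal full subformulas, up to probability smaller than any fixed power
of n.  Those with at most \<open>\<epsilon> n\<close> variables are excluded by the first moment.  For linear size, all literals of a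
full subformula survive any number t of rounds of pure literal elimination.  The number of surviving literals
is concentrated, by an exponential moment bound, and its mean obeys the recursion
\<open>x \<mapsto> 1 - exp (- \<Lambda> x\<^sup>r\<^sup>-\<^sup>1)\<close>, whose only fixed point is 0 below the threshold: the literals in a clause through
a variable v survive, up to probability O(1/n), already in the formula without v, which is independent of the
clauses at v.  Concentration is reused in the recursion to replace the random number of survivors by its bound.
\<close>

subsection \<open>Full formulas and minimal full formulas\<close>

text \<open>A fixed H has about n^|H| possible placements, each present with probability p^e(H) =
  \<alpha>^e(H) n^(-(r-1)e(H)); the product carries exactly the power -ex(H) of n, which is why the
  excess decides everything. Since excess is an integer, each strict gain costs a full factor 1/n,
  and this is the origin of the error O(1/n). The obstacle is that the event conditioned on is
  itself rare, of order n^(-ex'_i). That large full subformulas are absent with probability tending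
  to 1 is therefore not enough: their probability must be O(n^(-ex'_i - 1)) for arbitrary i. This
  forces an exponential inequality for the survivors rather than a variance bound. The inequality
  needs bounded influence of a single clause. The influence grows like the t-th power of the maximal
  degree, so t has to stay constant while degrees are capped at order log n. With t constant,
  elimination only drives the survivors below a small linear number, and the first moment takes over
  from there.\<close>

abbreviation formula_union :: "'a formula \<Rightarrow> 'a formula \<Rightarrow> 'a formula" where
  "formula_union H K \<equiv> (vars H \<union> vars K, clauses H \<union> clauses K)"

lemma clause_vars: "C \<in> possible_clauses r V \<Longrightarrow> (v, b) \<in> C \<Longrightarrow> v \<in> V"
  unfolding possible_clauses_def by auto

lemma possible_clauses_mono: "V \<subseteq> W \<Longrightarrow> possible_clauses r V \<subseteq> possible_clauses r W"
  unfolding possible_clauses_def by blast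

lemma finite_possible_clauses [simp]: "finite V \<Longrightarrow> finite (possible_clauses r V)"
  unfolding possible_clauses_def by (rule finite_subset[of _ "Pow (V \<times> UNIV)"]) auto

lemma card_Union_clauses_le:
  assumes "finite D" "D \<subseteq> possible_clauses r V"
  shows "card (\<Union>D) \<le> r * card D"
proof -
  have "card (\<Union>D) \<le> (\<Sum>C\<in>D. card C)"
    by (rule card_Union_le_sum_card)
  also have "\<dots> = (\<Sum>C\<in>D. r)"
    using assms(2) by (intro sum.cong) (auto simp: possible_clauses_def)
  finally show ?thesis by (simp add: mult.commute)
qed

lemma finite_clauses: "sat_formula r H \<Longrightarrow> finite (clauses H)"
  unfolding sat_formula_def using finite_subset finite_possible_clauses by blast

lemma subformula_refl [simp]: "subformula H H"
  by (simp add: subformula_def)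

lemma subformula_trans: "subformula H K \<Longrightarrow> subformula K L \<Longrightarrow> subformula H L"
  by (auto simp: subformula_def)

text \<open>Let D and W be the clauses and variables of H missing from K. Clauses of K use variables
  of K only, so all 2|W| literals over W must occur in clauses of D. Hence |W| \<le> r|D|/2 <
  (r-1)|D| once r \<ge> 3 and D is nonempty. Fullness is asked of H alone, so K may also be the
  empty formula.\<close>

lemma excess_less_full:
  assumes "r \<ge> 3" "full r H" "subformula K H" "K \<noteq> H"
    and K: "clauses K \<subseteq> possible_clauses r (vars K)"
  shows "excess r K < excess r H"
proof -
  define D where "D = clauses H - clauses K"
  define W where "W = vars H - vars K"
  have fin: "finite (vars H)" "finite (clauses H)"
    using assms(2) finite_clauses[of r H] by (auto simp: full_def sat_formula_def)
  have sub: "vars K \<subseteq> vars H" "clauses K \<subseteq> clauses H" using assms(3) by (auto simp: subformula_def)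
  have cov: "W \<times> UNIV \<subseteq> \<Union>D"
  proof clarify
    fix v b assume v: "v \<in> W"
    then obtain C where C: "C \<in> clauses H" "(v, b) \<in> C"
      using assms(2) unfolding W_def full_def by (cases b) auto
    have "C \<notin> clauses K" using v C K clause_vars[of C r "vars K" v b] by (auto simp: W_def)
    then show "(v, b) \<in> \<Union>D" using C by (auto simp: D_def)
  qed
  have finD: "finite D" "finite W" using fin by (auto simp: D_def W_def)
  have Dp: "D \<subseteq> possible_clauses r (vars H)"
    using assms(2) by (auto simp: D_def full_def sat_formula_def)
  have "\<Union>D \<subseteq> vars H \<times> UNIV" using Dp by (auto simp: possible_clauses_def)
  then have "finite (\<Union>D)" by (rule finite_subset) (simp add: fin)
  then have "card (W \<times> (UNIV::bool set)) \<le> r * card D"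
    using card_mono[OF _ cov] card_Union_clauses_le[OF finD(1) Dp] by linarith
  then have le: "2 * card W \<le> r * card D" by (simp add: card_cartesian_product)
  have "D \<noteq> {}"
  proof
    assume "D = {}"
    then have "W = {}" using cov by auto
    then show False using \<open>D = {}\<close> assms(4) sub by (auto simp: D_def W_def prod_eq_iff)
  qed
  then have Dpos: "card D > 0" using finD by auto
  have cD: "card (clauses H) = card (clauses K) + card D"
    using sub fin by (simp add: D_def card_Diff_subset finite_subset card_mono)
  have cW: "card (vars H) = card (vars K) + card W"
    using sub fin by (simp add: W_def card_Diff_subset finite_subset card_mono)
  have "int (card W) < (int r - 1) * int (card D)"
  proof -
    have a: "2 * int (card W) \<le> int r * int (card D)"
      using le by (metis of_nat_le_iff of_nat_mult of_nat_numeral)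
    have b: "1 * int (card D) \<le> (int r - 2) * int (card D)"
      using assms(1) by (intro mult_right_mono) auto
    have "2 * ((int r - 1) * int (card D)) = int r * int (card D) + (int r - 2) * int (card D)"
      by (simp add: algebra_simps)
    then show ?thesis using a b Dpos by linarith
  qed
  then show ?thesis unfolding excess_def cD cW by (simp add: algebra_simps)
qed

lemma full_literals_le:
  assumes "full r H"
  shows "2 * card (vars H) \<le> r * card (clauses H)"
proof -
  have fin: "finite (vars H)" "finite (clauses H)" and p: "clauses H \<subseteq> possible_clauses r (vars H)"
    using assms finite_clauses[of r H] by (auto simp: full_def sat_formula_def)
  have "vars H \<times> UNIV \<subseteq> \<Union>(clauses H)"
  proof clarify
    fix v b assume "v \<in> vars H"
    then show "(v, b) \<in> \<Union>(clauses H)" using assms unfolding full_def by (cases b) auto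
  qed
  moreover have "\<Union>(clauses H) \<subseteq> vars H \<times> UNIV" using p by (auto simp: possible_clauses_def)
  then have "finite (\<Union>(clauses H))" by (rule finite_subset) (simp add: fin)
  ultimately have "card (vars H \<times> (UNIV::bool set)) \<le> r * card (clauses H)"
    using card_mono card_Union_clauses_le[OF fin(2) p] le_trans by meson
  then show ?thesis by (simp add: card_cartesian_product)
qed

lemma full_union:
  assumes "full r H" "full r K"
  shows "full r (formula_union H K)"
proof -
  have "clauses H \<subseteq> possible_clauses r (vars H \<union> vars K)" "clauses K \<subseteq> possible_clauses r (vars H \<union> vars K)"
    using assms possible_clauses_mono[of _ "vars H \<union> vars K" r] unfolding full_def sat_formula_def by blast+
  with assms show ?thesis unfolding full_def sat_formula_def by auto
qed

text \<open>If the union were H itself, K would be a full proper subformula of H. So the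
  simultaneous presence of two minimal full subformulas costs at least one more factor 1/n in
  expectation.\<close>

lemma excess_union_mff:
  assumes "r \<ge> 3" "mff r H" "mff r K" "H \<noteq> K"
  shows "excess r H < excess r (formula_union H K)"
proof (rule excess_less_full)
  show "full r (formula_union H K)" using assms by (intro full_union) (auto simp: mff_def)
  show "H \<noteq> formula_union H K"
  proof
    assume "H = formula_union H K"
    then have "subformula K H" by (metis Un_upper2 fst_conv snd_conv subformula_def)
    moreover have "full r K" using assms(3) by (simp add: mff_def)
    ultimately show False using assms(2,4) unfolding mff_def by blast
  qed
  show "clauses H \<subseteq> possible_clauses r (vars H)" using assms by (auto simp: mff_def full_def sat_formula_def)
qed (use assms in \<open>auto simp: subformula_def\<close>)

lemma full_contains_mff:
  assumes "full r H"
  shows "\<exists>K. subformula K H \<and> mff r K"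
  using assms
proof (induction "card (vars H) + card (clauses H)" arbitrary: H rule: less_induct)
  case less
  show ?case
  proof (cases "mff r H")
    case False
    then obtain K where K: "subformula K H" "K \<noteq> H" "full r K" using less.prems by (auto simp: mff_def)
    have fin: "finite (vars H)" "finite (clauses H)"
      using less.prems finite_clauses[of r H] by (auto simp: full_def sat_formula_def)
    have "vars K \<subset> vars H \<or> clauses K \<subset> clauses H" "vars K \<subseteq> vars H" "clauses K \<subseteq> clauses H"
      using K by (auto simp: subformula_def prod_eq_iff)
    then have "card (vars K) + card (clauses K) < card (vars H) + card (clauses H)"
      using fin by (metis add_le_less_mono add_less_le_mono card_mono psubset_card_mono)
    then show ?thesis using less.hyps[OF _ K(3)] K(1) subformula_trans by blast
  qed (use subformula_refl in blast)
qed

lemma excess_mono_full: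
  assumes "r \<ge> 3" "full r H" "subformula K H" "full r K"
  shows "excess r K \<le> excess r H"
  using excess_less_full[OF assms(1-3)] assms(4) by (cases "K = H") (auto simp: full_def sat_formula_def)

text \<open>Picking one clause for each of the 2|H| literals already gives a full subformula, which
  by minimality is all of H. In the first moment this keeps constants raised to the number of
  clauses exponential in the number of variables.\<close>

lemma mff_card_clauses_le:
  assumes "r \<ge> 3" "mff r H"
  shows "card (clauses H) \<le> 2 * card (vars H)"
proof -
  have full: "full r H" using assms by (auto simp: mff_def)
  then have fin: "finite (vars H)" by (auto simp: full_def sat_formula_def)
  have "\<forall>l\<in>vars H \<times> UNIV. \<exists>C\<in>clauses H. l \<in> C"
  proof clarify
    fix v b assume "v \<in> vars H"
    then show "\<exists>C\<in>clauses H. (v, b) \<in> C" using full unfolding full_def by (cases b) auto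
  qed
  then obtain f where f: "\<And>l. l \<in> vars H \<times> UNIV \<Longrightarrow> f l \<in> clauses H \<and> l \<in> f l" by metis
  let ?K = "(vars H, f ` (vars H \<times> UNIV))"
  obtain C where C: "C \<in> clauses H" using full by (auto simp: full_def)
  then have "card C = r" "C \<subseteq> vars H \<times> UNIV"
    using full by (auto simp: full_def sat_formula_def possible_clauses_def)
  \<comment> \<open>Without a variable the selected clause set would be empty and therefore not
    full.\<close>
  then have "vars H \<noteq> {}" using assms(1) by auto
  then have "full r ?K"
    using full f unfolding full_def sat_formula_def by (simp add: image_subset_iff) blast
  moreover have "subformula ?K H" using f by (auto simp: subformula_def)
  ultimately have "?K = H" using assms(2) by (auto simp: mff_def)
  then have "clauses H = f ` (vars H \<times> UNIV)" by (metis snd_conv)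
  then have "card (clauses H) \<le> card (vars H \<times> (UNIV :: bool set))"
    using fin by (metis card_image_le finite_SigmaI finite)
  then show ?thesis by (simp add: card_cartesian_product)
qed

text \<open>Compare H with the empty formula, whose excess is 0.\<close>

lemma full_excess_pos: "r \<ge> 3 \<Longrightarrow> full r H \<Longrightarrow> excess r H > 0"
  using excess_less_full[of r H "({}, {})"] by (cases H) (auto simp: subformula_def excess_def full_def)

text \<open>From 2|H| \<le> r e(H) one gets 2 ex(H) \<ge> (r-2) e(H) \<ge> e(H). Thus the excess
  bounds the whole formula, which makes each set of classes of given excess finite.\<close>

lemma full_card_bound:
  assumes "r \<ge> 3" "full r H"
  shows "int (card (vars H)) \<le> int r * excess r H" "int (card (clauses H)) \<le> 2 * excess r H"
proof -
  have le: "2 * int (card (vars H)) \<le> int r * int (card (clauses H))"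
    using full_literals_le[OF assms(2)] by (metis of_nat_le_iff of_nat_mult of_nat_numeral)
  have "1 * int (card (clauses H)) \<le> (int r - 2) * int (card (clauses H))"
    using assms(1) by (intro mult_right_mono) auto
  moreover have "2 * excess r H = int r * int (card (clauses H)) + (int r - 2) * int (card (clauses H)) - 2 * int (card (vars H))"
    by (simp add: algebra_simps excess_def)
  ultimately show a: "int (card (clauses H)) \<le> 2 * excess r H" using le by linarith
  have "int r * int (card (clauses H)) \<le> int r * (2 * excess r H)" using a by (intro mult_left_mono) auto
  then show "int (card (vars H)) \<le> int r * excess r H" using le by linarith
qed

text \<open>A cyclic chain of 2N clauses in which every literal occurs exactly once: the positive and the
  negative clause of block t share r - 1 variables, and the last variable of block t links the positive
  clause of block t with the negative clause of block t - 1.\<close>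

definition pos_clause :: "nat \<Rightarrow> nat \<Rightarrow> nat literal set" where
  "pos_clause r t = {(v, True) | v. v div r = t}"

definition neg_clause :: "nat \<Rightarrow> nat \<Rightarrow> nat \<Rightarrow> nat literal set" where
  "neg_clause r N t = {(v, False) | v. v div r = t \<and> v mod r \<noteq> r - 1}
     \<union> {((Suc t mod N) * r + (r - 1), False)}"

definition cycle_formula :: "nat \<Rightarrow> nat \<Rightarrow> nat formula" where
  "cycle_formula r N = ({..<N * r}, pos_clause r ` {..<N} \<union> neg_clause r N ` {..<N})"

lemma card_block:
  assumes "(r::nat) > 0" shows "card {v. v div r = t} = r" "finite {v. v div r = t}"
proof -
  have "{v. v div r = t} = {t * r..<t * r + r}"
    using assms by (auto simp: div_nat_eqI mult.commute dest: dividend_less_times_div) (metis add.commute dividend_less_times_div mult.commute)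
  then show "card {v. v div r = t} = r" "finite {v. v div r = t}" by auto
qed

lemma block_end:
  assumes "(r::nat) > 0"
  shows "(a * r + (r - 1)) div r = a" "(a * r + (r - 1)) mod r = r - 1"
    "(a * r + r - Suc 0) div r = a" "(a * r + r - Suc 0) mod r = r - 1"
proof -
  obtain q where q: "r = Suc q" using assms by (cases r) auto
  show "(a * r + (r - 1)) div r = a" unfolding q diff_Suc_1
    by (metis add.commute div_mult_self1 div_less lessI nat.distinct(1) add_0)
  moreover show "(a * r + (r - 1)) mod r = r - 1" unfolding q diff_Suc_1
    by (metis mod_mult_self3 mod_less lessI)
  ultimately show "(a * r + r - Suc 0) div r = a" "(a * r + r - Suc 0) mod r = r - 1"
    unfolding q by simp_all
qed

lemma excess_cycle_formula:
  assumes "r \<ge> 3" "N > 0"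
  shows "excess r (cycle_formula r N) = int ((r - 2) * N)"
proof -
  have inj1: "inj_on (pos_clause r) {..<N}"
  proof (rule inj_onI)
    fix s t assume "pos_clause r s = pos_clause r t"
    moreover have "(s * r, True) \<in> pos_clause r s" using assms by (auto simp: pos_clause_def)
    ultimately show "s = t" using assms by (auto simp: pos_clause_def)
  qed
  have inj2: "inj_on (neg_clause r N) {..<N}"
  proof (rule inj_onI)
    fix s t assume "neg_clause r N s = neg_clause r N t"
    moreover have "(s * r, False) \<in> neg_clause r N s" using assms by (auto simp: neg_clause_def)
    ultimately have *: "(s * r, False) \<in> neg_clause r N t" by simp
    have "s * r \<noteq> (Suc t mod N) * r + (r - 1)"
    proof
      assume "s * r = (Suc t mod N) * r + (r - 1)"
      then have "(s * r) mod r = ((Suc t mod N) * r + (r - 1)) mod r" by simp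
      then show False using block_end[of r "Suc t mod N"] assms by simp
    qed
    with * show "s = t" using assms by (auto simp: neg_clause_def)
  qed
  have "pos_clause r ` {..<N} \<inter> neg_clause r N ` {..<N} = {}"
  proof -
    have "pos_clause r s \<noteq> neg_clause r N t" for s t
    proof -
      have "(s * r, True) \<in> pos_clause r s" "(s * r, True) \<notin> neg_clause r N t"
        using assms by (auto simp: pos_clause_def neg_clause_def)
      then show ?thesis by blast
    qed
    then show ?thesis by auto
  qed
  then have "card (clauses (cycle_formula r N)) = N + N"
    unfolding cycle_formula_def using inj1 inj2 by (simp add: card_Un_disjoint card_image)
  then have "excess r (cycle_formula r N) = (int r - 1) * (2 * int N) - int N * int r"
    unfolding excess_def by (simp add: cycle_formula_def)
  also have "\<dots> = (int r - 2) * int N" by (simp add: algebra_simps)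
  also have "\<dots> = int ((r - 2) * N)" using assms by (simp add: of_nat_diff)
  finally show ?thesis .
qed

text \<open>Every literal lies in a single clause. The negative literals with
  \<open>v mod r = r - 1\<close> are excluded from the second part because they sit in the negative
  clause of the preceding block.\<close>

lemma cycle_formula_occurrences:
  assumes "r \<ge> 3" "C \<in> clauses (cycle_formula r N)"
  shows "(v, True) \<in> C \<Longrightarrow> C = pos_clause r (v div r)"
    and "(v, False) \<in> C \<Longrightarrow> v mod r \<noteq> r - 1 \<Longrightarrow> C = neg_clause r N (v div r)"
proof -
  obtain t where C: "C = pos_clause r t \<or> C = neg_clause r N t"
    using assms(2) by (auto simp: cycle_formula_def)
  show "(v, True) \<in> C \<Longrightarrow> C = pos_clause r (v div r)"
    using C by (auto simp: pos_clause_def neg_clause_def)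
  assume v: "(v, False) \<in> C" "v mod r \<noteq> r - 1"
  then have "C = neg_clause r N t" using C by (auto simp: pos_clause_def)
  moreover have "v \<noteq> (Suc t mod N) * r + (r - 1)" using v(2) block_end(2)[of r "Suc t mod N"] assms(1) by (metis gr0I not_numeral_le_zero)
  ultimately show "C = neg_clause r N (v div r)" using v by (simp add: neg_clause_def)
qed

text \<open>Since every literal occurs once, a full subformula has no choice. The first variable of
  block t forces the positive and negative clauses of that block to come together, and the linking
  variable forces the positive clause of the next block. Going round the cycle yields
  everything.\<close>

lemma mff_cycle_formula:
  assumes r: "r \<ge> 3" and N: "N > 0"
  shows "mff r (cycle_formula r N)"
proof -
  let ?H = "cycle_formula r N"
  have pos: "pos_clause r t \<in> possible_clauses r {..<N * r}" if "t < N" for t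
  proof -
    have "pos_clause r t = (\<lambda>v. (v, True)) ` {v. v div r = t}" by (auto simp: pos_clause_def)
    then have "card (pos_clause r t) = r" using card_block[of r t] r by (simp add: card_image inj_on_def)
    moreover have "pos_clause r t \<subseteq> {..<N * r} \<times> UNIV"
      using that r by (auto simp: pos_clause_def div_less_iff_less_mult)
    moreover have "inj_on fst (pos_clause r t)" by (auto simp: pos_clause_def inj_on_def)
    ultimately show ?thesis by (simp add: possible_clauses_def)
  qed
  have neg: "neg_clause r N t \<in> possible_clauses r {..<N * r}" if "t < N" for t
  proof -
    let ?B = "{v. v div r = t \<and> v mod r \<noteq> r - 1}" and ?y = "(Suc t mod N) * r + (r - 1)"
    have eq: "{v. v div r = t} = insert (t * r + (r - 1)) ?B"
    proof (intro set_eqI iffI)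
      fix v assume "v \<in> {v. v div r = t}"
      then show "v \<in> insert (t * r + (r - 1)) ?B"
        by simp (metis div_mult_mod_eq)
    qed (use r block_end[of r t] in auto)
    have "t * r + (r - 1) \<notin> ?B" using r by (simp add: block_end)
    moreover have finB: "finite ?B" using card_block(2)[of r t] r by (intro finite_subset[of ?B "{v. v div r = t}"]) auto
    ultimately have "card (insert (t * r + (r - 1)) ?B) = Suc (card ?B)" by simp
    then have "card ?B = r - 1" using card_block(1)[of r t] r unfolding eq by simp
    moreover have "?y \<notin> ?B" using r by (simp add: block_end)
    ultimately have "card (insert ?y ?B) = r" using r finB by simp
    moreover have e2: "neg_clause r N t = (\<lambda>v. (v, False)) ` insert ?y ?B" by (auto simp: neg_clause_def)
    moreover have "card ((\<lambda>v. (v, False)) ` insert ?y ?B) = card (insert ?y ?B)"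
      by (rule card_image) (rule inj_onI, blast)
    ultimately have "card (neg_clause r N t) = r" by (simp only:)
    moreover have "?y < N * r"
    proof -
      have "Suc t mod N < N" using N by simp
      then have "Suc (Suc t mod N) * r \<le> N * r" by (intro mult_le_mono1) simp
      then show ?thesis using r by simp
    qed
    then have "neg_clause r N t \<subseteq> {..<N * r} \<times> UNIV"
      unfolding e2 using that r by (auto simp: div_less_iff_less_mult)
    moreover have "inj_on fst (neg_clause r N t)" by (auto simp: e2 inj_on_def)
    ultimately show ?thesis by (simp add: possible_clauses_def)
  qed
  have full: "full r ?H"
    unfolding full_def
  proof (intro conjI ballI)
    show "sat_formula r ?H" using pos neg by (auto simp: sat_formula_def cycle_formula_def)
    show "clauses ?H \<noteq> {}" using N by (auto simp: cycle_formula_def)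
    fix v assume "v \<in> vars ?H"
    then have vt: "v div r < N" using r by (simp add: cycle_formula_def div_less_iff_less_mult)
    then have "pos_clause r (v div r) \<in> clauses ?H" by (auto simp: cycle_formula_def)
    then show "\<exists>C\<in>clauses ?H. (v, True) \<in> C" by (rule bexI[rotated]) (simp add: pos_clause_def)
    show "\<exists>C\<in>clauses ?H. (v, False) \<in> C"
    proof (cases "v mod r = r - 1")
      case False
      have "neg_clause r N (v div r) \<in> clauses ?H" using vt by (auto simp: cycle_formula_def)
      then show ?thesis using False by (rule_tac bexI[rotated]) (auto simp: neg_clause_def)
    next
      case True
      \<comment> \<open>The cyclic predecessor of the block of v, with N - 1 added instead of
        subtracting 1.\<close>
      define t where "t = (v div r + (N - 1)) mod N"
      have "Suc t mod N = v div r"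
        unfolding t_def using vt N by (simp add: mod_Suc_eq)
      then have "(v, False) \<in> neg_clause r N t"
        using True by (simp add: neg_clause_def) (metis div_mult_mod_eq)
      moreover have "neg_clause r N t \<in> clauses ?H" using N by (auto simp: cycle_formula_def t_def)
      ultimately show ?thesis by blast
    qed
  qed
  have "K = ?H" if K: "subformula K ?H" "full r K" for K
  proof -
    have sub: "clauses K \<subseteq> clauses ?H" "vars K \<subseteq> {..<N * r}" using K by (auto simp: subformula_def cycle_formula_def)
    have lit: "v \<in> vars K" if "(v, b) \<in> C" "C \<in> clauses K" for v b C
      using that K clause_vars by (fastforce simp: full_def sat_formula_def)
    have occ: "\<exists>C\<in>clauses K. (v, b) \<in> C" if "v \<in> vars K" for v b
      using that K by (cases b) (auto simp: full_def)
    have z: "(t * r) mod r \<noteq> r - 1" "(t * r) div r = t" for t using r by auto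
    have pn: "neg_clause r N t \<in> clauses K" if h: "pos_clause r t \<in> clauses K" for t
    proof -
      have "(t * r, True) \<in> pos_clause r t" using r by (simp add: pos_clause_def)
      then obtain C where C: "C \<in> clauses K" "(t * r, False) \<in> C" using occ[OF lit[OF _ h]] by metis
      then show ?thesis using cycle_formula_occurrences(2)[OF r, of C N "t * r"] sub z by auto
    qed
    have np: "pos_clause r t \<in> clauses K" if h: "neg_clause r N t \<in> clauses K" for t
    proof -
      have "(t * r, False) \<in> neg_clause r N t" using r by (simp add: neg_clause_def)
      then obtain C where C: "C \<in> clauses K" "(t * r, True) \<in> C" using occ[OF lit[OF _ h]] by metis
      then show ?thesis using cycle_formula_occurrences(1)[OF r, of C N "t * r"] sub z by auto
    qed
    have step: "pos_clause r (Suc t mod N) \<in> clauses K" if h: "pos_clause r t \<in> clauses K" for t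
    proof -
      let ?y = "(Suc t mod N) * r + (r - 1)"
      have "(?y, False) \<in> neg_clause r N t" by (simp add: neg_clause_def)
      then obtain C where C: "C \<in> clauses K" "(?y, True) \<in> C" using occ[OF lit[OF _ pn[OF h]]] by metis
      then have "C = pos_clause r (?y div r)" using cycle_formula_occurrences(1)[OF r, of C N ?y] sub by auto
      moreover have "?y div r = Suc t mod N" using r by (simp add: block_end)
      ultimately show ?thesis using C by simp
    qed
    obtain t0 where t0: "t0 < N" "pos_clause r t0 \<in> clauses K"
    proof -
      obtain C where C: "C \<in> clauses K" using K by (auto simp: full_def)
      then obtain t where "t < N" "C = pos_clause r t \<or> C = neg_clause r N t"
        using sub by (auto simp: cycle_formula_def)
      then show ?thesis using C np by (intro that) blast+
    qed
    have all: "pos_clause r ((t0 + k) mod N) \<in> clauses K" for k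
    proof (induction k)
      case (Suc k)
      then show ?case using step[OF Suc] by (simp add: mod_Suc_eq)
    qed (use t0 in simp)
    have allp: "pos_clause r t \<in> clauses K" if "t < N" for t
    proof -
      have "(t0 + (t + (N - t0))) mod N = t" using that t0 by simp
      then show ?thesis using all by metis
    qed
    have "vars K = vars ?H"
    proof
      show "vars ?H \<subseteq> vars K"
      proof
        fix v assume "v \<in> vars ?H"
        then have "v div r < N" using r by (simp add: cycle_formula_def div_less_iff_less_mult)
        then show "v \<in> vars K" using lit[of v True "pos_clause r (v div r)"] allp by (simp add: pos_clause_def)
      qed
    qed (use sub in \<open>simp add: cycle_formula_def\<close>)
    moreover have "clauses ?H \<subseteq> clauses K" using allp pn by (auto simp: cycle_formula_def)
    ultimately show "K = ?H" using sub by (simp add: prod_eq_iff)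
  qed
  with full show ?thesis by (auto simp: mff_def)
qed

text \<open>\<open>enumerate\<close> is guaranteed to return members only of an infinite set; the
  cycles supply the excesses (r-2)N for all N \<ge> 1.\<close>

lemma mff_excess_attained:
  assumes "r \<ge> 3"
  shows "\<exists>H :: nat formula. mff r H \<and> excess r H = mff_excess r s"
proof -
  let ?S = "{k. \<exists>H :: nat formula. mff r H \<and> excess r H = int k}"
  have sub: "range (\<lambda>N. (r - 2) * Suc N) \<subseteq> ?S"
    using mff_cycle_formula[OF assms] excess_cycle_formula[OF assms] by blast
  have "inj (\<lambda>N. (r - 2) * Suc N)"
    using assms by (intro injI, unfold mult_cancel1) auto
  then have "infinite ?S" by (rule infinite_super[OF sub range_inj_infinite])
  then have "enumerate ?S (s - 1) \<in> ?S" by (rule enumerate_in_set)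
  then show ?thesis by (simp add: mff_excess_def)
qed

subsection \<open>Random subsets of a finite set\<close>

text \<open>Expectation over a random subset of A that contains each element independently with
  probability p. As a finite weighted sum it obeys its algebraic laws for every real p, and
  independence becomes induction on A; only monotonicity uses 0 \<le> p \<le> 1.\<close>

definition rs_mean :: "real \<Rightarrow> 'a set \<Rightarrow> ('a set \<Rightarrow> real) \<Rightarrow> real" where
  "rs_mean p A f = (\<Sum>S\<in>Pow A. p ^ card S * (1 - p) ^ card (A - S) * f S)"

definition rs_prob :: "real \<Rightarrow> 'a set \<Rightarrow> ('a set \<Rightarrow> bool) \<Rightarrow> real" where
  "rs_prob p A Q = rs_mean p A (\<lambda>S. of_bool (Q S))"

lemma rs_mean_empty [simp]: "rs_mean p {} f = f {}"
  by (simp add: rs_mean_def)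

text \<open>Conditioning on whether x is chosen; the other laws that involve more than linearity
  follow from this by induction on the ground set.\<close>

lemma rs_mean_insert:
  assumes "finite A" "x \<notin> A"
  shows "rs_mean p (insert x A) f = p * rs_mean p A (\<lambda>S. f (insert x S)) + (1 - p) * rs_mean p A f"
proof -
  let ?g = "\<lambda>S. p ^ card S * (1 - p) ^ card (insert x A - S) * f S"
  have inj: "inj_on (insert x) (Pow A)"
    using assms(2) by (auto simp: inj_on_def)
  have "rs_mean p (insert x A) f = sum ?g (insert x ` Pow A) + sum ?g (Pow A)"
    unfolding rs_mean_def Pow_insert using assms
    by (subst sum.union_disjoint) (auto simp: add.commute)
  also have "sum ?g (insert x ` Pow A) = (\<Sum>S\<in>Pow A. ?g (insert x S))"
    by (rule sum.reindex_cong[OF inj]) auto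
  also have "\<dots> = p * rs_mean p A (\<lambda>S. f (insert x S))"
    unfolding rs_mean_def sum_distrib_left
  proof (rule sum.cong)
    fix S assume S: "S \<in> Pow A"
    then have "card (insert x S) = Suc (card S)" "insert x A - insert x S = A - S"
      using assms finite_subset by (auto intro!: card_insert_disjoint)
    then show "?g (insert x S) = p * (p ^ card S * (1 - p) ^ card (A - S) * f (insert x S))" by simp
  qed simp
  also have "sum ?g (Pow A) = (1 - p) * rs_mean p A f"
    unfolding rs_mean_def sum_distrib_left
  proof (rule sum.cong)
    fix S assume S: "S \<in> Pow A"
    then have "insert x A - S = insert x (A - S)" using assms by auto
    then have "card (insert x A - S) = Suc (card (A - S))"
      using assms by (simp add: card_insert_disjoint)
    then show "?g S = (1 - p) * (p ^ card S * (1 - p) ^ card (A - S) * f S)" by simp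
  qed simp
  finally show ?thesis .
qed

lemma rs_mean_cong: "(\<And>S. S \<subseteq> A \<Longrightarrow> f S = g S) \<Longrightarrow> rs_mean p A f = rs_mean p A g"
  by (simp add: rs_mean_def)

lemma rs_mean_const [simp]: "finite A \<Longrightarrow> rs_mean p A (\<lambda>_. k) = k"
  by (induction A rule: finite_induct) (simp_all add: rs_mean_insert algebra_simps)

lemma rs_mean_add: "rs_mean p A (\<lambda>S. f S + g S) = rs_mean p A f + rs_mean p A g"
  by (simp add: rs_mean_def sum.distrib algebra_simps)

lemma rs_mean_diff: "rs_mean p A (\<lambda>S. f S - g S) = rs_mean p A f - rs_mean p A g"
  by (simp add: rs_mean_def sum_subtractf algebra_simps)

lemma rs_mean_cmult: "rs_mean p A (\<lambda>S. k * f S) = k * rs_mean p A f"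
  by (simp add: rs_mean_def sum_distrib_left algebra_simps)

lemma rs_mean_sum: "rs_mean p A (\<lambda>S. \<Sum>i\<in>I. f i S) = (\<Sum>i\<in>I. rs_mean p A (f i))"
  unfolding rs_mean_def by (subst sum.swap) (simp add: sum_distrib_left)

lemma rs_mean_mono:
  assumes "0 \<le> p" "p \<le> 1" "\<And>S. S \<subseteq> A \<Longrightarrow> f S \<le> g S"
  shows "rs_mean p A f \<le> rs_mean p A g"
  unfolding rs_mean_def using assms by (intro sum_mono mult_left_mono) auto

lemma rs_mean_nonneg:
  assumes "0 \<le> p" "p \<le> 1" "\<And>S. S \<subseteq> A \<Longrightarrow> 0 \<le> f S"
  shows "0 \<le> rs_mean p A f"
  unfolding rs_mean_def using assms by (intro sum_nonneg mult_nonneg_nonneg) auto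

lemma rs_prob_nonneg: "0 \<le> p \<Longrightarrow> p \<le> 1 \<Longrightarrow> 0 \<le> rs_prob p A Q"
  unfolding rs_prob_def by (rule rs_mean_nonneg) auto

lemma rs_prob_mono:
  "0 \<le> p \<Longrightarrow> p \<le> 1 \<Longrightarrow> (\<And>S. S \<subseteq> A \<Longrightarrow> Q S \<Longrightarrow> R S) \<Longrightarrow> rs_prob p A Q \<le> rs_prob p A R"
  unfolding rs_prob_def by (rule rs_mean_mono) auto

lemma rs_prob_le_1: "finite A \<Longrightarrow> 0 \<le> p \<Longrightarrow> p \<le> 1 \<Longrightarrow> rs_prob p A Q \<le> 1"
  unfolding rs_prob_def using rs_mean_mono[of p A "\<lambda>S. of_bool (Q S)" "\<lambda>_. 1"] by simp

lemma rs_prob_disj: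
  assumes "0 \<le> p" "p \<le> 1"
  shows "rs_prob p A (\<lambda>S. Q S \<or> R S) \<le> rs_prob p A Q + rs_prob p A R"
  unfolding rs_prob_def rs_mean_add[symmetric] using assms by (intro rs_mean_mono) auto

lemma rs_prob_Ex:
  assumes "0 \<le> p" "p \<le> 1" "finite I"
  shows "rs_prob p A (\<lambda>S. \<exists>i\<in>I. Q i S) \<le> (\<Sum>i\<in>I. rs_prob p A (Q i))"
  unfolding rs_prob_def rs_mean_sum[symmetric]
proof (rule rs_mean_mono)
  fix S show "of_bool (\<exists>i\<in>I. Q i S) \<le> (\<Sum>i\<in>I. of_bool (Q i S) :: real)"
  proof (cases "\<exists>i\<in>I. Q i S")
    case True
    then obtain i where i: "i \<in> I" "Q i S" by blast
    have "of_bool (Q i S) \<le> (\<Sum>i\<in>I. of_bool (Q i S) :: real)"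
      using i assms by (intro member_le_sum) auto
    with i show ?thesis by auto
  qed (auto intro: sum_nonneg)
qed (use assms in auto)

lemma rs_mean_split:
  assumes "finite A" "finite B" "A \<inter> B = {}"
  shows "rs_mean p (A \<union> B) f = rs_mean p A (\<lambda>S. rs_mean p B (\<lambda>T. f (S \<union> T)))"
  using assms(1,3)
proof (induction A arbitrary: f rule: finite_induct)
  case (insert x A)
  then have "rs_mean p (insert x A \<union> B) f
     = p * rs_mean p (A \<union> B) (\<lambda>S. f (insert x S)) + (1 - p) * rs_mean p (A \<union> B) f"
    using rs_mean_insert[of "A \<union> B" x p f] assms(2) by auto
  then show ?case using insert by (simp add: rs_mean_insert)
qed simp

lemma rs_prob_superset:
  assumes "finite A" "B \<subseteq> A"
  shows "rs_prob p A (\<lambda>S. B \<subseteq> S) = p ^ card B"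
  using assms
proof (induction A arbitrary: B rule: finite_induct)
  case (insert x A)
  show ?case
  proof (cases "x \<in> B")
    case True
    have 1: "rs_mean p A (\<lambda>S. of_bool (B \<subseteq> S)) = 0"
      using insert True rs_mean_cong[of A "\<lambda>S. of_bool (B \<subseteq> S)" "\<lambda>_. 0" p] by auto
    have 2: "rs_mean p A (\<lambda>S. of_bool (B \<subseteq> insert x S)) = rs_prob p A (\<lambda>S. B - {x} \<subseteq> S)"
      unfolding rs_prob_def by (intro rs_mean_cong) auto
    have "card B = Suc (card (B - {x}))"
      using True insert.prems insert.hyps by (intro card.remove) (auto intro: finite_subset)
    moreover have "B - {x} \<subseteq> A" using insert by auto
    ultimately show ?thesis using insert 1 2 by (simp add: rs_prob_def rs_mean_insert)
  next
    case False
    have 2: "rs_mean p A (\<lambda>S. of_bool (B \<subseteq> insert x S)) = rs_prob p A (\<lambda>S. B \<subseteq> S)"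
      unfolding rs_prob_def using False by (intro rs_mean_cong) auto
    have "B \<subseteq> A" using insert False by auto
    then show ?thesis using insert 2 by (simp add: rs_prob_def rs_mean_insert algebra_simps)
  qed
qed (auto simp: rs_prob_def)

lemma rs_prob_disjoint:
  assumes "finite A" "B \<subseteq> A"
  shows "rs_prob p A (\<lambda>S. B \<inter> S = {}) = (1 - p) ^ card B"
  using assms
proof (induction A arbitrary: B rule: finite_induct)
  case (insert x A)
  show ?case
  proof (cases "x \<in> B")
    case True
    have 2: "rs_mean p A (\<lambda>S. of_bool (B \<inter> S = {})) = rs_prob p A (\<lambda>S. (B - {x}) \<inter> S = {})"
      unfolding rs_prob_def using insert by (intro rs_mean_cong) auto
    have "card B = Suc (card (B - {x}))"
      using True insert.prems insert.hyps by (intro card.remove) (auto intro: finite_subset)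
    moreover have "B - {x} \<subseteq> A" using insert by auto
    ultimately have "rs_prob p A (\<lambda>S. (B - {x}) \<inter> S = {}) = (1 - p) ^ card (B - {x})"
        "(1 - p) ^ card B = (1 - p) * (1 - p) ^ card (B - {x})"
      using insert.IH[of "B - {x}"] by simp_all
    then show ?thesis using insert.hyps 2 True by (simp add: rs_prob_def rs_mean_insert)
  next
    case False
    have 2: "rs_mean p A (\<lambda>S. of_bool (B \<inter> insert x S = {})) = rs_prob p A (\<lambda>S. B \<inter> S = {})"
      unfolding rs_prob_def using False by (intro rs_mean_cong) auto
    have "B \<subseteq> A" using insert False by auto
    then show ?thesis using insert 2 by (simp add: rs_prob_def rs_mean_insert algebra_simps)
  qed
qed (auto simp: rs_prob_def)

text \<open>Q applied to S - {x} cannot see whether x was chosen.\<close>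

lemma rs_prob_indep:
  assumes "finite A" "x \<in> A"
  shows "rs_prob p A (\<lambda>S. x \<in> S \<and> Q (S - {x})) = p * rs_prob p A (\<lambda>S. Q (S - {x}))"
proof -
  let ?B = "A - {x}"
  have A: "A = insert x ?B" and fin: "finite ?B" and x: "x \<notin> ?B" using assms by auto
  have "rs_prob p A (\<lambda>S. x \<in> S \<and> Q (S - {x})) = p * rs_mean p ?B (\<lambda>S. of_bool (Q S))"
  proof -
    have "rs_mean p ?B (\<lambda>S. of_bool (x \<in> S \<and> Q (S - {x}))) = rs_mean p ?B (\<lambda>_. 0)"
      by (intro rs_mean_cong) auto
    moreover have "rs_mean p ?B (\<lambda>S. of_bool (Q (S - {x}))) = rs_mean p ?B (\<lambda>S. of_bool (Q S))"
      by (intro rs_mean_cong) (metis Diff_insert_absorb insert_Diff_if subset_Diff_insert Diff_empty Diff_insert0)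
    ultimately show ?thesis unfolding rs_prob_def
      by (subst A) (simp only: rs_mean_insert[OF fin x], simp add: fin assms(1))
  qed
  moreover have "rs_prob p A (\<lambda>S. Q (S - {x})) = rs_mean p ?B (\<lambda>S. of_bool (Q S))"
  proof -
    have "rs_mean p ?B (\<lambda>S. of_bool (Q (S - {x}))) = rs_mean p ?B (\<lambda>S. of_bool (Q S))"
      by (intro rs_mean_cong) (metis Diff_insert_absorb insert_Diff_if subset_Diff_insert Diff_empty Diff_insert0)
    then show ?thesis unfolding rs_prob_def
      by (subst A) (simp only: rs_mean_insert[OF fin x], simp add: fin assms(1) algebra_simps)
  qed
  ultimately show ?thesis by simp
qed

text \<open>The left side equals exp(-spd) (1 + p (exp(sd) - 1)), hence is at most exp(p (exp(sd) -
  1 - sd)), and exp u \<le> 1 + u + u^2 on [0,1]. The factor p in the exponent is essential: there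
  are of order n^r possible clauses, and only p times their number is of order n.\<close>

lemma bernoulli_mgf_bound:
  fixes p s d c :: real
  assumes "0 \<le> p" "p \<le> 1" "0 \<le> s" "0 \<le> d" "d \<le> c" "s * c \<le> 1"
  shows "p * exp (s * ((1 - p) * d)) + (1 - p) * exp (- (s * (p * d))) \<le> exp (p * s\<^sup>2 * c\<^sup>2)"
proof -
  have sd: "0 \<le> s * d" "s * d \<le> s * c" using assms by (auto intro: mult_left_mono)
  then have e: "exp (s * d) \<le> 1 + s * d + (s * d)\<^sup>2" using assms by (intro exp_bound) auto
  have "p * exp (s * ((1 - p) * d)) + (1 - p) * exp (- (s * (p * d)))
      = exp (- (s * (p * d))) * (1 + p * (exp (s * d) - 1))"
  proof -
    have "exp (s * ((1 - p) * d)) = exp (- (s * (p * d))) * exp (s * d)"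
      unfolding mult_exp_exp by (simp add: algebra_simps)
    then show ?thesis by (simp only:) (simp add: algebra_simps)
  qed
  also have "\<dots> \<le> exp (- (s * (p * d))) * exp (p * (exp (s * d) - 1))"
    by (intro mult_left_mono exp_ge_add_one_self) auto
  also have "\<dots> = exp (p * (exp (s * d) - 1 - s * d))"
    by (simp add: mult_exp_exp algebra_simps)
  also have "\<dots> \<le> exp (p * (s * c)\<^sup>2)"
  proof -
    have "exp (s * d) - 1 - s * d \<le> (s * d)\<^sup>2" using e by simp
    also have "\<dots> \<le> (s * c)\<^sup>2" using sd by (intro power_mono) auto
    finally show ?thesis using assms by (simp add: mult_left_mono)
  qed
  finally show ?thesis by (simp add: power_mult_distrib mult.assoc)
qed

text \<open>The Bernstein-type martingale bound: revealing one element changes the conditional mean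
  by at most c, and this happens with probability p only.\<close>
lemma rs_mgf_bound:
  fixes f :: "'a set \<Rightarrow> real" and p s c :: real
  assumes "finite A" "0 \<le> p" "p \<le> 1" "0 \<le> s" "s * c \<le> 1"
    and "\<And>S x. S \<subseteq> A \<Longrightarrow> x \<in> A \<Longrightarrow> f S \<le> f (insert x S) \<and> f (insert x S) \<le> f S + c"
  shows "rs_mean p A (\<lambda>S. exp (s * (f S - rs_mean p A f))) \<le> exp (card A * (p * s\<^sup>2 * c\<^sup>2))"
  using assms(1,6)
proof (induction A arbitrary: f rule: finite_induct)
  case (insert x A)
  define m1 where "m1 = rs_mean p A (\<lambda>S. f (insert x S))"
  define m0 where "m0 = rs_mean p A f"
  define m where "m = rs_mean p (insert x A) f"
  have m: "m = p * m1 + (1 - p) * m0" unfolding m_def m1_def m0_def using insert by (simp add: rs_mean_insert)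
  have step: "f S \<le> f (insert x S)" "f (insert x S) \<le> f S + c" if "S \<subseteq> A" for S
    using insert.prems[of S x] that by auto
  have "m0 \<le> m1" unfolding m1_def m0_def
    using assms step by (intro rs_mean_mono) auto
  moreover have "m1 \<le> rs_mean p A (\<lambda>S. f S + c)" unfolding m1_def
    using assms step by (intro rs_mean_mono) auto
  ultimately have d: "0 \<le> m1 - m0" "m1 - m0 \<le> c"
    unfolding m0_def using insert.hyps by (simp_all add: rs_mean_add)
  let ?E = "exp (card A * (p * s\<^sup>2 * c\<^sup>2))"
  have IH0: "rs_mean p A (\<lambda>S. exp (s * (f S - m0))) \<le> ?E"
    unfolding m0_def using insert.prems by (intro insert.IH) auto
  have IH1: "rs_mean p A (\<lambda>S. exp (s * (f (insert x S) - m1))) \<le> ?E"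
    unfolding m1_def
  proof (intro insert.IH)
    fix S y assume "S \<subseteq> A" "y \<in> A"
    then show "f (insert x S) \<le> f (insert x (insert y S)) \<and> f (insert x (insert y S)) \<le> f (insert x S) + c"
      using insert.prems[of "insert x S" y] by (auto simp: insert_commute)
  qed
  have "rs_mean p (insert x A) (\<lambda>S. exp (s * (f S - m)))
     = p * rs_mean p A (\<lambda>S. exp (s * (f (insert x S) - m))) + (1 - p) * rs_mean p A (\<lambda>S. exp (s * (f S - m)))"
    using insert by (simp add: rs_mean_insert)
  \<comment> \<open>Recentring: m1 - m = (1-p)(m1 - m0) and m0 - m = -p (m1 - m0), so the two cases
    are the two values of a centred Bernoulli jump of size m1 - m0.\<close>
  also have "rs_mean p A (\<lambda>S. exp (s * (f (insert x S) - m))) =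
     exp (s * ((1 - p) * (m1 - m0))) * rs_mean p A (\<lambda>S. exp (s * (f (insert x S) - m1)))"
    unfolding rs_mean_cmult[symmetric] mult_exp_exp m by (simp add: algebra_simps)
  also have "rs_mean p A (\<lambda>S. exp (s * (f S - m))) =
     exp (- (s * (p * (m1 - m0)))) * rs_mean p A (\<lambda>S. exp (s * (f S - m0)))"
    unfolding rs_mean_cmult[symmetric] mult_exp_exp m by (simp add: algebra_simps)
  also have "p * (exp (s * ((1 - p) * (m1 - m0))) * rs_mean p A (\<lambda>S. exp (s * (f (insert x S) - m1))))
     + (1 - p) * (exp (- (s * (p * (m1 - m0)))) * rs_mean p A (\<lambda>S. exp (s * (f S - m0))))
     \<le> p * (exp (s * ((1 - p) * (m1 - m0))) * ?E) + (1 - p) * (exp (- (s * (p * (m1 - m0)))) * ?E)"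
    using assms IH0 IH1 by (intro add_mono mult_left_mono) auto
  also have "\<dots> = (p * exp (s * ((1 - p) * (m1 - m0))) + (1 - p) * exp (- (s * (p * (m1 - m0))))) * ?E"
    by (simp add: algebra_simps)
  also have "\<dots> \<le> exp (p * s\<^sup>2 * c\<^sup>2) * ?E"
    using assms d by (intro mult_right_mono bernoulli_mgf_bound) auto
  also have "\<dots> = exp (card (insert x A) * (p * s\<^sup>2 * c\<^sup>2))"
    using insert by (simp add: mult_exp_exp algebra_simps)
  finally show ?case unfolding m_def .
qed simp

text \<open>Markov's inequality for exp(s (f - mean)); s stays free, to be optimised once the scale
  of c is known.\<close>

lemma rs_upper_tail:
  fixes f :: "'a set \<Rightarrow> real" and p s c :: real
  assumes "finite A" "0 \<le> p" "p \<le> 1" "0 \<le> s" "s * c \<le> 1"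
    and "\<And>S x. S \<subseteq> A \<Longrightarrow> x \<in> A \<Longrightarrow> f S \<le> f (insert x S) \<and> f (insert x S) \<le> f S + c"
  shows "rs_prob p A (\<lambda>S. f S \<ge> rs_mean p A f + u) \<le> exp (card A * (p * s\<^sup>2 * c\<^sup>2) - s * u)"
proof -
  let ?m = "rs_mean p A f"
  have "rs_prob p A (\<lambda>S. f S \<ge> ?m + u) \<le> rs_mean p A (\<lambda>S. exp (- (s * u)) * exp (s * (f S - ?m)))"
    unfolding rs_prob_def
  proof (rule rs_mean_mono)
    fix S
    have "f S \<ge> ?m + u \<Longrightarrow> 0 \<le> s * (f S - ?m - u)" using assms by (intro mult_nonneg_nonneg) auto
    then show "of_bool (f S \<ge> ?m + u) \<le> exp (- (s * u)) * exp (s * (f S - ?m))"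
      unfolding mult_exp_exp by (auto simp: algebra_simps)
  qed (use assms in auto)
  also have "\<dots> = exp (- (s * u)) * rs_mean p A (\<lambda>S. exp (s * (f S - ?m)))"
    by (rule rs_mean_cmult)
  also have "\<dots> \<le> exp (- (s * u)) * exp (card A * (p * s\<^sup>2 * c\<^sup>2))"
    by (intro mult_left_mono rs_mgf_bound assms) auto
  finally show ?thesis by (simp add: mult_exp_exp algebra_simps)
qed


section \<open>From finite sums back to the probability mass function of the random formula\<close>

lemma expectation_Pi_bernoulli:
  fixes f :: "'a set \<Rightarrow> real" and p s c :: real
  assumes "finite A" "0 \<le> p" "p \<le> 1"
  shows "measure_pmf.expectation (Pi_pmf A False (\<lambda>_. bernoulli_pmf p)) (\<lambda>X. f {C\<in>A. X C}) = rs_mean p A f"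
  using assms(1)
proof (induction A arbitrary: f rule: finite_induct)
  case (insert x A)
  let ?P = "Pi_pmf A False (\<lambda>_. bernoulli_pmf p)"
  have fin: "finite (set_pmf ?P)"
    using insert by (simp add: set_Pi_pmf finite_PiE_dflt)
  have "measure_pmf.expectation (Pi_pmf (insert x A) False (\<lambda>_. bernoulli_pmf p)) (\<lambda>X. f {C\<in>insert x A. X C})
     = measure_pmf.expectation (pair_pmf (bernoulli_pmf p) ?P) (\<lambda>z. f {C\<in>insert x A. ((snd z)(x := fst z)) C})"
    using insert by (simp add: Pi_pmf_insert case_prod_unfold)
  also have "\<dots> = measure_pmf.expectation (bernoulli_pmf p \<bind> (\<lambda>b. map_pmf (Pair b) ?P)) (\<lambda>z. f {C\<in>insert x A. ((snd z)(x := fst z)) C})"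
    by (simp add: pair_pmf_def map_pmf_def)
  also have "\<dots> = p * measure_pmf.expectation ?P (\<lambda>X. f {C\<in>insert x A. (X(x := True)) C})
       + (1 - p) * measure_pmf.expectation ?P (\<lambda>X. f {C\<in>insert x A. (X(x := False)) C})"
    using assms by (subst pmf_expectation_bind[of UNIV]) (auto simp: fin UNIV_bool intro!: finite_imageI)
  also have "(\<lambda>X. f {C\<in>insert x A. (X(x := True)) C}) = (\<lambda>X. f (insert x {C\<in>A. X C}))"
    using insert by (intro ext arg_cong[of _ _ f]) auto
  also have "(\<lambda>X. f {C\<in>insert x A. (X(x := False)) C}) = (\<lambda>X. f {C\<in>A. X C})"
    using insert by (intro ext arg_cong[of _ _ f]) auto
  finally show ?case using insert.IH[of f] insert.IH[of "\<lambda>S. f (insert x S)"] insert by (simp add: rs_mean_insert)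
qed simp

lemma prob_random_formula:
  assumes "0 \<le> p" "p \<le> 1"
  shows "\<P>(F in random_formula r n p. Q F)
    = rs_prob p (possible_clauses r {..<n}) (\<lambda>S. Q ({..<n}, S))"
proof -
  let ?\<Omega> = "possible_clauses r {..<n}"
  have "\<P>(F in random_formula r n p. Q F) = measure_pmf.expectation (random_formula r n p) (indicator {F. Q F})"
    by simp
  also have "\<dots> = measure_pmf.expectation (Pi_pmf ?\<Omega> False (\<lambda>_. bernoulli_pmf p))
      (\<lambda>X. (\<lambda>S. of_bool (Q ({..<n}, S))) {C\<in>?\<Omega>. X C})"
    unfolding random_formula_def integral_map_pmf by (intro Bochner_Integration.integral_cong) (auto simp: indicator_def)
  also have "\<dots> = rs_prob p ?\<Omega> (\<lambda>S. Q ({..<n}, S))"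
    unfolding rs_prob_def using assms by (intro expectation_Pi_bernoulli) auto
  finally show ?thesis .
qed

subsection \<open>Isomorphisms and counting copies\<close>

lemma mff_full: "mff r H \<Longrightarrow> full r H"
  by (simp add: mff_def)

lemma mff_minimal: "mff r H \<Longrightarrow> subformula K H \<Longrightarrow> full r K \<Longrightarrow> K = H"
  unfolding mff_def by blast

lemma full_sat_formula: "full r H \<Longrightarrow> sat_formula r H"
  by (simp add: full_def)

text \<open>A formula all of whose literals are over its own variables. This is what makes the
  effect of a renaming depend only on its values on the variable set.\<close>

definition closed_formula :: "'a formula \<Rightarrow> bool" where
  "closed_formula H \<longleftrightarrow> (\<forall>C\<in>clauses H. C \<subseteq> vars H \<times> UNIV)"

lemma sat_formula_closed: "sat_formula r H \<Longrightarrow> closed_formula H"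
  by (auto simp: sat_formula_def closed_formula_def possible_clauses_def)

lemma vars_map_formula [simp]: "vars (map_formula f S H) = f ` vars H"
  by (simp add: map_formula_def)

lemma clauses_map_formula: "clauses (map_formula f S H) = (\<lambda>C. map_literal f S ` C) ` clauses H"
  by (simp add: map_formula_def)

lemma map_formula_cong:
  assumes "closed_formula H" "\<And>v. v \<in> vars H \<Longrightarrow> f v = g v \<and> (v \<in> S \<longleftrightarrow> v \<in> T)"
  shows "map_formula f S H = map_formula g T H"
proof -
  have "map_literal f S ` C = map_literal g T ` C" if "C \<in> clauses H" for C
  proof (rule image_cong)
    fix l assume "l \<in> C"
    then have "fst l \<in> vars H" using that assms(1) unfolding closed_formula_def by (metis mem_Times_iff subsetD)
    then show "map_literal f S l = map_literal g T l" using assms(2)[of "fst l"]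
      by (simp add: map_literal_def case_prod_unfold)
  qed simp
  then show ?thesis using assms(2) by (auto simp: map_formula_def cong: image_cong)
qed

lemma map_formula_id: "map_formula id {} H = H"
  by (simp add: map_formula_def map_literal_def)

text \<open>Signs add modulo 2, so the flip set of the composition is the symmetric difference of S
  and the preimage of T. It is cut down to \<open>vars H\<close> to fit the normal form used in
  \<open>aut\<close> and \<open>isomorphic\<close>.\<close>

lemma map_formula_comp:
  assumes "closed_formula H"
  shows "map_formula g T (map_formula f S H) = map_formula (g \<circ> f) {v \<in> vars H. (v \<in> S) \<noteq> (f v \<in> T)} H"
proof -
  let ?U = "{v. (v \<in> S) \<noteq> (f v \<in> T)}"
  have "map_literal g T \<circ> map_literal f S = map_literal (g \<circ> f) ?U"
    by (auto simp: map_literal_def fun_eq_iff)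
  then have "map_formula g T (map_formula f S H) = map_formula (g \<circ> f) ?U H"
    by (simp add: map_formula_def image_image) (metis (no_types, lifting) comp_apply image_cong)
  also have "\<dots> = map_formula (g \<circ> f) {v \<in> vars H. (v \<in> S) \<noteq> (f v \<in> T)} H"
    using assms by (intro map_formula_cong) auto
  finally show ?thesis .
qed

lemma closed_map_formula:
  assumes "closed_formula H"
  shows "closed_formula (map_formula f S H)"
  using assms unfolding closed_formula_def clauses_map_formula vars_map_formula
  by (fastforce simp: map_literal_def)

lemma map_formula_inverse:
  assumes "closed_formula H" "vars H \<subseteq> A" "inj_on f A"
  shows "map_formula (inv_into A f) (f ` (S \<inter> A)) (map_formula f S H) = H"
proof -
  have "map_formula (inv_into A f) (f ` (S \<inter> A)) (map_formula f S H)
    = map_formula (inv_into A f \<circ> f) {v \<in> vars H. (v \<in> S) \<noteq> (f v \<in> f ` (S \<inter> A))} H"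
    by (rule map_formula_comp[OF assms(1)])
  also have "\<dots> = map_formula id {} H"
    using assms by (intro map_formula_cong) (auto simp: inj_on_image_mem_iff[OF assms(3)] subset_iff inj_on_def)
  finally show ?thesis by (simp add: map_formula_id)
qed

lemma inj_on_map_literal: "inj_on f A \<Longrightarrow> inj_on (map_literal f S) (A \<times> UNIV)"
  by (auto simp: inj_on_def map_literal_def)

lemma sat_formula_map_formula:
  assumes "sat_formula r H" "inj_on f (vars H)"
  shows "sat_formula r (map_formula f S H)"
  unfolding sat_formula_def
proof (intro conjI subsetI)
  show "finite (vars (map_formula f S H))" using assms by (simp add: sat_formula_def)
  fix D assume "D \<in> clauses (map_formula f S H)"
  then obtain C where C: "C \<in> clauses H" "D = map_literal f S ` C" by (auto simp: clauses_map_formula)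
  then have p: "C \<subseteq> vars H \<times> UNIV" "card C = r" "inj_on fst C"
    using assms by (auto simp: sat_formula_def possible_clauses_def)
  have "card D = r" unfolding C(2) using p inj_on_map_literal[OF assms(2), of S]
    by (metis card_image inj_on_subset)
  moreover have "D \<subseteq> f ` vars H \<times> UNIV" using p unfolding C(2) by (auto simp: map_literal_def)
  moreover have "inj_on fst D"
  proof (rule inj_onI)
    fix x y assume "x \<in> D" "y \<in> D" and e: "fst x = fst y"
    then obtain l m where l: "l \<in> C" "m \<in> C" "x = map_literal f S l" "y = map_literal f S m" using C by auto
    then have "f (fst l) = f (fst m)" using e by (simp add: map_literal_def case_prod_unfold)
    moreover have "fst l \<in> vars H" "fst m \<in> vars H" using l p by auto
    ultimately have "fst l = fst m" using assms(2) by (auto dest: inj_onD)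
    then show "x = y" using l p(3) by (auto dest: inj_onD)
  qed
  ultimately show "D \<in> possible_clauses r (vars (map_formula f S H))" by (simp add: possible_clauses_def)
qed

lemma card_map_formula:
  assumes "closed_formula H" "inj_on f (vars H)"
  shows "card (vars (map_formula f S H)) = card (vars H)"
    "card (clauses (map_formula f S H)) = card (clauses H)"
proof -
  show "card (vars (map_formula f S H)) = card (vars H)" using assms by (simp add: card_image)
  have "inj_on (\<lambda>C. map_literal f S ` C) (clauses H)"
  proof (rule inj_onI)
    fix C D assume "C \<in> clauses H" "D \<in> clauses H" "map_literal f S ` C = map_literal f S ` D"
    then show "C = D" using inj_on_image_eq_iff[OF inj_on_map_literal[OF assms(2), of S], of C D] assms(1)
      by (auto simp: closed_formula_def)
  qed
  then show "card (clauses (map_formula f S H)) = card (clauses H)"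
    unfolding clauses_map_formula by (rule card_image)
qed

lemma full_map_formula:
  assumes "full r H" "inj_on f (vars H)"
  shows "full r (map_formula f S H)"
proof -
  have occ: "\<exists>C\<in>clauses H. (v, b) \<in> C" if "v \<in> vars H" for v b
    using that assms(1) by (cases b) (auto simp: full_def)
  have "\<exists>D\<in>clauses (map_formula f S H). (w, b) \<in> D" if w: "w \<in> vars (map_formula f S H)" for w b
  proof -
    obtain v where v: "v \<in> vars H" "w = f v" using w by auto
    obtain C where C: "C \<in> clauses H" "(v, b \<noteq> (v \<in> S)) \<in> C" using occ v by blast
    have "map_literal f S (v, b \<noteq> (v \<in> S)) = (w, b)" using v by (auto simp: map_literal_def)
    then have "(w, b) \<in> map_literal f S ` C" using C by (metis imageI)
    then show ?thesis using C by (auto simp: clauses_map_formula)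
  qed
  moreover have "clauses (map_formula f S H) \<noteq> {}" using assms by (auto simp: full_def clauses_map_formula)
  ultimately show ?thesis using assms sat_formula_map_formula[of r H f S] by (simp add: full_def)
qed

text \<open>A full subformula of the image is pulled back along the inverse renaming; by minimality
  it comes back as H, and mapping forward again gives the whole image.\<close>

lemma mff_map_formula:
  assumes "mff r H" "inj_on f (vars H)"
  shows "mff r (map_formula f S H)"
proof -
  let ?A = "vars H" and ?K = "map_formula f S H"
  let ?g = "inv_into ?A f" and ?T = "f ` (S \<inter> ?A)"
  have full: "full r H" and cl: "closed_formula H"
    using mff_full[OF assms(1)] sat_formula_closed[OF full_sat_formula] by blast+
  have inv: "map_formula ?g ?T ?K = H" using cl assms by (intro map_formula_inverse) auto
  have "L = ?K" if L: "subformula L ?K" "full r L" for L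
  proof -
    have sub: "vars L \<subseteq> f ` ?A" "clauses L \<subseteq> clauses ?K" using L by (auto simp: subformula_def)
    have g: "inj_on ?g (f ` ?A)" by (rule inj_on_inv_into) simp
    have "full r (map_formula ?g ?T L)" using L g sub by (intro full_map_formula) (auto intro: inj_on_subset)
    moreover have "subformula (map_formula ?g ?T L) (map_formula ?g ?T ?K)"
      using L unfolding subformula_def clauses_map_formula vars_map_formula by blast
    ultimately have e: "map_formula ?g ?T L = map_formula ?g ?T ?K" unfolding inv using mff_minimal[OF assms(1)] by blast
    have clL: "closed_formula L" "closed_formula ?K"
      using L full_map_formula[OF full assms(2), of S] sat_formula_closed[OF full_sat_formula] by blast+
    have inv2: "map_formula (inv_into (f ` ?A) ?g) (?g ` (?T \<inter> f ` ?A)) (map_formula ?g ?T M) = M"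
      if "closed_formula M" "vars M \<subseteq> f ` ?A" for M
      using that g by (intro map_formula_inverse)
    have "L = map_formula (inv_into (f ` ?A) ?g) (?g ` (?T \<inter> f ` ?A)) (map_formula ?g ?T L)"
      by (rule inv2[OF clL(1) sub(1), symmetric])
    also have "\<dots> = map_formula (inv_into (f ` ?A) ?g) (?g ` (?T \<inter> f ` ?A)) (map_formula ?g ?T ?K)"
      by (simp only: e)
    also have "\<dots> = ?K" by (rule inv2[OF clL(2)]) (simp only: vars_map_formula order_refl)
    finally show "L = ?K" .
  qed
  then show ?thesis using full_map_formula[OF full assms(2)] unfolding mff_def by blast
qed

lemma isomorphic_iff:
  "H \<simeq>\<^sub>f K \<longleftrightarrow> (\<exists>f S. inj_on f (vars H) \<and> S \<subseteq> vars H \<and> K = map_formula f S H)"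
  unfolding isomorphic_def bij_betw_def by (metis vars_map_formula)

lemma isomorphic_refl: "H \<simeq>\<^sub>f H"
  unfolding isomorphic_iff using map_formula_id[of H] by (metis empty_subsetI inj_on_id)

lemma isomorphic_sym:
  assumes "closed_formula H" "H \<simeq>\<^sub>f K"
  shows "K \<simeq>\<^sub>f H"
proof -
  obtain f S where f: "inj_on f (vars H)" "S \<subseteq> vars H" "K = map_formula f S H"
    using assms(2) by (auto simp: isomorphic_iff)
  have "inj_on (inv_into (vars H) f) (vars K)" using f by (auto intro: inj_on_inv_into)
  moreover have "f ` (S \<inter> vars H) \<subseteq> vars K" using f by auto
  ultimately show ?thesis
    unfolding isomorphic_iff using map_formula_inverse[OF assms(1) order_refl f(1), of S] f(3) by metis
qed

lemma isomorphic_trans: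
  assumes "closed_formula H" "H \<simeq>\<^sub>f K" "K \<simeq>\<^sub>f L"
  shows "H \<simeq>\<^sub>f L"
proof -
  obtain f S where f: "inj_on f (vars H)" "S \<subseteq> vars H" "K = map_formula f S H"
    using assms(2) by (auto simp: isomorphic_iff)
  obtain g T where g: "inj_on g (vars K)" "T \<subseteq> vars K" "L = map_formula g T K"
    using assms(3) by (auto simp: isomorphic_iff)
  have "inj_on (g \<circ> f) (vars H)" using f g by (auto intro: comp_inj_on)
  then show ?thesis unfolding isomorphic_iff using map_formula_comp[OF assms(1), of g T f S] f(3) g(3)
    by (intro exI[of _ "g \<circ> f"] exI[of _ "{v \<in> vars H. (v \<in> S) \<noteq> (f v \<in> T)}"]) auto
qed

lemma isomorphic_mff:
  assumes "mff r H" "H \<simeq>\<^sub>f K"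
  shows "mff r K" "card (vars K) = card (vars H)" "card (clauses K) = card (clauses H)"
    "excess r K = excess r H"
proof -
  obtain f S where f: "inj_on f (vars H)" "S \<subseteq> vars H" "K = map_formula f S H"
    using assms(2) by (auto simp: isomorphic_iff)
  have "closed_formula H" using mff_full[OF assms(1)] sat_formula_closed[OF full_sat_formula] by blast
  then show "card (vars K) = card (vars H)" "card (clauses K) = card (clauses H)"
    "excess r K = excess r H" using card_map_formula[OF _ f(1), of S] f by (auto simp: excess_def)
  show "mff r K" using f mff_map_formula[OF assms(1)] by auto
qed

lemma mff_closed: "mff r H \<Longrightarrow> closed_formula H"
  using mff_full sat_formula_closed[OF full_sat_formula] by blast

lemma mff_finite_vars: "mff r H \<Longrightarrow> finite (vars H)"
  by (auto simp: mff_def full_def sat_formula_def)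

section \<open>Isomorphism classes of minimal full formulas of a given rank\<close>

definition iso_rel :: "nat \<Rightarrow> nat \<Rightarrow> (nat formula \<times> nat formula) set" where
  "iso_rel r s = {(H, K). H \<in> mffs_of_rank r s \<and> K \<in> mffs_of_rank r s \<and> H \<simeq>\<^sub>f K}"

lemma equiv_iso_rel: "equiv (mffs_of_rank r s) (iso_rel r s)"
proof (rule equivI)
  have cl: "closed_formula H" if "H \<in> mffs_of_rank r s" for H
    using that mff_closed[of r H] by (simp add: mffs_of_rank_def)
  show "iso_rel r s \<subseteq> mffs_of_rank r s \<times> mffs_of_rank r s" by (auto simp: iso_rel_def)
  show "refl_on (mffs_of_rank r s) (iso_rel r s)"
    unfolding refl_on_def iso_rel_def using isomorphic_refl by auto
  show "sym (iso_rel r s)" unfolding sym_def iso_rel_def using isomorphic_sym cl by blast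
  show "trans (iso_rel r s)" unfolding trans_def iso_rel_def using isomorphic_trans cl by blast
qed

lemma mff_classes_alt: "mff_classes r s = mffs_of_rank r s // iso_rel r s"
  by (simp add: mff_classes_def iso_rel_def)

lemma Union_mff_classes: "\<Union>(mff_classes r s) = mffs_of_rank r s"
  unfolding mff_classes_alt by (rule Union_quotient[OF equiv_iso_rel])

lemma mff_class_Image:
  assumes "c \<in> mff_classes r s" "H \<in> c"
  shows "c = iso_rel r s `` {H}"
proof -
  obtain K where K: "c = iso_rel r s `` {K}"
    using assms(1) unfolding mff_classes_alt by (rule quotientE)
  then have "(K, H) \<in> iso_rel r s" using assms(2) by simp
  then show ?thesis unfolding K by (rule equiv_class_eq[OF equiv_iso_rel])
qed

lemma mff_class_eq:
  assumes "c \<in> mff_classes r s" "H \<in> c"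
  shows "c = {K \<in> mffs_of_rank r s. K \<simeq>\<^sub>f H}" "H \<in> mffs_of_rank r s"
proof -
  show H: "H \<in> mffs_of_rank r s" using assms Union_mff_classes by blast
  have "c = iso_rel r s `` {H}" by (rule mff_class_Image[OF assms])
  also have "\<dots> = {K \<in> mffs_of_rank r s. K \<simeq>\<^sub>f H}"
  proof -
    have "H \<simeq>\<^sub>f K \<longleftrightarrow> K \<simeq>\<^sub>f H" if "K \<in> mffs_of_rank r s" for K
    proof -
      have "closed_formula H" "closed_formula K" using H that mff_closed[of r H] mff_closed[of r K] by (simp_all add: mffs_of_rank_def)
      then show ?thesis using isomorphic_sym by blast
    qed
    then show ?thesis using H by (auto simp only: iso_rel_def Image_singleton mem_Collect_eq case_prod_conv)
  qed
  finally show "c = {K \<in> mffs_of_rank r s. K \<simeq>\<^sub>f H}" .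
qed

lemma mff_class_nonempty: "c \<in> mff_classes r s \<Longrightarrow> \<exists>H. H \<in> c"
  unfolding mff_classes_alt using in_quotient_imp_non_empty[OF equiv_iso_rel] by blast

lemma isomorphic_initial_segment:
  fixes H :: "'a formula"
  assumes "finite (vars H)"
  shows "\<exists>K :: nat formula. vars K = {..<card (vars H)} \<and> H \<simeq>\<^sub>f K"
proof -
  obtain f where f: "bij_betw f (vars H) {0..<card (vars H)}"
    using ex_bij_betw_finite_nat[OF assms] by blast
  then have "vars (map_formula f {} H) = {..<card (vars H)}" by (simp add: bij_betw_def atLeast0LessThan)
  moreover have "H \<simeq>\<^sub>f map_formula f {} H" unfolding isomorphic_iff using f by (auto simp: bij_betw_def)
  ultimately show ?thesis by blast
qed

text \<open>The excess bounds the number of variables by B, so every class has a member whose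
  variables are an initial segment of {..<B}, and over this set there are finitely many
  formulas.\<close>

lemma finite_mff_classes:
  assumes "r \<ge> 3"
  shows "finite (mff_classes r s)"
proof -
  define B where "B = nat (int r * mff_excess r s)"
  let ?F = "Pow {..<B} \<times> Pow (Pow ({..<B} \<times> (UNIV :: bool set)))"
  have "mff_classes r s \<subseteq> (\<lambda>H. iso_rel r s `` {H}) ` ?F"
  proof
    fix c assume c: "c \<in> mff_classes r s"
    then obtain H where H: "H \<in> c" using mff_class_nonempty by blast
    note Hr = mff_class_eq(2)[OF c H]
    then have mff: "mff r H" "excess r H = mff_excess r s" by (auto simp: mffs_of_rank_def)
    obtain K :: "nat formula" where K: "vars K = {..<card (vars H)}" "H \<simeq>\<^sub>f K"
      using isomorphic_initial_segment mff_finite_vars[OF mff(1)] by blast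
    note iso = isomorphic_mff[OF mff(1) K(2)]
    have KR: "K \<in> mffs_of_rank r s" using iso mff by (simp add: mffs_of_rank_def)
    have "full r H" using mff by (simp add: mff_def)
    then have "card (vars H) \<le> B" using full_card_bound(1)[OF assms, of H] mff(2) by (simp add: B_def le_nat_iff)
    then have v: "vars K \<subseteq> {..<B}" using K by auto
    moreover have "clauses K \<subseteq> Pow ({..<B} \<times> UNIV)" using mff_closed[OF iso(1)] v by (fastforce simp: closed_formula_def)
    ultimately have "K \<in> ?F" by (metis PowI SigmaI prod.collapse)
    moreover have "c = iso_rel r s `` {K}"
    proof -
      have "(H, K) \<in> iso_rel r s" using Hr KR K by (simp add: iso_rel_def)
      then have "iso_rel r s `` {H} = iso_rel r s `` {K}" by (rule equiv_class_eq[OF equiv_iso_rel])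
      then show ?thesis using mff_class_Image[OF c H] by (rule trans[rotated])
    qed
    ultimately show "c \<in> (\<lambda>H. iso_rel r s `` {H}) ` ?F" by blast
  qed
  then show ?thesis by (rule finite_subset) simp
qed

section \<open>Counting the copies of a formula on n variables\<close>

lemma card_injections:
  assumes "finite A" "finite B"
  shows "card {f \<in> A \<rightarrow>\<^sub>E B. inj_on f A} = (\<Prod>i<card A. card B - i)"
  using assms(1)
proof (induction A rule: finite_induct)
  case empty
  then show ?case by (simp add: PiE_empty_domain)
next
  case (insert x A)
  let ?I = "\<lambda>A. {f \<in> A \<rightarrow>\<^sub>E B. inj_on f A}"
  have finI: "finite (?I A)" using insert assms by (simp add: finite_PiE)
  \<comment> \<open>An injection on \<open>insert x A\<close> is an injection on A together with a
    value for x outside its image.\<close>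
  have "bij_betw (\<lambda>(f, y). f(x := y)) (Sigma (?I A) (\<lambda>f. B - f ` A)) (?I (insert x A))"
  proof (rule bij_betw_byWitness[where f' = "\<lambda>f. (restrict f A, f x)"])
    show "\<forall>p\<in>Sigma (?I A) (\<lambda>f. B - f ` A). (\<lambda>f. (restrict f A, f x)) (case p of (f, y) \<Rightarrow> f(x := y)) = p"
      using insert(2) by (auto simp: PiE_def extensional_def restrict_def fun_eq_iff)
    show "\<forall>f\<in>?I (insert x A). (case (restrict f A, f x) of (f, y) \<Rightarrow> f(x := y)) = f"
      by (auto simp: PiE_def extensional_def restrict_def fun_eq_iff)
    show "(\<lambda>(f, y). f(x := y)) ` Sigma (?I A) (\<lambda>f. B - f ` A) \<subseteq> ?I (insert x A)"
    proof clarify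
      fix f y assume f: "f \<in> A \<rightarrow>\<^sub>E B" "inj_on f A" "y \<in> B" "y \<notin> f ` A"
      have "inj_on (f(x := y)) (insert x A)"
        using f insert(2) by (auto simp: inj_on_def image_iff)
      then show "f(x := y) \<in> insert x A \<rightarrow>\<^sub>E B \<and> inj_on (f(x := y)) (insert x A)" using f(1,3) PiE_fun_upd[of y "\<lambda>_. B" x f A] by simp
    qed
    show "(\<lambda>f. (restrict f A, f x)) ` ?I (insert x A) \<subseteq> Sigma (?I A) (\<lambda>f. B - f ` A)"
      using insert(2) by (auto simp: inj_on_def PiE_iff)
  qed
  then have "card (?I (insert x A)) = card (Sigma (?I A) (\<lambda>f. B - f ` A))"
    by (simp add: bij_betw_same_card)
  also have "\<dots> = (\<Sum>f\<in>?I A. card (B - f ` A))"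
    using finI assms by (intro card_SigmaI) auto
  also have "\<dots> = (\<Sum>f\<in>?I A. card B - card A)"
  proof (intro sum.cong refl)
    fix f assume "f \<in> ?I A"
    then have "f ` A \<subseteq> B" "inj_on f A" by auto
    then show "card (B - f ` A) = card B - card A"
      using insert.hyps(1) by (simp add: card_Diff_subset card_image)
  qed
  finally show ?case using insert by (simp add: lessThan_Suc mult.commute)
qed

text \<open>Closedness excludes formulas with stray literals outside their variable set, which a
  renaming, injective only on that set, could still map onto H.\<close>

definition copies :: "nat \<Rightarrow> 'a formula \<Rightarrow> nat formula set" where
  "copies n H = {K. closed_formula K \<and> vars K \<subseteq> {..<n} \<and> K \<simeq>\<^sub>f H}"

text \<open>Orbit-stabiliser: the signed injections with the same image as (f0, S0) are exactly the
  compositions of (f0, S0) with automorphisms of H. Extensional functions make each injection count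
  once.\<close>

lemma card_fiber_aut:
  assumes cl: "closed_formula H" and f0: "inj_on f0 (vars H)" "f0 \<in> vars H \<rightarrow> B"
  shows "card {(f, S). f \<in> vars H \<rightarrow>\<^sub>E B \<and> inj_on f (vars H) \<and> S \<subseteq> vars H \<and>
            map_formula f S H = map_formula f0 S0 H} = card (aut H)"
proof -
  let ?A = "vars H"
  let ?X = "{(f, S). f \<in> ?A \<rightarrow>\<^sub>E B \<and> inj_on f ?A \<and> S \<subseteq> ?A \<and>
            map_formula f S H = map_formula f0 S0 H}"
  \<comment> \<open>For fixed \<sigma> this takes the symmetric difference with a fixed set, hence
    is an involution in U; the same expression therefore serves for the map and for its
    inverse.\<close>
  let ?tw = "\<lambda>\<sigma> U. {v \<in> ?A. (v \<in> U) \<noteq> (\<sigma> v \<in> S0)}"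
  let ?\<Theta> = "\<lambda>(\<sigma>, U). (restrict (f0 \<circ> \<sigma>) ?A, ?tw \<sigma> U)"
  let ?s = "\<lambda>f v. if v \<in> ?A then inv_into ?A f0 (f v) else v"
  let ?\<Psi> = "\<lambda>(f, S). (?s f, ?tw (?s f) S)"
  have mapeq: "map_formula (restrict (f0 \<circ> \<sigma>) ?A) (?tw \<sigma> U) H = map_formula f0 S0 (map_formula \<sigma> U H)" for \<sigma> U
    unfolding map_formula_comp[OF cl] using cl by (intro map_formula_cong) auto
  have "bij_betw ?\<Theta> (aut H) ?X"
  proof (rule bij_betw_byWitness[where f' = ?\<Psi>])
    show "\<forall>a\<in>aut H. ?\<Psi> (?\<Theta> a) = a"
    proof
      fix a assume "a \<in> aut H"
      then obtain \<sigma> U where a: "a = (\<sigma>, U)" and s: "\<sigma> permutes ?A" "U \<subseteq> ?A" by (auto simp: aut_def)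
      have s1: "?s (restrict (f0 \<circ> \<sigma>) ?A) = \<sigma>"
        using s f0 permutes_in_image[OF s(1)] permutes_not_in[OF s(1)] by (auto simp: fun_eq_iff)
      have s2: "?tw \<sigma> (?tw \<sigma> U) = U" using s by auto
      have s1': "?s (restrict (f0 \<circ> \<sigma>) ?A) v = \<sigma> v" for v by (rule fun_cong[OF s1])
      show "?\<Psi> (?\<Theta> a) = a" unfolding a prod.case s1 s1' s2 ..
    qed
    have bij: "f ` ?A = f0 ` ?A" if "(f, S) \<in> ?X" for f S
    proof -
      have "vars (map_formula f S H) = vars (map_formula f0 S0 H)" using that by simp
      then show ?thesis by (simp only: vars_map_formula)
    qed
    have fs: "f0 (?s f v) = f v" if "(f, S) \<in> ?X" "v \<in> ?A" for f S v
    proof -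
      have "f v \<in> f0 ` ?A" using bij[OF that(1)] that(2) by blast
      then show ?thesis using that(2) by (simp add: f_inv_into_f)
    qed
    show "\<forall>x\<in>?X. ?\<Theta> (?\<Psi> x) = x"
    proof
      fix x assume x: "x \<in> ?X"
      obtain f S where [simp]: "x = (f, S)" by (cases x)
      have "restrict (f0 \<circ> ?s f) ?A = f"
      proof
        fix v show "restrict (f0 \<circ> ?s f) ?A v = f v"
          using x fs[of f S v] by (cases "v \<in> ?A") (auto simp: PiE_def extensional_def)
      qed
      moreover have "?tw (?s f) (?tw (?s f) S) = S" using x by auto
      ultimately show "?\<Theta> (?\<Psi> x) = x" by simp
    qed
    show "?\<Theta> ` aut H \<subseteq> ?X"
    proof clarify
      fix \<sigma> U assume "(\<sigma>, U) \<in> aut H"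
      then have s: "\<sigma> permutes ?A" "U \<subseteq> ?A" "map_formula \<sigma> U H = H" by (auto simp: aut_def)
      have "inj_on (restrict (f0 \<circ> \<sigma>) ?A) ?A"
        using f0 s(1) by (simp add: comp_inj_on permutes_image permutes_inj_on inj_on_restrict_eq)
      moreover have "restrict (f0 \<circ> \<sigma>) ?A \<in> ?A \<rightarrow>\<^sub>E B"
        using f0 permutes_in_image[OF s(1)] by auto
      ultimately show "restrict (f0 \<circ> \<sigma>) ?A \<in> ?A \<rightarrow>\<^sub>E B \<and> inj_on (restrict (f0 \<circ> \<sigma>) ?A) ?A \<and> ?tw \<sigma> U \<subseteq> ?A \<and>
            map_formula (restrict (f0 \<circ> \<sigma>) ?A) (?tw \<sigma> U) H = map_formula f0 S0 H"
        unfolding mapeq s(3) by auto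
    qed
    show "?\<Psi> ` ?X \<subseteq> aut H"
    proof
      fix z assume "z \<in> ?\<Psi> ` ?X"
      then obtain f S where x: "(f, S) \<in> ?X" and z: "z = ?\<Psi> (f, S)" by auto
      let ?U = "?tw (?s f) S"
      have ran: "?s f ` ?A \<subseteq> ?A" using bij[OF x] by (auto intro!: inv_into_into)
      have "inj_on (?s f) ?A"
      proof (rule inj_onI)
        fix v w assume "v \<in> ?A" "w \<in> ?A" "?s f v = ?s f w"
        then have "f v = f w" using fs[OF x] by metis
        then show "v = w" using x \<open>v \<in> ?A\<close> \<open>w \<in> ?A\<close> by (auto dest: inj_onD)
      qed
      moreover have onto: "?s f ` ?A = ?A"
      proof
        show "?A \<subseteq> ?s f ` ?A"
        proof
          fix u assume u: "u \<in> ?A"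
          then obtain v where v: "v \<in> ?A" "f v = f0 u" using bij[OF x] by (metis image_iff)
          then have "?s f v = u" using f0 u by simp
          then show "u \<in> ?s f ` ?A" using v by blast
        qed
      qed (rule ran)
      ultimately have "bij_betw (?s f) ?A ?A" by (simp add: bij_betw_def)
      then have perm: "?s f permutes ?A" by (rule bij_imp_permutes) simp
      have "map_formula f0 S0 (map_formula (?s f) ?U H) = map_formula f S H"
      proof -
        have "map_formula f0 S0 (map_formula (?s f) ?U H) = map_formula (f0 \<circ> ?s f) {v \<in> ?A. (v \<in> ?U) \<noteq> (?s f v \<in> S0)} H"
          by (rule map_formula_comp[OF cl])
        also have "\<dots> = map_formula f S H"
        proof (rule map_formula_cong[OF cl])
          fix v assume v: "v \<in> ?A"
          have "(f0 \<circ> ?s f) v = f v" using fs[OF x v] by (simp only: comp_apply)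
          moreover have "v \<in> {v \<in> ?A. (v \<in> ?U) \<noteq> (?s f v \<in> S0)} \<longleftrightarrow> v \<in> S" using v by blast
          ultimately show "(f0 \<circ> ?s f) v = f v \<and> (v \<in> {v \<in> ?A. (v \<in> ?U) \<noteq> (?s f v \<in> S0)} \<longleftrightarrow> v \<in> S)" by (rule conjI)
        qed
        finally show ?thesis .
      qed
      also have "\<dots> = map_formula f0 S0 H" using x by auto
      finally have e: "map_formula f0 S0 (map_formula (?s f) ?U H) = map_formula f0 S0 H" .
      have cl2: "closed_formula (map_formula (?s f) ?U H)"
        by (rule closed_map_formula[OF cl])
      have "map_formula (?s f) ?U H
          = map_formula (inv_into ?A f0) (f0 ` (S0 \<inter> ?A)) (map_formula f0 S0 (map_formula (?s f) ?U H))"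
        by (rule map_formula_inverse[OF cl2 _ f0(1), symmetric]) (simp only: vars_map_formula onto order_refl)
      also have "\<dots> = map_formula (inv_into ?A f0) (f0 ` (S0 \<inter> ?A)) (map_formula f0 S0 H)"
        by (simp only: e)
      also have "\<dots> = H" by (rule map_formula_inverse[OF cl order_refl f0(1)])
      finally have "map_formula (?s f) ?U H = H" .
      then show "z \<in> aut H" unfolding z aut_def using perm by auto
    qed
  qed
  then show ?thesis by (simp add: bij_betw_same_card)
qed

text \<open>Double counting of pairs (f, S): they number n(n-1)...(n-m+1) 2^m, and each copy arises
  from |aut H| of them.\<close>

lemma card_copies:
  assumes cl: "closed_formula H" and fin: "finite (vars H)"
  shows "card (copies n H) * card (aut H) = (\<Prod>i<card (vars H). n - i) * 2 ^ card (vars H)"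
    "finite (copies n H)"
proof -
  let ?A = "vars H"
  let ?I = "{f \<in> ?A \<rightarrow>\<^sub>E {..<n}. inj_on f ?A}"
  let ?\<Phi> = "\<lambda>(f, S). map_formula f S H"
  let ?P = "?I \<times> Pow ?A"
  have finP: "finite ?P" using fin by (simp add: finite_PiE)
  have img: "?\<Phi> ` ?P = copies n H"
  proof (intro equalityI subsetI)
    fix K assume "K \<in> ?\<Phi> ` ?P"
    then obtain f S where f: "f \<in> ?I" "S \<subseteq> ?A" "K = map_formula f S H" by auto
    then have "H \<simeq>\<^sub>f K" by (auto simp: isomorphic_iff)
    then have "K \<simeq>\<^sub>f H" by (rule isomorphic_sym[OF cl])
    then show "K \<in> copies n H" using f closed_map_formula[OF cl] by (auto simp: copies_def)
  next
    fix K assume K: "K \<in> copies n H"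
    have "H \<simeq>\<^sub>f K" using K isomorphic_sym[of K H] by (simp add: copies_def)
    then obtain g T where g: "inj_on g ?A" "T \<subseteq> ?A" "K = map_formula g T H" by (auto simp: isomorphic_iff)
    have "map_formula (restrict g ?A) T H = K" unfolding g(3) using cl by (intro map_formula_cong) auto
    moreover have "restrict g ?A \<in> ?I" using g K by (auto simp: copies_def inj_on_restrict_eq)
    ultimately show "K \<in> ?\<Phi> ` ?P" using g(2) by (auto intro!: image_eqI[of _ _ "(restrict g ?A, T)"])
  qed
  show "finite (copies n H)" unfolding img[symmetric] using finP by (rule finite_imageI)
  have "card ?P = (\<Sum>K\<in>?\<Phi> ` ?P. card {x \<in> ?P. ?\<Phi> x = K})"
    using sum.image_gen[OF finP, of "\<lambda>_. 1::nat" ?\<Phi>] by simp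
  also have "\<dots> = (\<Sum>K\<in>?\<Phi> ` ?P. card (aut H))"
  proof (rule sum.cong[OF refl])
    fix K assume "K \<in> ?\<Phi> ` ?P"
    then obtain f S where f: "f \<in> ?I" "S \<subseteq> ?A" "K = map_formula f S H" by auto
    have "{x \<in> ?P. ?\<Phi> x = K} = {(g, T). g \<in> ?A \<rightarrow>\<^sub>E {..<n} \<and> inj_on g ?A \<and> T \<subseteq> ?A \<and>
            map_formula g T H = map_formula f S H}" using f(3) by auto
    then show "card {x \<in> ?P. ?\<Phi> x = K} = card (aut H)"
      using card_fiber_aut[OF cl, of f "{..<n}" S] f by auto
  qed
  finally have "card ?P = card (copies n H) * card (aut H)" unfolding img by simp
  moreover have "card ?P = (\<Prod>i<card ?A. n - i) * 2 ^ card ?A"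
    using card_injections[OF fin, of "{..<n}"] fin by (simp add: card_cartesian_product card_Pow)
  ultimately show "card (copies n H) * card (aut H) = (\<Prod>i<card ?A. n - i) * 2 ^ card ?A" by simp
qed

lemma card_aut_pos:
  assumes "finite (vars H)"
  shows "card (aut H) > 0"
proof -
  have "(id, {}) \<in> aut H" by (simp add: aut_def map_formula_id permutes_id)
  moreover have "aut H \<subseteq> {f. f permutes vars H} \<times> Pow (vars H)" by (auto simp: aut_def)
  then have "finite (aut H)" using assms by (rule_tac finite_subset) (auto simp: finite_permutations)
  ultimately show ?thesis by (auto simp: card_gt_0_iff)
qed

subsection \<open>Pure literal elimination\<close>

definition neg_literal :: "'a literal \<Rightarrow> 'a literal" where
  "neg_literal l = (fst l, \<not> snd l)"

lemma neg_literal_simps [simp]: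
  "fst (neg_literal l) = fst l" "neg_literal (neg_literal l) = l" "neg_literal l \<noteq> l" "l \<noteq> neg_literal l"
  by (auto simp: neg_literal_def prod_eq_iff)

lemma inj_neg_literal: "inj neg_literal"
  by (metis injI neg_literal_simps(2))

text \<open>Pure literal elimination as message passing: l is kept if one of its clauses contains no
  other literal whose negation has been lost. The negation of l itself is deliberately not
  consulted. The literals of a full subformula still survive, and the fate of l is decided beyond
  its own clauses, which produces the recursion of a branching tree.\<close>

primrec surv :: "nat \<Rightarrow> 'a literal set set \<Rightarrow> 'a literal set" where
  "surv 0 F = UNIV"
| "surv (Suc t) F = {l. \<exists>C\<in>F. l \<in> C \<and> (\<forall>w\<in>C - {l}. neg_literal w \<in> surv t F)}"

lemma surv_mono: "F \<subseteq> G \<Longrightarrow> surv t F \<subseteq> surv t G"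
proof (induction t)
  case (Suc t)
  then have "surv t F \<subseteq> surv t G" by blast
  then show ?case using Suc.prems unfolding surv.simps by blast
qed simp

text \<open>Each literal of H has a clause inside H, and the negations of the other literals of that
  clause are again literals of H.\<close>

lemma full_literals_surv:
  assumes "full r H" "clauses H \<subseteq> F"
  shows "vars H \<times> UNIV \<subseteq> surv t F"
proof (induction t)
  case (Suc t)
  show ?case
  proof clarify
    fix v b assume "v \<in> vars H"
    then obtain C where C: "C \<in> clauses H" "(v, b) \<in> C" using assms(1) by (cases b) (auto simp: full_def)
    then have "C \<subseteq> vars H \<times> UNIV" using assms(1) by (auto simp: full_def sat_formula_def possible_clauses_def)
    then have "neg_literal w \<in> surv t F" if "w \<in> C" for w
      using Suc that unfolding neg_literal_def by (metis UNIV_I mem_Sigma_iff mem_Times_iff subsetD)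
    then show "(v, b) \<in> surv (Suc t) F" using C assms(2) by auto
  qed
qed simp

section \<open>Influence of a single clause on the survivors\<close>

definition var_degree :: "'a literal set set \<Rightarrow> 'a \<Rightarrow> nat" where
  "var_degree F v = card {C \<in> F. v \<in> fst ` C}"

lemma var_degree_mono: "finite G \<Longrightarrow> F \<subseteq> G \<Longrightarrow> var_degree F v \<le> var_degree G v"
  unfolding var_degree_def by (intro card_mono) auto

text \<open>A literal lost in round t + 1 lies in C0 or shares a clause with a literal whose
  negation was lost in round t. Each earlier loss thus spreads to at most rD literals, and |Y| \<le>
  r + rD |X| unrolls to the stated bound.\<close>

lemma surv_remove_clause:
  assumes fin: "finite F" and C: "C0 \<in> F" and r: "\<And>C. C \<in> F \<Longrightarrow> finite C \<and> card C \<le> r"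
    and D: "\<And>v. var_degree F v \<le> D"
  shows "finite (surv t F - surv t (F - {C0})) \<and> card (surv t F - surv t (F - {C0})) \<le> r * (1 + r * D) ^ t"
proof (induction t)
  case (Suc t)
  let ?X = "surv t F - surv t (F - {C0})"
  let ?Y = "surv (Suc t) F - surv (Suc t) (F - {C0})"
  let ?N = "\<lambda>m. \<Union>{C \<in> F. fst m \<in> fst ` C}"
  have sub: "?Y \<subseteq> C0 \<union> (\<Union>m\<in>?X. ?N m)"
  proof
    fix l assume l: "l \<in> ?Y"
    then obtain C where C: "C \<in> F" "l \<in> C" "\<forall>w\<in>C - {l}. neg_literal w \<in> surv t F" by auto
    show "l \<in> C0 \<union> (\<Union>m\<in>?X. ?N m)"
    proof (cases "C = C0")
      case False
      then have "C \<in> F - {C0}" using C by simp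
      then have "\<not> (\<forall>w\<in>C - {l}. neg_literal w \<in> surv t (F - {C0}))"
        using l C(2) unfolding surv.simps by blast
      then obtain w where w: "w \<in> C - {l}" "neg_literal w \<notin> surv t (F - {C0})" by blast
      then have "neg_literal w \<in> ?X" using C(3) by auto
      moreover have "l \<in> ?N (neg_literal w)" using w C by auto
      ultimately show ?thesis by blast
    qed (use C in auto)
  qed
  have N: "finite (?N m) \<and> card (?N m) \<le> r * D" for m
  proof
    show "finite (?N m)" using fin r by auto
    have "card (?N m) \<le> (\<Sum>C\<in>{C \<in> F. fst m \<in> fst ` C}. card C)"
      by (rule card_Union_le_sum_card)
    also have "\<dots> \<le> (\<Sum>C\<in>{C \<in> F. fst m \<in> fst ` C}. r)" using r by (intro sum_mono) auto
    also have "\<dots> = r * var_degree F (fst m)" by (simp add: var_degree_def mult.commute)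
    also have "\<dots> \<le> r * D" using D by simp
    finally show "card (?N m) \<le> r * D" .
  qed
  have finU: "finite (C0 \<union> (\<Union>m\<in>?X. ?N m))"
    by (intro finite_UnI finite_UN_I conjunct1[OF r[OF C]] conjunct1[OF Suc] conjunct1[OF N])
  have finY: "finite ?Y" by (rule finite_subset[OF sub finU])
  have 1: "card ?Y \<le> card (C0 \<union> (\<Union>m\<in>?X. ?N m))" by (rule card_mono[OF finU sub])
  have 2: "card (C0 \<union> (\<Union>m\<in>?X. ?N m)) \<le> card C0 + card (\<Union>m\<in>?X. ?N m)" by (rule card_Un_le)
  have 3: "card (\<Union>m\<in>?X. ?N m) \<le> (\<Sum>m\<in>?X. card (?N m))" using Suc by (intro card_UN_le) simp
  have 4: "(\<Sum>m\<in>?X. card (?N m)) \<le> (\<Sum>m\<in>?X. r * D)" using N by (intro sum_mono) blast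
  have 5: "(\<Sum>m\<in>?X. r * D) \<le> r * (1 + r * D) ^ t * (r * D)"
    using Suc unfolding sum_constant of_nat_id by (intro mult_le_mono1) blast
  have 6: "card C0 \<le> r" using r C by blast
  have 7: "r \<le> r * (1 + r * D) ^ t" by (simp add: one_le_power)
  have 8: "r * (1 + r * D) ^ Suc t = r * (1 + r * D) ^ t + r * (1 + r * D) ^ t * (r * D)"
    by (simp add: algebra_simps)
  have "card ?Y \<le> r * (1 + r * D) ^ Suc t" using 1 2 3 4 5 6 7 unfolding 8 by linarith
  then show ?case using finY by blast
qed simp

text \<open>The number of surviving literals is a Lipschitz function of the clause set only as long as the
  degrees are bounded; taking the maximum over all subformulas of bounded degree gives a function that is
  Lipschitz everywhere and agrees with the original one on formulas of bounded degree.\<close>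

definition surv_count :: "nat \<Rightarrow> 'a set \<Rightarrow> 'a literal set set \<Rightarrow> nat" where
  "surv_count t V F = card (surv t F \<inter> V \<times> UNIV)"

definition low_degree :: "nat \<Rightarrow> 'a literal set set \<Rightarrow> bool" where
  "low_degree D F \<longleftrightarrow> (\<forall>v. var_degree F v \<le> D)"

definition trunc_surv_count :: "nat \<Rightarrow> nat \<Rightarrow> 'a set \<Rightarrow> 'a literal set set \<Rightarrow> nat" where
  "trunc_surv_count D t V F = Max (surv_count t V ` {G. G \<subseteq> F \<and> low_degree D G})"

lemma low_degree_mono: "finite G \<Longrightarrow> F \<subseteq> G \<Longrightarrow> low_degree D G \<Longrightarrow> low_degree D F"
  unfolding low_degree_def by (meson var_degree_mono le_trans)

lemma surv_count_mono: "finite V \<Longrightarrow> F \<subseteq> G \<Longrightarrow> surv_count t V F \<le> surv_count t V G"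
  unfolding surv_count_def using surv_mono[of F G t] by (intro card_mono) auto

lemma surv_count_le: "finite V \<Longrightarrow> surv_count t V F \<le> 2 * card V"
  unfolding surv_count_def using card_mono[of "V \<times> (UNIV::bool set)" "surv t F \<inter> V \<times> UNIV"]
  by (simp add: card_cartesian_product)

lemma trunc_surv_count_le:
  assumes "finite F"
  shows "\<exists>G\<subseteq>F. low_degree D G \<and> trunc_surv_count D t V F = surv_count t V G"
    and "G \<subseteq> F \<Longrightarrow> low_degree D G \<Longrightarrow> surv_count t V G \<le> trunc_surv_count D t V F"
proof -
  have "finite {G. G \<subseteq> F \<and> low_degree D G}" using assms by (auto intro: finite_subset[of _ "Pow F"])
  then have fin: "finite (surv_count t V ` {G. G \<subseteq> F \<and> low_degree D G})" by simp
  have "{} \<in> {G. G \<subseteq> F \<and> low_degree D G}" by (simp add: low_degree_def var_degree_def)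
  then have "surv_count t V ` {G. G \<subseteq> F \<and> low_degree D G} \<noteq> {}" by blast
  from Max_in[OF fin this] show "\<exists>G\<subseteq>F. low_degree D G \<and> trunc_surv_count D t V F = surv_count t V G"
    unfolding trunc_surv_count_def by auto
  show "G \<subseteq> F \<Longrightarrow> low_degree D G \<Longrightarrow> surv_count t V G \<le> trunc_surv_count D t V F"
    unfolding trunc_surv_count_def using fin by (intro Max_ge) auto
qed

text \<open>For the upper bound, take a maximising G below \<open>insert C0 F\<close> and drop C0
  from it: degrees only decrease, so the rest competes in the maximum for F, and the loss is bounded
  because G itself has low degree.\<close>

lemma trunc_surv_count_lipschitz:
  assumes fin: "finite F" "finite V" and r: "\<And>C. C \<in> insert C0 F \<Longrightarrow> finite C \<and> card C \<le> r"
  shows "trunc_surv_count D t V F \<le> trunc_surv_count D t V (insert C0 F)"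
    "trunc_surv_count D t V (insert C0 F) \<le> trunc_surv_count D t V F + r * (1 + r * D) ^ t"
proof -
  obtain G where G: "G \<subseteq> F" "low_degree D G" "trunc_surv_count D t V F = surv_count t V G"
    using trunc_surv_count_le(1)[OF fin(1), of D t V] by blast
  then show "trunc_surv_count D t V F \<le> trunc_surv_count D t V (insert C0 F)"
    using trunc_surv_count_le(2)[of "insert C0 F" G D t V] fin(1) by (simp add: subset_insertI2)
  obtain G where G: "G \<subseteq> insert C0 F" "low_degree D G" "trunc_surv_count D t V (insert C0 F) = surv_count t V G"
    using trunc_surv_count_le(1)[of "insert C0 F" D t V] fin(1) by (auto simp del: surv.simps)
  have finG: "finite G" by (rule finite_subset[OF G(1)]) (simp add: fin)
  let ?G = "G - {C0}"
  have "surv_count t V G \<le> surv_count t V ?G + r * (1 + r * D) ^ t"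
  proof (cases "C0 \<in> G")
    case True
    have d: "finite (surv t G - surv t ?G) \<and> card (surv t G - surv t ?G) \<le> r * (1 + r * D) ^ t"
      using G r by (intro surv_remove_clause finG True) (auto simp: low_degree_def)
    have "surv t G \<inter> V \<times> UNIV \<subseteq> (surv t ?G \<inter> V \<times> UNIV) \<union> (surv t G - surv t ?G)" by auto
    then have "surv_count t V G \<le> card ((surv t ?G \<inter> V \<times> UNIV) \<union> (surv t G - surv t ?G))"
      unfolding surv_count_def using fin d by (intro card_mono) auto
    also have "\<dots> \<le> surv_count t V ?G + card (surv t G - surv t ?G)"
      unfolding surv_count_def by (rule card_Un_le)
    finally show ?thesis using d by linarith
  qed simp
  also have "surv_count t V ?G \<le> trunc_surv_count D t V F"
    using G fin low_degree_mono[OF finG, of ?G D] by (intro trunc_surv_count_le(2)) auto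
  finally show "trunc_surv_count D t V (insert C0 F) \<le> trunc_surv_count D t V F + r * (1 + r * D) ^ t"
    using G by simp
qed

text \<open>The truncated count never exceeds the true one, so its mean is smaller too; for an upper
  tail the comparison therefore goes the right way, and only formulas of high degree have to be
  added.\<close>

lemma surv_count_upper_tail:
  fixes p s u c :: real
  assumes V: "finite V" and p: "0 \<le> p" "p \<le> 1" and r: "r \<ge> 1"
    and c: "c = real (r * (1 + r * D) ^ t)" and s: "0 \<le> s" "s * c \<le> 1"
  defines "\<Omega> \<equiv> possible_clauses r V"
  shows "rs_prob p \<Omega> (\<lambda>F. surv_count t V F \<ge> rs_mean p \<Omega> (\<lambda>F. real (surv_count t V F)) + u)
    \<le> rs_prob p \<Omega> (\<lambda>F. \<not> low_degree D F) + exp (card \<Omega> * (p * s\<^sup>2 * c\<^sup>2) - s * u)"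
proof -
  let ?g = "\<lambda>F. real (trunc_surv_count D t V F)" and ?f = "\<lambda>F. real (surv_count t V F)"
  have fin\<Omega>: "finite \<Omega>" using V by (simp add: \<Omega>_def)
  have clause: "finite C \<and> card C \<le> r" if "C \<in> \<Omega>" for C
    using that r by (auto simp: \<Omega>_def possible_clauses_def intro: card_ge_0_finite)
  have "rs_mean p \<Omega> ?g \<le> rs_mean p \<Omega> ?f"
  proof (intro rs_mean_mono p)
    fix F assume F: "F \<subseteq> \<Omega>"
    obtain G where "G \<subseteq> F" "trunc_surv_count D t V F = surv_count t V G"
      using trunc_surv_count_le(1)[of F D t V] F fin\<Omega> finite_subset by blast
    then show "?g F \<le> ?f F" using surv_count_mono[OF V] by simp
  qed
  then have "rs_prob p \<Omega> (\<lambda>F. ?f F \<ge> rs_mean p \<Omega> ?f + u)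
     \<le> rs_prob p \<Omega> (\<lambda>F. \<not> low_degree D F \<or> ?g F \<ge> rs_mean p \<Omega> ?g + u)"
  proof (intro rs_prob_mono p)
    fix F assume le: "rs_mean p \<Omega> ?g \<le> rs_mean p \<Omega> ?f" and F: "F \<subseteq> \<Omega>" and h: "?f F \<ge> rs_mean p \<Omega> ?f + u"
    have "low_degree D F \<Longrightarrow> surv_count t V F \<le> trunc_surv_count D t V F"
      using F fin\<Omega> finite_subset by (intro trunc_surv_count_le(2)) auto
    then show "\<not> low_degree D F \<or> ?g F \<ge> rs_mean p \<Omega> ?g + u" using h le by force
  qed
  also have "\<dots> \<le> rs_prob p \<Omega> (\<lambda>F. \<not> low_degree D F) + rs_prob p \<Omega> (\<lambda>F. ?g F \<ge> rs_mean p \<Omega> ?g + u)"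
    by (intro rs_prob_disj p)
  also have "rs_prob p \<Omega> (\<lambda>F. ?g F \<ge> rs_mean p \<Omega> ?g + u) \<le> exp (card \<Omega> * (p * s\<^sup>2 * c\<^sup>2) - s * u)"
  proof (intro rs_upper_tail fin\<Omega> p s)
    fix F C assume F: "F \<subseteq> \<Omega>" and C: "C \<in> \<Omega>"
    have finF: "finite F" by (rule finite_subset[OF F fin\<Omega>])
    have cl: "\<And>C'. C' \<in> insert C F \<Longrightarrow> finite C' \<and> card C' \<le> r" using F C clause by blast
    have "trunc_surv_count D t V F \<le> trunc_surv_count D t V (insert C F)"
      "trunc_surv_count D t V (insert C F) \<le> trunc_surv_count D t V F + r * (1 + r * D) ^ t"
      by (rule trunc_surv_count_lipschitz[OF finF V cl]; simp)+
    then show "?g F \<le> ?g (insert C F) \<and> ?g (insert C F) \<le> ?g F + c"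
      unfolding c by (metis of_nat_add of_nat_le_iff)
  qed
  finally show ?thesis by simp
qed

text \<open>The factor (r-1)! is kept because it enters the threshold; cruder counts suffice
  elsewhere.\<close>

lemma card_clauses_through_literal_le:
  assumes "finite B" "r \<ge> 1"
  shows "card {C. finite C \<and> card C = r \<and> l \<in> C \<and> C - {l} \<subseteq> B} * fact (r - 1) \<le> card B ^ (r - 1)"
proof -
  let ?X = "{C. finite C \<and> card C = r \<and> l \<in> C \<and> C - {l} \<subseteq> B}"
  have "inj_on (\<lambda>C. C - {l}) ?X" by (auto simp: inj_on_def)
  moreover have "(\<lambda>C. C - {l}) ` ?X \<subseteq> {S. S \<subseteq> B \<and> card S = r - 1}" by auto
  ultimately have "card ?X \<le> card {S. S \<subseteq> B \<and> card S = r - 1}"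
    using assms by (intro card_inj_on_le) auto
  also have "\<dots> = card B choose (r - 1)" by (rule n_subsets[OF assms(1)])
  finally show ?thesis using binomial_fact_pow[of "card B" "r - 1"] by (meson le_trans mult_le_mono1)
qed

lemma card_clauses_through_literal:
  assumes "r \<ge> 1"
  shows "card {C \<in> possible_clauses r {..<n}. l \<in> C} \<le> (2 * n) ^ (r - 1)"
proof -
  let ?B = "{..<n} \<times> (UNIV :: bool set)"
  have "{C \<in> possible_clauses r {..<n}. l \<in> C} \<subseteq> {C. finite C \<and> card C = r \<and> l \<in> C \<and> C - {l} \<subseteq> ?B}"
    using assms by (auto simp: possible_clauses_def intro: card_ge_0_finite)
  moreover have "finite {C. finite C \<and> card C = r \<and> l \<in> C \<and> C - {l} \<subseteq> ?B}"
    by (rule finite_subset[of _ "Pow (insert l ?B)"], blast, simp)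
  ultimately have "card {C \<in> possible_clauses r {..<n}. l \<in> C} \<le> card {C. finite C \<and> card C = r \<and> l \<in> C \<and> C - {l} \<subseteq> ?B}"
    by (rule card_mono[rotated])
  also have "\<dots> = card {C. finite C \<and> card C = r \<and> l \<in> C \<and> C - {l} \<subseteq> ?B} * 1" by (rule mult_1_right[symmetric])
  also have "\<dots> \<le> card {C. finite C \<and> card C = r \<and> l \<in> C \<and> C - {l} \<subseteq> ?B} * fact (r - 1)"
    by (intro mult_le_mono2 fact_ge_1)
  also have "\<dots> \<le> card ?B ^ (r - 1)" using assms by (intro card_clauses_through_literal_le) auto
  finally show ?thesis by (simp add: card_cartesian_product mult.commute)
qed

text \<open>Deleting l leaves a clause of size r - 1 through m.\<close>

lemma card_clauses_through_two_literals:
  assumes "r \<ge> 2" "l \<noteq> m"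
  shows "card {C \<in> possible_clauses r {..<n}. l \<in> C \<and> m \<in> C} \<le> (2 * n) ^ (r - 2)"
proof -
  let ?B = "{..<n} \<times> (UNIV :: bool set)"
  let ?X = "{C \<in> possible_clauses r {..<n}. l \<in> C \<and> m \<in> C}"
  have "inj_on (\<lambda>C. C - {l}) ?X" by (auto simp: inj_on_def)
  moreover have "(\<lambda>C. C - {l}) ` ?X \<subseteq> {C \<in> possible_clauses (r - 1) {..<n}. m \<in> C}"
  proof
    fix D assume "D \<in> (\<lambda>C. C - {l}) ` ?X"
    then obtain C where C: "C \<in> possible_clauses r {..<n}" "l \<in> C" "m \<in> C" "D = C - {l}" by auto
    then have "inj_on fst D" by (auto simp: possible_clauses_def intro: inj_on_subset)
    then show "D \<in> {C \<in> possible_clauses (r - 1) {..<n}. m \<in> C}"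
      using C assms by (auto simp: possible_clauses_def)
  qed
  ultimately have "card ?X \<le> card {C \<in> possible_clauses (r - 1) {..<n}. m \<in> C}"
    by (intro card_inj_on_le) auto
  also have "\<dots> \<le> (2 * n) ^ (r - 1 - 1)" using assms by (intro card_clauses_through_literal) auto
  finally show ?thesis by (simp add: numeral_2_eq_2)
qed

lemma card_possible_clauses_le:
  assumes "finite V"
  shows "card (possible_clauses r V) \<le> (2 * card V) ^ r"
proof -
  let ?B = "V \<times> (UNIV :: bool set)"
  have fin: "finite {S. S \<subseteq> ?B \<and> card S = r}" by (rule finite_subset[of _ "Pow ?B"]) (use assms in auto)
  have "card (possible_clauses r V) \<le> card {S. S \<subseteq> ?B \<and> card S = r}"
    by (intro card_mono fin) (auto simp: possible_clauses_def)
  also have "\<dots> = card ?B choose r" using assms by (intro n_subsets) simp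
  also have "\<dots> \<le> (card ?B choose r) * fact r" by simp
  also have "\<dots> \<le> card ?B ^ r" by (rule binomial_fact_pow)
  finally show ?thesis by (simp add: card_cartesian_product mult.commute)
qed

text \<open>A variable of degree above D has D + 1 present clauses among at most 2 (2n)^(r-1)
  candidates; union bound over variables and over such sets of clauses.\<close>

lemma rs_prob_degree_gt:
  assumes p: "0 \<le> p" "p \<le> 1" and r: "r \<ge> 1"
  shows "rs_prob p (possible_clauses r {..<n}) (\<lambda>F. \<not> low_degree D F)
    \<le> real n * ((2 * (2 * real n) ^ (r - 1) * p) ^ Suc D / fact (Suc D))"
proof -
  let ?\<Omega> = "possible_clauses r {..<n}"
  let ?N = "\<lambda>v. {C \<in> ?\<Omega>. v \<in> fst ` C}"
  let ?S = "\<lambda>v. {S. S \<subseteq> ?N v \<and> card S = Suc D}"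
  have N: "card (?N (v :: nat)) \<le> 2 * (2 * n) ^ (r - 1)" for v
  proof -
    have "?N v \<subseteq> {C \<in> ?\<Omega>. (v, True) \<in> C} \<union> {C \<in> ?\<Omega>. (v, False) \<in> C}"
    proof
      fix C assume "C \<in> ?N v"
      then obtain b where "C \<in> ?\<Omega>" "(v, b) \<in> C" by auto
      then show "C \<in> {C \<in> ?\<Omega>. (v, True) \<in> C} \<union> {C \<in> ?\<Omega>. (v, False) \<in> C}" by (cases b) auto
    qed
    then have "card (?N v) \<le> card ({C \<in> ?\<Omega>. (v, True) \<in> C} \<union> {C \<in> ?\<Omega>. (v, False) \<in> C})"
      by (intro card_mono) auto
    also have "\<dots> \<le> card {C \<in> ?\<Omega>. (v, True) \<in> C} + card {C \<in> ?\<Omega>. (v, False) \<in> C}" by (rule card_Un_le)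
    also have "\<dots> \<le> (2 * n) ^ (r - 1) + (2 * n) ^ (r - 1)"
      by (intro add_mono card_clauses_through_literal r)
    finally show ?thesis by simp
  qed
  have finS: "finite (?S v)" for v by (rule finite_subset[of _ "Pow ?\<Omega>"]) auto
  have "rs_prob p ?\<Omega> (\<lambda>F. \<not> low_degree D F) \<le> rs_prob p ?\<Omega> (\<lambda>F. \<exists>v\<in>{..<n}. \<exists>S\<in>?S v. S \<subseteq> F)"
  proof (intro rs_prob_mono p)
    fix F assume F: "F \<subseteq> ?\<Omega>" "\<not> low_degree D F"
    then obtain v where v: "Suc D \<le> var_degree F v" by (auto simp: low_degree_def not_le Suc_le_eq)
    obtain S where S: "S \<subseteq> {C \<in> F. v \<in> fst ` C}" "card S = Suc D"
      by (rule obtain_subset_with_card_n[OF v[unfolded var_degree_def]])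
    have "S \<noteq> {}" using S(2) by auto
    then obtain C where "C \<in> S" by blast
    then have "C \<in> ?\<Omega>" "v \<in> fst ` C" using S F by auto
    then have "v < n" by (auto simp: possible_clauses_def)
    moreover have "S \<in> ?S v" "S \<subseteq> F" using S F by auto
    ultimately show "\<exists>v\<in>{..<n}. \<exists>S\<in>?S v. S \<subseteq> F" by blast
  qed
  also have "\<dots> \<le> (\<Sum>v\<in>{..<n}. rs_prob p ?\<Omega> (\<lambda>F. \<exists>S\<in>?S v. S \<subseteq> F))"
    by (intro rs_prob_Ex p) simp
  also have "\<dots> \<le> (\<Sum>v\<in>{..<n}. (2 * (2 * real n) ^ (r - 1) * p) ^ Suc D / fact (Suc D))"
  proof (rule sum_mono)
    fix v
    have "rs_prob p ?\<Omega> (\<lambda>F. \<exists>S\<in>?S v. S \<subseteq> F) \<le> (\<Sum>S\<in>?S v. rs_prob p ?\<Omega> (\<lambda>F. S \<subseteq> F))"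
      by (intro rs_prob_Ex p finS)
    also have "\<dots> = (\<Sum>S\<in>?S v. p ^ Suc D)"
    proof (intro sum.cong refl)
      fix S assume "S \<in> ?S v"
      then have "S \<subseteq> ?\<Omega>" "card S = Suc D" by auto
      then show "rs_prob p ?\<Omega> (\<lambda>F. S \<subseteq> F) = p ^ Suc D" using rs_prob_superset[of ?\<Omega> S p] by simp
    qed
    also have "\<dots> = (card (?N v) choose Suc D) * p ^ Suc D" by (simp add: n_subsets)
    also have "\<dots> \<le> real (card (?N v)) ^ Suc D / fact (Suc D) * p ^ Suc D"
    proof (rule mult_right_mono)
      have "real ((card (?N v) choose Suc D) * fact (Suc D)) \<le> real (card (?N v) ^ Suc D)"
        by (rule of_nat_mono, rule binomial_fact_pow)
      then show "real (card (?N v) choose Suc D) \<le> real (card (?N v)) ^ Suc D / fact (Suc D)"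
        by (simp add: field_simps del: fact_Suc)
    qed (use p in auto)
    also have "\<dots> \<le> (2 * (2 * real n) ^ (r - 1)) ^ Suc D / fact (Suc D) * p ^ Suc D"
    proof -
      have "real (card (?N v)) \<le> real (2 * (2 * n) ^ (r - 1))" using N[of v] by (simp only: of_nat_le_iff)
      then have "real (card (?N v)) \<le> 2 * (2 * real n) ^ (r - 1)" by simp
      then show ?thesis using p by (intro mult_right_mono divide_right_mono power_mono) auto
    qed
    also have "\<dots> = (2 * (2 * real n) ^ (r - 1) * p) ^ Suc D / fact (Suc D)"
      by (simp only: power_mult_distrib times_divide_eq_left)
    finally show "rs_prob p ?\<Omega> (\<lambda>F. \<exists>S\<in>?S v. S \<subseteq> F) \<le> (2 * (2 * real n) ^ (r - 1) * p) ^ Suc D / fact (Suc D)" .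
  qed
  finally show ?thesis by simp
qed

subsection \<open>The one-step recursion for the survival probability\<close>

text \<open>The variables met when \<open>surv\<close> is unfolded t times from m: a walk enters a
  clause at m, leaves it at another literal w and goes on from the negation of w. It follows the
  recursion of \<open>surv\<close>, so it covers all variables whose clauses can matter.\<close>

primrec reach :: "nat \<Rightarrow> 'a literal set set \<Rightarrow> 'a literal \<Rightarrow> 'a set" where
  "reach 0 F m = {}"
| "reach (Suc t) F m = (\<Union>C\<in>{C \<in> F. m \<in> C}. \<Union>w\<in>C - {m}. insert (fst w) (reach t F (neg_literal w)))"

lemma reach_Suc_iff:
  "u \<in> reach (Suc t) F m \<longleftrightarrow>
    (\<exists>C\<in>F. m \<in> C \<and> (\<exists>w\<in>C - {m}. u = fst w \<or> u \<in> reach t F (neg_literal w)))"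
  by auto

lemma reach_mono: "F \<subseteq> G \<Longrightarrow> reach t F m \<subseteq> reach t G m"
proof (induction t arbitrary: m)
  case (Suc t)
  show ?case
  proof
    fix u assume "u \<in> reach (Suc t) F m"
    then obtain C w where "C \<in> F" "m \<in> C" "w \<in> C - {m}" "u = fst w \<or> u \<in> reach t F (neg_literal w)"
      unfolding reach_Suc_iff by blast
    moreover have "reach t F (neg_literal w) \<subseteq> reach t G (neg_literal w)" by (rule Suc.IH[OF Suc.prems])
    ultimately show "u \<in> reach (Suc t) G m" using Suc.prems unfolding reach_Suc_iff by blast
  qed
qed simp

text \<open>A walk that starts outside the clause C avoids C up to the first time it meets a variable of C.\<close>
lemma reach_remove_clause:
  assumes "m \<notin> C" "u \<in> reach t F m"
  shows "\<exists>u'\<in>insert u (fst ` C). u' \<in> reach t (F - {C}) m"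
  using assms
proof (induction t arbitrary: m)
  case (Suc t)
  from Suc.prems(2) obtain C' w where C': "C' \<in> F" "m \<in> C'" "w \<in> C' - {m}"
      "u = fst w \<or> u \<in> reach t F (neg_literal w)" unfolding reach_Suc_iff by blast
  then have C'F: "C' \<in> F - {C}" using Suc.prems(1) by blast
  have hit: "fst w \<in> reach (Suc t) (F - {C}) m" using C'F C'(2,3) unfolding reach_Suc_iff by blast
  show ?case
  proof (cases "u = fst w \<or> fst w \<in> fst ` C")
    case True
    then show ?thesis using hit by (metis insertCI)
  next
    case False
    then have "neg_literal w \<notin> C" by (metis image_eqI neg_literal_simps(1))
    moreover have "u \<in> reach t F (neg_literal w)" using C'(4) False by blast
    ultimately obtain u' where u': "u' \<in> insert u (fst ` C)" "u' \<in> reach t (F - {C}) (neg_literal w)"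
      using Suc.IH by blast
    then have "u' \<in> reach (Suc t) (F - {C}) m" using C'F C'(2,3) unfolding reach_Suc_iff by blast
    then show ?thesis using u'(1) by blast
  qed
qed simp

text \<open>If the unfolding never meets v, every clause it uses avoids v and is still there after v
  is deleted.\<close>

lemma surv_remove_variable:
  assumes "l \<in> surv t F" "v \<noteq> fst l" "v \<notin> reach t F l"
  shows "l \<in> surv t {C \<in> F. v \<notin> fst ` C}"
  using assms
proof (induction t arbitrary: l)
  case (Suc t)
  from Suc.prems(1) obtain C where C: "C \<in> F" "l \<in> C" "\<forall>w\<in>C - {l}. neg_literal w \<in> surv t F" by auto
  have nr: "v \<noteq> fst w \<and> v \<notin> reach t F (neg_literal w)" if "w \<in> C - {l}" for w
    using Suc.prems(3) C that unfolding reach_Suc_iff by blast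
  have "v \<notin> fst ` C"
  proof
    assume "v \<in> fst ` C"
    then obtain w where "w \<in> C" "v = fst w" by blast
    then show False using nr Suc.prems(2) by (cases "w = l") auto
  qed
  moreover have "neg_literal w \<in> surv t {C \<in> F. v \<notin> fst ` C}" if "w \<in> C - {l}" for w
    using Suc.IH[of "neg_literal w"] C(3) nr[OF that] that by simp
  ultimately show ?case using C(1,2) unfolding surv.simps by blast
qed simp

text \<open>Turns "x is present and Q holds without x" into a product; monotonicity then puts x
  back, so that an induction hypothesis about the whole random set applies.\<close>

lemma rs_prob_remove_le:
  assumes fin: "finite A" and x: "x \<in> A" and p: "0 \<le> p" "p \<le> 1"
    and mono: "\<And>S T. S \<subseteq> T \<Longrightarrow> Q S \<Longrightarrow> Q T"
  shows "rs_prob p A (\<lambda>S. x \<in> S \<and> Q (S - {x})) \<le> p * rs_prob p A Q"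
  unfolding rs_prob_indep[OF fin x]
  using p mono[of "_ - {x}"] by (intro mult_left_mono rs_prob_mono) blast+

lemma possible_clauseD:
  assumes "C \<in> possible_clauses r V" "r \<ge> 1"
  shows "finite C" "card C = r" "C \<subseteq> V \<times> UNIV" "inj_on fst C" "w \<in> C \<Longrightarrow> neg_literal w \<notin> C"
proof -
  show "finite C" "card C = r" "C \<subseteq> V \<times> UNIV" and inj: "inj_on fst C"
    using assms by (auto simp: possible_clauses_def intro: card_ge_0_finite)
  assume w: "w \<in> C"
  show "neg_literal w \<notin> C"
  proof
    assume "neg_literal w \<in> C"
    then have "neg_literal w = w" using inj_onD[OF inj _ _ w, of "neg_literal w"] by simp
    then show False by simp
  qed
qed

text \<open>Union bound over the first clause C of the walk. Either C contains u, which costs one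
  degree of freedom in choosing C, or the walk continues from some negated literal of C and, up to
  its first hit of u or of a variable of C, does not use C. That part is independent of C, with at
  most r starting literals and r + 1 targets.\<close>

lemma rs_prob_reach_step:
  fixes p q :: real
  assumes p: "0 \<le> p" "p \<le> 1" and r: "r \<ge> 2" and q: "0 \<le> q"
    and IH: "\<And>m u. rs_prob p (possible_clauses r {..<n}) (\<lambda>F. u \<in> reach t F m) \<le> q"
  shows "rs_prob p (possible_clauses r {..<n}) (\<lambda>F. u \<in> reach (Suc t) F m)
    \<le> 2 * (2 * real n) ^ (r - 2) * p + (2 * real n) ^ (r - 1) * p * (real r * real (r + 1) * q)"
proof -
  let ?\<Omega> = "possible_clauses r {..<n}"
  let ?M = "{C \<in> ?\<Omega>. m \<in> C}"
  let ?U = "{C \<in> ?\<Omega>. m \<in> C \<and> u \<in> fst ` (C - {m})}"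
  let ?Q = "\<lambda>C G. \<exists>w\<in>C - {m}. \<exists>u'\<in>insert u (fst ` C). u' \<in> reach t G (neg_literal w)"
  have fin\<Omega>: "finite ?\<Omega>" by simp
  have finM: "finite ?M" and finU: "finite ?U" by simp_all
  have "rs_prob p ?\<Omega> (\<lambda>F. u \<in> reach (Suc t) F m)
      \<le> rs_prob p ?\<Omega> (\<lambda>F. (\<exists>C\<in>?U. {C} \<subseteq> F) \<or> (\<exists>C\<in>?M. C \<in> F \<and> ?Q C (F - {C})))"
  proof (intro rs_prob_mono p)
    fix F assume F: "F \<subseteq> ?\<Omega>" "u \<in> reach (Suc t) F m"
    then obtain C w where C: "C \<in> F" "m \<in> C" "w \<in> C - {m}" "u = fst w \<or> u \<in> reach t F (neg_literal w)"
      unfolding reach_Suc_iff by blast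
    have C\<Omega>: "C \<in> ?\<Omega>" using C F by blast
    show "(\<exists>C\<in>?U. {C} \<subseteq> F) \<or> (\<exists>C\<in>?M. C \<in> F \<and> ?Q C (F - {C}))"
    proof (cases "u = fst w")
      case True
      then have "C \<in> ?U" using C C\<Omega> by blast
      then show ?thesis using C(1) by blast
    next
      case False
      have "neg_literal w \<notin> C" using possible_clauseD(5)[OF C\<Omega>, of w] C r by simp
      moreover have "u \<in> reach t F (neg_literal w)" using False C(4) by blast
      ultimately have "\<exists>u'\<in>insert u (fst ` C). u' \<in> reach t (F - {C}) (neg_literal w)"
        by (rule reach_remove_clause)
      then have "?Q C (F - {C})" using C(3) by blast
      moreover have "C \<in> ?M" using C(2) C\<Omega> by blast
      ultimately show ?thesis using C(1) by blast
    qed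
  qed
  also have "\<dots> \<le> rs_prob p ?\<Omega> (\<lambda>F. \<exists>C\<in>?U. {C} \<subseteq> F) + rs_prob p ?\<Omega> (\<lambda>F. \<exists>C\<in>?M. C \<in> F \<and> ?Q C (F - {C}))"
    by (rule rs_prob_disj[OF p])
  also have "\<dots> \<le> (\<Sum>C\<in>?U. rs_prob p ?\<Omega> (\<lambda>F. {C} \<subseteq> F)) + (\<Sum>C\<in>?M. rs_prob p ?\<Omega> (\<lambda>F. C \<in> F \<and> ?Q C (F - {C})))"
    by (intro add_mono rs_prob_Ex p finM finU)
  also have "(\<Sum>C\<in>?U. rs_prob p ?\<Omega> (\<lambda>F. {C} \<subseteq> F)) = (\<Sum>C\<in>?U. p)"
  proof (intro sum.cong refl)
    fix C assume "C \<in> ?U"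
    then show "rs_prob p ?\<Omega> (\<lambda>F. {C} \<subseteq> F) = p" using rs_prob_superset[OF fin\<Omega>, of "{C}" p] by simp
  qed
  also have "\<dots> = card ?U * p" by simp
  also have "\<dots> \<le> 2 * (2 * real n) ^ (r - 2) * p"
  proof (rule mult_right_mono)
    let ?L = "\<lambda>l. if l = m then {} else {C \<in> ?\<Omega>. m \<in> C \<and> l \<in> C}"
    have L: "finite (?L l) \<and> card (?L l) \<le> (2 * n) ^ (r - 2)" for l
      using card_clauses_through_two_literals[OF r, of m l n] by auto
    have "?U \<subseteq> ?L (u, True) \<union> ?L (u, False)"
    proof
      fix C assume "C \<in> ?U"
      then obtain w where w: "C \<in> ?\<Omega>" "m \<in> C" "w \<in> C - {m}" "u = fst w" by blast
      then have "C \<in> ?L w" by simp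
      moreover have "w = (u, True) \<or> w = (u, False)" using w(4) by (cases w) auto
      ultimately show "C \<in> ?L (u, True) \<union> ?L (u, False)" by blast
    qed
    then have "card ?U \<le> card (?L (u, True) \<union> ?L (u, False))" using L by (intro card_mono) blast+
    also have "\<dots> \<le> card (?L (u, True)) + card (?L (u, False))" by (rule card_Un_le)
    also have "\<dots> \<le> (2 * n) ^ (r - 2) + (2 * n) ^ (r - 2)" using L by (intro add_mono) blast+
    finally have "real (card ?U) \<le> real (2 * (2 * n) ^ (r - 2))" by (simp only: of_nat_le_iff mult_2)
    then show "real (card ?U) \<le> 2 * (2 * real n) ^ (r - 2)" by simp
  qed (use p in auto)
  also have "(\<Sum>C\<in>?M. rs_prob p ?\<Omega> (\<lambda>F. C \<in> F \<and> ?Q C (F - {C}))) \<le> (\<Sum>C\<in>?M. p * (real r * real (r + 1) * q))"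
  proof (rule sum_mono)
    fix C assume C: "C \<in> ?M"
    then have C\<Omega>: "C \<in> ?\<Omega>" by blast
    have r1: "r \<ge> 1" using r by simp
    have finC: "finite C" and cC: "card C = r" using possible_clauseD[OF C\<Omega> r1] by blast+
    have "rs_prob p ?\<Omega> (\<lambda>F. C \<in> F \<and> ?Q C (F - {C})) \<le> p * rs_prob p ?\<Omega> (?Q C)"
    proof (rule rs_prob_remove_le[OF fin\<Omega> C\<Omega> p])
      fix S T assume ST: "S \<subseteq> T" "?Q C S"
      then obtain w u' where "w \<in> C - {m}" "u' \<in> insert u (fst ` C)" "u' \<in> reach t S (neg_literal w)" by blast
      moreover have "reach t S (neg_literal w) \<subseteq> reach t T (neg_literal w)" by (rule reach_mono[OF ST(1)])
      ultimately show "?Q C T" by blast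
    qed
    also have "rs_prob p ?\<Omega> (?Q C) \<le> (\<Sum>w\<in>C - {m}. rs_prob p ?\<Omega> (\<lambda>G. \<exists>u'\<in>insert u (fst ` C). u' \<in> reach t G (neg_literal w)))"
      using finC by (intro rs_prob_Ex p) simp
    also have "\<dots> \<le> (\<Sum>w\<in>C - {m}. \<Sum>u'\<in>insert u (fst ` C). rs_prob p ?\<Omega> (\<lambda>G. u' \<in> reach t G (neg_literal w)))"
      using finC by (intro sum_mono rs_prob_Ex p) simp
    also have "\<dots> \<le> (\<Sum>w\<in>C - {m}. \<Sum>u'\<in>insert u (fst ` C). q)"
      by (intro sum_mono IH)
    also have "\<dots> = real (card (C - {m})) * (real (card (insert u (fst ` C))) * q)" by simp
    also have "\<dots> \<le> real r * (real (r + 1) * q)"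
    proof (intro mult_mono)
      show "real (card (C - {m})) \<le> real r" using cC card_Diff1_le[of C m] by simp
      have "card (insert u (fst ` C)) \<le> Suc (card (fst ` C))" by (rule card_insert_le_m1) auto
      also have "\<dots> \<le> Suc r" using card_image_le[OF finC, of fst] cC by simp
      finally show "real (card (insert u (fst ` C))) \<le> real (r + 1)" by simp
    qed (use q in auto)
    finally show "rs_prob p ?\<Omega> (\<lambda>F. C \<in> F \<and> ?Q C (F - {C})) \<le> p * (real r * real (r + 1) * q)"
      using p by (simp add: mult_left_mono mult.assoc)
  qed
  also have "\<dots> = card ?M * (p * (real r * real (r + 1) * q))" by simp
  also have "\<dots> \<le> (2 * real n) ^ (r - 1) * (p * (real r * real (r + 1) * q))"
  proof (rule mult_right_mono)
    have "card ?M \<le> (2 * n) ^ (r - 1)" using r by (intro card_clauses_through_literal) simp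
    then have "real (card ?M) \<le> real ((2 * n) ^ (r - 1))" by (simp only: of_nat_le_iff)
    then show "real (card ?M) \<le> (2 * real n) ^ (r - 1)" by simp
  qed (use p q in auto)
  finally show ?thesis by (simp add: mult.assoc)
qed

text \<open>A lower bound is wanted, so 1 - p \<le> exp(-p) points the wrong way. Instead 1/(1-p) =
  1 + p/(1-p) \<le> exp(p/(1-p)), at the price of a factor 1/(1-p) that tends to 1.\<close>

lemma one_minus_power_ge_exp:
  fixes p :: real
  assumes "0 \<le> p" "p < 1" "real k * (p / (1 - p)) \<le> y"
  shows "exp (- y) \<le> (1 - p) ^ k"
proof -
  have "1 / (1 - p) = 1 + p / (1 - p)" using assms by (simp add: field_simps)
  also have "\<dots> \<le> exp (p / (1 - p))" by (rule exp_ge_add_one_self)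
  finally have "exp (- (p / (1 - p))) \<le> 1 - p" using assms by (simp add: exp_minus field_simps)
  then have "exp (- (p / (1 - p))) ^ k \<le> (1 - p) ^ k" by (intro power_mono) auto
  also have "exp (- (p / (1 - p))) ^ k = exp (- (real k * (p / (1 - p))))"
    by (simp add: exp_of_nat_mult[symmetric])
  finally show ?thesis using assms(3) by (smt (verit) exp_le_cancel_iff)
qed

text \<open>Unless the walk from l returns to its own variable, the other literals of a supporting
  clause already survive in the formula without that variable. That formula is independent of the
  clauses containing l. Given it, the number of clauses that could support l is at most (number of
  survivors)^(r-1)/(r-1)!, and one of them is present with probability 1 - (1-p)^N. The number of
  survivors is replaced by 2nx, the opposite case being charged separately.\<close>

lemma rs_prob_surv_step:
  fixes p x y :: real and l :: "nat literal"
  assumes p: "0 \<le> p" "p < 1" and r: "r \<ge> 2" and x: "0 \<le> x"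
    and y: "(2 * real n * x) ^ (r - 1) / fact (r - 1) * (p / (1 - p)) \<le> y"
  defines "\<Omega> \<equiv> possible_clauses r {..<n}"
  shows "rs_prob p \<Omega> (\<lambda>F. l \<in> surv (Suc t) F)
    \<le> rs_prob p \<Omega> (\<lambda>F. fst l \<in> reach (Suc t) F l) + (1 - exp (- y))
      + rs_prob p \<Omega> (\<lambda>F. real (surv_count t {..<n} F) > 2 * real n * x)"
proof -
  let ?v = "fst l" and ?V = "{..<n}"
  let ?rm = "\<lambda>F. {C \<in> F. ?v \<notin> fst ` C}"
  let ?E = "\<lambda>F. \<exists>C\<in>F. l \<in> C \<and> (\<forall>w\<in>C - {l}. neg_literal w \<in> surv t (?rm F))"
  let ?big = "\<lambda>F. real (surv_count t ?V F) > 2 * real n * x"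
  have p1: "p \<le> 1" using p by simp
  have r1: "r \<ge> 1" using r by simp
  have fin\<Omega>: "finite \<Omega>" by (simp add: \<Omega>_def)
  have "rs_prob p \<Omega> (\<lambda>F. l \<in> surv (Suc t) F) \<le> rs_prob p \<Omega> (\<lambda>F. ?v \<in> reach (Suc t) F l \<or> ?E F)"
  proof (intro rs_prob_mono p(1) p1)
    fix F assume F: "F \<subseteq> \<Omega>" "l \<in> surv (Suc t) F"
    then obtain C where C: "C \<in> F" "l \<in> C" "\<forall>w\<in>C - {l}. neg_literal w \<in> surv t F" by auto
    have C\<Omega>: "C \<in> possible_clauses r ?V" using C F by (auto simp: \<Omega>_def)
    show "?v \<in> reach (Suc t) F l \<or> ?E F"
    proof (cases "?v \<in> reach (Suc t) F l")
      case False
      have "neg_literal w \<in> surv t (?rm F)" if w: "w \<in> C - {l}" for w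
      proof (rule surv_remove_variable)
        show "neg_literal w \<in> surv t F" using C(3) w by blast
        show "?v \<noteq> fst (neg_literal w)"
          using possible_clauseD(4)[OF C\<Omega> r1] C(2) w by (auto dest: inj_onD)
        show "?v \<notin> reach t F (neg_literal w)" using False C w unfolding reach_Suc_iff by blast
      qed
      then show ?thesis using C(1,2) by blast
    qed simp
  qed
  also have "\<dots> \<le> rs_prob p \<Omega> (\<lambda>F. ?v \<in> reach (Suc t) F l) + rs_prob p \<Omega> ?E"
    by (rule rs_prob_disj[OF p(1) p1])
  also have "rs_prob p \<Omega> ?E \<le> (1 - exp (- y)) + rs_prob p \<Omega> ?big"
  proof -
    \<comment> \<open>Only clauses containing l itself go into B. Those with the negation of l stay
      in A, but are invisible to ?rm.\<close>
    define B where "B = {C \<in> \<Omega>. l \<in> C}"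
    define A where "A = \<Omega> - B"
    have AB: "\<Omega> = A \<union> B" "A \<inter> B = {}" "finite A" "finite B" using fin\<Omega> by (auto simp: A_def B_def)
    have inner: "rs_mean p B (\<lambda>T. of_bool (?E (S \<union> T)))
        \<le> (1 - exp (- y)) + rs_mean p B (\<lambda>T. of_bool (?big (S \<union> T)))" if S: "S \<subseteq> A" for S
    proof (cases "?big (?rm S)")
      case True
      have "rs_mean p B (\<lambda>T. of_bool (?E (S \<union> T))) \<le> 1"
        using rs_prob_le_1[OF AB(4) p(1) p1] by (simp add: rs_prob_def)
      \<comment> \<open>Further clauses only add survivors, so here the charged event is certain and
        pays for the trivial bound 1.\<close>
      also have "1 = rs_mean p B (\<lambda>T. of_bool (?big (S \<union> T)))"
      proof -
        have "?big (S \<union> T)" for T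
        proof -
          have "surv_count t ?V (?rm S) \<le> surv_count t ?V (S \<union> T)" by (intro surv_count_mono) auto
          then show ?thesis using True by linarith
        qed
        then show ?thesis using AB(4) by simp
      qed
      also have "\<dots> \<le> (1 - exp (- y)) + \<dots>"
      proof -
        have "0 \<le> (2 * real n * x) ^ (r - 1) / fact (r - 1) * (p / (1 - p))"
          using p x by (intro mult_nonneg_nonneg divide_nonneg_nonneg zero_le_power) auto
        then show ?thesis using y by simp
      qed
      finally show ?thesis .
    next
      case False
      let ?N = "{C \<in> B. \<forall>w\<in>C - {l}. neg_literal w \<in> surv t (?rm S)}"
      have le: "rs_mean p B (\<lambda>T. of_bool (?E (S \<union> T))) \<le> rs_mean p B (\<lambda>T. 1 - of_bool (?N \<inter> T = {}))"
      proof (intro rs_mean_mono p(1) p1)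
        fix T assume T: "T \<subseteq> B"
        have "?N \<inter> T \<noteq> {}" if E: "?E (S \<union> T)"
        proof -
          \<comment> \<open>Every clause of B contains l and hence its variable, so deleting the
            variable erases T and the survivors are determined by S.\<close>
          have rm: "?rm (S \<union> T) = ?rm S" using T by (force simp: B_def)
          from E obtain C where C: "C \<in> S \<union> T" "l \<in> C" "\<forall>w\<in>C - {l}. neg_literal w \<in> surv t (?rm S)"
            unfolding rm by blast
          then have "C \<in> T" using S by (auto simp: A_def B_def)
          then show ?thesis using C T by blast
        qed
        then show "of_bool (?E (S \<union> T)) \<le> 1 - (of_bool (?N \<inter> T = {}) :: real)" by auto
      qed
      have eq: "rs_mean p B (\<lambda>T. 1 - of_bool (?N \<inter> T = {})) = 1 - (1 - p) ^ card ?N"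
        using rs_prob_disjoint[OF AB(4), of ?N p] AB(4) by (simp add: rs_mean_diff rs_prob_def)
      have "exp (- y) \<le> (1 - p) ^ card ?N"
      proof (rule one_minus_power_ge_exp[OF p])
        \<comment> \<open>The literals that may accompany l in a supporting clause: those whose
          negation survives. Negation is injective, so there are as many as survivors.\<close>
        let ?W = "neg_literal ` (surv t (?rm S) \<inter> ?V \<times> UNIV)"
        have finW: "finite ?W" by simp
        have cW: "card ?W = surv_count t ?V (?rm S)"
          unfolding surv_count_def by (rule card_image) (rule inj_on_subset[OF inj_neg_literal], simp)
        have "?N \<subseteq> {C. finite C \<and> card C = r \<and> l \<in> C \<and> C - {l} \<subseteq> ?W}"
        proof
          fix C assume C: "C \<in> ?N"
          then have C\<Omega>: "C \<in> possible_clauses r ?V" by (simp add: B_def \<Omega>_def)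
          note c = possible_clauseD[OF C\<Omega> r1]
          have "w \<in> ?W" if w: "w \<in> C - {l}" for w
          proof (rule image_eqI)
            have "fst w \<in> ?V" using c(3) w by auto
            then show "neg_literal w \<in> surv t (?rm S) \<inter> ?V \<times> UNIV" using C w by (simp add: mem_Times_iff)
          qed simp
          then show "C \<in> {C. finite C \<and> card C = r \<and> l \<in> C \<and> C - {l} \<subseteq> ?W}"
            using c(1,2) C by (auto simp: B_def)
        qed
        moreover have "finite {C. finite C \<and> card C = r \<and> l \<in> C \<and> C - {l} \<subseteq> ?W}"
          by (rule finite_subset[of _ "Pow (insert l ?W)"], blast, simp)
        ultimately have "card ?N \<le> card {C. finite C \<and> card C = r \<and> l \<in> C \<and> C - {l} \<subseteq> ?W}"
          by (rule card_mono[rotated])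
        then have "card ?N * fact (r - 1) \<le> card ?W ^ (r - 1)"
          using card_clauses_through_literal_le[OF finW r1, of l] by (meson le_trans mult_le_mono1)
        then have "real (card ?N * fact (r - 1)) \<le> real (card ?W ^ (r - 1))" by (simp only: of_nat_le_iff)
        also have "real (card ?W ^ (r - 1)) \<le> (2 * real n * x) ^ (r - 1)"
          using False unfolding cW of_nat_power by (intro power_mono) auto
        finally have "real (card ?N) \<le> (2 * real n * x) ^ (r - 1) / fact (r - 1)"
          by (simp add: field_simps)
        then have "real (card ?N) * (p / (1 - p)) \<le> (2 * real n * x) ^ (r - 1) / fact (r - 1) * (p / (1 - p))"
          using p by (intro mult_right_mono) auto
        then show "real (card ?N) * (p / (1 - p)) \<le> y" using y by linarith
      qed
      then have "rs_mean p B (\<lambda>T. of_bool (?E (S \<union> T))) \<le> 1 - exp (- y)" using le eq by linarith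
      moreover have "0 \<le> rs_mean p B (\<lambda>T. of_bool (?big (S \<union> T)))"
        by (intro rs_mean_nonneg p(1) p1) simp
      ultimately show ?thesis by linarith
    qed
    have "rs_prob p \<Omega> ?E = rs_mean p A (\<lambda>S. rs_mean p B (\<lambda>T. of_bool (?E (S \<union> T))))"
      unfolding rs_prob_def AB(1) by (rule rs_mean_split[OF AB(3,4,2)])
    also have "\<dots> \<le> rs_mean p A (\<lambda>S. (1 - exp (- y)) + rs_mean p B (\<lambda>T. of_bool (?big (S \<union> T))))"
      by (intro rs_mean_mono p(1) p1 inner)
    also have "\<dots> = (1 - exp (- y)) + rs_mean p A (\<lambda>S. rs_mean p B (\<lambda>T. of_bool (?big (S \<union> T))))"
      using AB(3) by (simp add: rs_mean_add)
    also have "rs_mean p A (\<lambda>S. rs_mean p B (\<lambda>T. of_bool (?big (S \<union> T)))) = rs_prob p \<Omega> ?big"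
      unfolding rs_prob_def AB(1) by (rule rs_mean_split[OF AB(3,4,2), symmetric])
    finally show ?thesis .
  qed
  finally show ?thesis by simp
qed

lemma rs_mean_surv_count_step:
  fixes p x y q :: real
  assumes p: "0 \<le> p" "p < 1" and r: "r \<ge> 2" and x: "0 \<le> x"
    and y: "(2 * real n * x) ^ (r - 1) / fact (r - 1) * (p / (1 - p)) \<le> y"
    and q: "\<And>m u. rs_prob p (possible_clauses r {..<n}) (\<lambda>F. u \<in> reach (Suc t) F m) \<le> q"
  shows "rs_mean p (possible_clauses r {..<n}) (\<lambda>F. real (surv_count (Suc t) {..<n} F))
    \<le> 2 * real n * (q + (1 - exp (- y))
      + rs_prob p (possible_clauses r {..<n}) (\<lambda>F. real (surv_count t {..<n} F) > 2 * real n * x))"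
proof -
  let ?\<Omega> = "possible_clauses r {..<n}" and ?L = "{..<n} \<times> (UNIV :: bool set)"
  have count: "real (surv_count (Suc t) {..<n} F) = (\<Sum>l\<in>?L. of_bool (l \<in> surv (Suc t) F))" for F
  proof -
    have "surv_count (Suc t) {..<n} F = card {l \<in> ?L. l \<in> surv (Suc t) F}"
      unfolding surv_count_def by (rule arg_cong[of _ _ card]) blast
    also have "real \<dots> = (\<Sum>l\<in>?L. of_bool (l \<in> surv (Suc t) F))"
      by (simp add: sum.If_cases of_bool_def Int_def del: surv.simps)
    finally show ?thesis .
  qed
  have "rs_mean p ?\<Omega> (\<lambda>F. real (surv_count (Suc t) {..<n} F))
      = (\<Sum>l\<in>?L. rs_prob p ?\<Omega> (\<lambda>F. l \<in> surv (Suc t) F))"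
    unfolding count rs_prob_def by (rule rs_mean_sum)
  also have "\<dots> \<le> (\<Sum>l\<in>?L. q + (1 - exp (- y)) + rs_prob p ?\<Omega> (\<lambda>F. real (surv_count t {..<n} F) > 2 * real n * x))"
  proof (rule sum_mono)
    fix l :: "nat literal"
    show "rs_prob p ?\<Omega> (\<lambda>F. l \<in> surv (Suc t) F)
      \<le> q + (1 - exp (- y)) + rs_prob p ?\<Omega> (\<lambda>F. real (surv_count t {..<n} F) > 2 * real n * x)"
      using rs_prob_surv_step[OF p r x y, of l t] q[of "fst l" l] by linarith
  qed
  also have "\<dots> = 2 * real n * (q + (1 - exp (- y))
      + rs_prob p ?\<Omega> (\<lambda>F. real (surv_count t {..<n} F) > 2 * real n * x))"
    by (simp add: card_cartesian_product)
  finally show ?thesis .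
qed

subsection \<open>Subcriticality: no linear-size full subformula\<close>

text \<open>The power of n to be beaten is the excess of rank i plus one, hence unbounded over all
  ranks.\<close>

definition rapidly_vanishing :: "(nat \<Rightarrow> real) \<Rightarrow> bool" where
  "rapidly_vanishing f \<longleftrightarrow> (\<forall>K. f \<in> O(\<lambda>n. 1 / real n ^ K))"

lemma rapidly_vanishing_mono:
  assumes "rapidly_vanishing g" "eventually (\<lambda>n. 0 \<le> f n \<and> f n \<le> g n) sequentially"
  shows "rapidly_vanishing f"
  unfolding rapidly_vanishing_def
proof
  fix K
  have "f \<in> O(g)" using assms(2) by (intro landau_o.big_mono) (auto elim: eventually_mono)
  moreover have "g \<in> O(\<lambda>n. 1 / real n ^ K)" using assms(1) unfolding rapidly_vanishing_def by blast
  ultimately show "f \<in> O(\<lambda>n. 1 / real n ^ K)" by (rule landau_o.big_trans)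
qed

lemma rapidly_vanishing_add: "rapidly_vanishing f \<Longrightarrow> rapidly_vanishing g \<Longrightarrow> rapidly_vanishing (\<lambda>n. f n + g n)"
  unfolding rapidly_vanishing_def by (simp add: sum_in_bigo(1))

lemma bigo_inverse_tendsto_0:
  assumes "f \<in> O(\<lambda>n. 1 / real n)"
  shows "f \<longlonglongrightarrow> 0"
proof -
  obtain c where "eventually (\<lambda>n. norm (f n) \<le> c * norm (1 / real n)) sequentially"
    using assms by (auto elim: landau_o.bigE)
  then have "eventually (\<lambda>n. norm (f n) \<le> c / real n) sequentially" by simp
  moreover have "(\<lambda>n. c / real n) \<longlonglongrightarrow> 0" by real_asymp
  ultimately show ?thesis by (rule Lim_null_comparison)
qed

lemma rapidly_vanishing_tendsto_0:
  assumes "rapidly_vanishing f"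
  shows "f \<longlonglongrightarrow> 0"
proof (rule bigo_inverse_tendsto_0)
  have "f \<in> O(\<lambda>n. 1 / real n ^ 1)" using assms unfolding rapidly_vanishing_def by blast
  then show "f \<in> O(\<lambda>n. 1 / real n)" by simp
qed

text \<open>x^m exp(-x)/m! is a Poisson probability.\<close>

lemma power_div_fact_le_exp:
  fixes x :: real
  assumes "x > 0"
  shows "x ^ m / fact m \<le> exp x"
proof -
  have "x ^ m / fact m * exp (- x) \<le> 1"
    using pmf_le_1[of "poisson_pmf x" m] assms by (simp add: pmf_poisson)
  then show ?thesis by (simp add: exp_minus field_simps)
qed

text \<open>The degree cap: large enough that B^D/D! beats every power of n, small enough that the
  Lipschitz constant stays polylogarithmic.\<close>

definition log_degree :: "nat \<Rightarrow> nat" where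
  "log_degree n = nat \<lceil>ln (real n)\<rceil>"

lemma rapidly_vanishing_power_div_fact:
  fixes B :: real
  assumes "B > 0"
  shows "rapidly_vanishing (\<lambda>n. real n * (B ^ Suc (log_degree n) / fact (Suc (log_degree n))))"
  unfolding rapidly_vanishing_def
proof
  fix K :: nat
  \<comment> \<open>With m \<ge> ln n this gives X^m \<ge> n^(K+1), one power more than K to absorb
    the prefactor n, while (BX)^m/m! \<le> exp(BX) stays bounded.\<close>
  define X where "X = exp (real (Suc K))"
  have X: "X > 0" by (simp add: X_def)
  have bound: "norm (real n * (B ^ Suc (log_degree n) / fact (Suc (log_degree n))))
      \<le> exp (B * X) * norm (1 / real n ^ K)" if n: "n \<ge> 1" for n
  proof -
    define m where "m = Suc (log_degree n)"
    have "ln (real n) \<le> real m" unfolding m_def log_degree_def by linarith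
    then have "exp (real (Suc K) * ln (real n)) \<le> exp (real (Suc K) * real m)"
      unfolding exp_le_cancel_iff by (rule mult_left_mono) simp
    moreover have "exp (real (Suc K) * ln (real n)) = real n ^ Suc K"
      using n by (simp add: exp_of_nat_mult exp_add del: of_nat_Suc power_Suc)
    moreover have "exp (real (Suc K) * real m) = X ^ m"
      unfolding X_def by (metis exp_of_nat_mult mult.commute)
    ultimately have Xm: "real n ^ Suc K \<le> X ^ m" by (simp only:)
    have "B ^ m / fact m * real n ^ Suc K \<le> B ^ m / fact m * X ^ m"
      using assms Xm by (intro mult_left_mono) auto
    also have "\<dots> = (B * X) ^ m / fact m" by (simp add: power_mult_distrib)
    also have "\<dots> \<le> exp (B * X)" using assms X by (intro power_div_fact_le_exp) auto
    finally have "B ^ m / fact m * real n ^ Suc K \<le> exp (B * X)" .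
    then have "real n * (B ^ m / fact m) * real n ^ K \<le> exp (B * X)" by (simp add: mult_ac)
    then have "real n * (B ^ m / fact m) \<le> exp (B * X) / real n ^ K"
      using n by (subst pos_le_divide_eq) auto
    moreover have "0 \<le> real n * (B ^ m / fact m)" using assms by simp
    ultimately show ?thesis unfolding m_def[symmetric] by simp
  qed
  show "(\<lambda>n. real n * (B ^ Suc (log_degree n) / fact (Suc (log_degree n)))) \<in> O(\<lambda>n. 1 / real n ^ K)"
    using eventually_ge_at_top[of 1] by (intro bigoI[of _ "exp (B * X)"]) (rule eventually_mono, assumption, rule bound)
qed

text \<open>With y = ln n + 2 the quotient is a constant times y^q / exp y.\<close>

lemma polylog_div_tendsto_0: "(\<lambda>n. (C * (ln (real n) + 2)) ^ q / real n) \<longlonglongrightarrow> 0"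
proof -
  have y: "filterlim (\<lambda>n. ln (real n) + 2) at_top sequentially" by real_asymp
  have "(\<lambda>n. C ^ q * exp 2 * ((ln (real n) + 2) ^ q / exp (ln (real n) + 2))) \<longlonglongrightarrow> C ^ q * exp 2 * 0"
    by (intro tendsto_intros filterlim_compose[OF tendsto_power_div_exp_0 y])
  moreover have "eventually (\<lambda>n. C ^ q * exp 2 * ((ln (real n) + 2) ^ q / exp (ln (real n) + 2))
      = (C * (ln (real n) + 2)) ^ q / real n) sequentially"
    using eventually_ge_at_top[of 1] by eventually_elim (simp add: exp_add power_mult_distrib)
  ultimately show ?thesis by (simp add: tendsto_cong)
qed

definition lipschitz_bound :: "nat \<Rightarrow> nat \<Rightarrow> nat \<Rightarrow> real" where
  "lipschitz_bound r t n = real (r * (1 + r * log_degree n) ^ t)"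

lemma lipschitz_bound_ge_1: "r \<ge> 1 \<Longrightarrow> lipschitz_bound r t n \<ge> 1"
proof -
  assume "r \<ge> 1"
  then have "1 * 1 \<le> r * (1 + r * log_degree n) ^ t" by (intro mult_le_mono one_le_power) auto
  then show ?thesis unfolding lipschitz_bound_def by (metis mult_1 of_nat_1 of_nat_le_iff)
qed

lemma rapidly_vanishing_exp_lipschitz:
  assumes "\<gamma> > 0" "r \<ge> 1"
  shows "rapidly_vanishing (\<lambda>n. exp (- (\<gamma> * real n / (lipschitz_bound r t n)\<^sup>2)))"
  unfolding rapidly_vanishing_def
proof
  fix K :: nat
  \<comment> \<open>With y = r (ln n + 2) the Lipschitz bound is at most y^(t+1) and ln n \<le> y,
    so its square times ln n is at most y^q; this has to be o(n).\<close>
  let ?q = "2 * (t + 1) + 1"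
  have "eventually (\<lambda>n. (real r * (ln (real n) + 2)) ^ ?q / real n < \<gamma> / (K + 1)) sequentially"
    using polylog_div_tendsto_0[of "real r" ?q] assms by (intro order_tendstoD(2)) auto
  then have "eventually (\<lambda>n. norm (exp (- (\<gamma> * real n / (lipschitz_bound r t n)\<^sup>2)))
      \<le> 1 * norm (1 / real n ^ K)) sequentially"
    using eventually_ge_at_top[of 1]
  proof eventually_elim
    case (elim n)
    let ?y = "real r * (ln (real n) + 2)" and ?c = "lipschitz_bound r t n"
    have ln0: "ln (real n) \<ge> 0" using elim by simp
    have c1: "?c \<ge> 1" by (rule lipschitz_bound_ge_1[OF assms(2)])
    have D: "real (log_degree n) \<le> ln (real n) + 1" unfolding log_degree_def using ln0 by linarith
    have r1: "real r \<ge> 1" using assms(2) by simp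
    have "?c = real r * (1 + real r * real (log_degree n)) ^ t" by (simp add: lipschitz_bound_def)
    also have "\<dots> \<le> ?y * ?y ^ t"
    proof (intro mult_mono power_mono)
      show "real r \<le> ?y" using r1 ln0 mult_left_mono[of 1 "ln (real n) + 2" "real r"] by simp
      have "real r * real (log_degree n) \<le> real r * (ln (real n) + 1)" using D by (intro mult_left_mono) auto
      then show "1 + real r * real (log_degree n) \<le> ?y" using r1 by (simp add: algebra_simps)
    qed (use ln0 in auto)
    finally have cy: "?c \<le> ?y ^ (t + 1)" by simp
    have "1 * (ln (real n) + 2) \<le> ?y" using r1 ln0 by (intro mult_right_mono) auto
    then have lny: "ln (real n) \<le> ?y" by (rule order_trans[rotated]) simp
    have "?c\<^sup>2 * ln (real n) \<le> (?y ^ (t + 1))\<^sup>2 * ?y"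
      using cy c1 lny ln0 r1 by (intro mult_mono power_mono) auto
    also have "\<dots> = ?y ^ ?q"
    proof -
      have "(z ^ (t + 1))\<^sup>2 * z = z ^ ((t + 1) * 2 + 1)" for z :: real
        by (simp only: power_add[of z "(t + 1) * 2" 1] power_mult power_one_right)
      then show ?thesis by (simp only: mult.commute[of 2])
    qed
    also have "\<dots> \<le> \<gamma> / (K + 1) * real n" using elim by (simp add: pos_divide_less_eq less_imp_le)
    finally have "(K + 1) * (?c\<^sup>2 * ln (real n)) \<le> (K + 1) * (\<gamma> / (K + 1) * real n)"
      by (intro mult_left_mono) auto
    then have le: "(K + 1) * (?c\<^sup>2 * ln (real n)) \<le> \<gamma> * real n" by simp
    have "real K * ln (real n) \<le> (K + 1) * ln (real n)" using ln0 by (intro mult_right_mono) auto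
    also have "\<dots> \<le> \<gamma> * real n / ?c\<^sup>2"
      using le c1 by (simp add: pos_le_divide_eq mult_ac)
    finally have "exp (- (\<gamma> * real n / ?c\<^sup>2)) \<le> exp (- (real K * ln (real n)))" by simp
    also have "\<dots> = 1 / real n ^ K" using elim by (simp add: exp_minus exp_of_nat_mult inverse_eq_divide)
    finally show ?case by simp
  qed
  then show "(\<lambda>n. exp (- (\<gamma> * real n / (lipschitz_bound r t n)\<^sup>2))) \<in> O(\<lambda>n. 1 / real n ^ K)"
    by (rule bigoI)
qed

text \<open>Upper bounds on probabilities and first moments ask only for an upper bound on the
  non-negative p. That p is at most 1 holds eventually, which is why most estimates below are
  eventual ones.\<close>

locale sparse_sat =
  fixes r :: nat and p :: "nat \<Rightarrow> real" and a :: real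
  assumes r: "r \<ge> 3" and a: "a > 0"
    and p_nonneg: "\<And>n. n \<ge> 1 \<Longrightarrow> 0 \<le> p n"
    and p_le: "\<And>n. n \<ge> 1 \<Longrightarrow> p n \<le> a / real n ^ (r - 1)"
begin

abbreviation pr :: "nat \<Rightarrow> (nat literal set set \<Rightarrow> bool) \<Rightarrow> real" where
  "pr n Q \<equiv> rs_prob (p n) (possible_clauses r {..<n}) Q"

abbreviation mean_surv :: "nat \<Rightarrow> nat \<Rightarrow> real" where
  "mean_surv t n \<equiv> rs_mean (p n) (possible_clauses r {..<n}) (\<lambda>F. real (surv_count t {..<n} F))"

text \<open>Up to constants these are the expected numbers of clauses through one literal, through
  two literals, and in all.\<close>

lemma power_p_le:
  assumes "n \<ge> 1"
  shows "real n ^ (r - 1) * p n \<le> a" "real n ^ (r - 2) * p n \<le> a / real n" "real n ^ r * p n \<le> a * real n"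
proof -
  have n: "real n > 0" using assms by simp
  have "p n * real n ^ (r - 1) \<le> a" using p_le[OF assms] n by (simp add: pos_le_divide_eq)
  then show 1: "real n ^ (r - 1) * p n \<le> a" by (simp add: mult.commute)
  have e: "real n ^ (r - 1) = real n * real n ^ (r - 2)" "real n ^ r = real n * real n ^ (r - 1)"
  proof -
    have s: "Suc (r - 2) = r - 1" "Suc (r - 1) = r" using r by simp_all
    show "real n ^ (r - 1) = real n * real n ^ (r - 2)" "real n ^ r = real n * real n ^ (r - 1)"
      using power_Suc[of "real n" "r - 2"] power_Suc[of "real n" "r - 1"] unfolding s by simp_all
  qed
  have "real n * (real n ^ (r - 2) * p n) \<le> a" using 1 unfolding e by (simp add: mult_ac)
  then show "real n ^ (r - 2) * p n \<le> a / real n" using n by (simp add: pos_le_divide_eq mult_ac)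
  have "real n * (real n ^ (r - 1) * p n) \<le> real n * a" using 1 n by (intro mult_left_mono) auto
  then show "real n ^ r * p n \<le> a * real n" unfolding e by (simp add: mult_ac)
qed

lemma eventually_p_less:
  assumes "\<delta> > 0"
  shows "eventually (\<lambda>n. n \<ge> 1 \<and> 0 \<le> p n \<and> p n < \<delta>) sequentially"
proof -
  have "(\<lambda>n. a / real n) \<longlonglongrightarrow> 0" by real_asymp
  then have "eventually (\<lambda>n. a / real n < \<delta>) sequentially" using assms by (rule order_tendstoD(2))
  then show ?thesis using eventually_ge_at_top[of 1]
  proof eventually_elim
    case (elim n)
    have "1 * p n \<le> real n ^ (r - 2) * p n"
      using elim p_nonneg[of n] by (intro mult_right_mono one_le_power) auto
    then show ?case using power_p_le(2)[of n] elim p_nonneg[of n] by simp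
  qed
qed

lemma eventually_p_le_1: "eventually (\<lambda>n. n \<ge> 1 \<and> 0 \<le> p n \<and> p n \<le> 1) sequentially"
  using eventually_p_less[of 1] by (auto elim: eventually_mono)

text \<open>A step hits u directly with probability O(1/n) and otherwise branches into an expected
  bounded number of continuations, each hitting a bounded set of targets with probability O(1/n) by
  induction. The constant grows with t, which is harmless for fixed t.\<close>

lemma reach_prob_bound:
  "\<exists>K\<ge>0. eventually (\<lambda>n. \<forall>m u. pr n (\<lambda>F. u \<in> reach t F m) \<le> K / real n) sequentially"
proof (induction t)
  case 0
  have "pr n (\<lambda>F. u \<in> reach 0 F m) = 0" for n m u by (simp add: rs_prob_def)
  then show ?case by (intro exI[of _ 0]) (simp del: reach.simps)
next
  case (Suc t)
  then obtain K where K: "K \<ge> 0"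
    "eventually (\<lambda>n. \<forall>m u. pr n (\<lambda>F. u \<in> reach t F m) \<le> K / real n) sequentially" by blast
  define K' where "K' = 2 * 2 ^ (r - 2) * a + 2 ^ (r - 1) * a * (real r * real (r + 1) * K)"
  have "eventually (\<lambda>n. \<forall>m u. pr n (\<lambda>F. u \<in> reach (Suc t) F m) \<le> K' / real n) sequentially"
    using K(2) eventually_p_le_1
  proof eventually_elim
    case (elim n)
    show ?case
    proof (intro allI)
      fix m u
      have n: "n \<ge> 1" and p: "0 \<le> p n" "p n \<le> 1" using elim by auto
      have "pr n (\<lambda>F. u \<in> reach (Suc t) F m)
        \<le> 2 * (2 * real n) ^ (r - 2) * p n + (2 * real n) ^ (r - 1) * p n * (real r * real (r + 1) * (K / real n))"
        using r K(1) elim by (intro rs_prob_reach_step p) auto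
      also have "\<dots> = 2 * 2 ^ (r - 2) * (real n ^ (r - 2) * p n)
          + 2 ^ (r - 1) * (real n ^ (r - 1) * p n) * (real r * real (r + 1) * (K / real n))"
        by (simp add: power_mult_distrib mult_ac)
      also have "\<dots> \<le> 2 * 2 ^ (r - 2) * (a / real n)
          + 2 ^ (r - 1) * a * (real r * real (r + 1) * (K / real n))"
        using power_p_le[OF n] K(1) by (intro add_mono mult_mono mult_left_mono mult_right_mono) auto
      also have "\<dots> = K' / real n" by (simp add: K'_def add_divide_distrib)
      finally show "pr n (\<lambda>F. u \<in> reach (Suc t) F m) \<le> K' / real n" .
    qed
  qed
  moreover have "K' \<ge> 0" using K(1) a by (simp add: K'_def)
  ultimately show ?case by blast
qed

lemma rapidly_vanishing_high_degree: "rapidly_vanishing (\<lambda>n. pr n (\<lambda>F. \<not> low_degree (log_degree n) F))"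
proof (rule rapidly_vanishing_mono)
  show "rapidly_vanishing (\<lambda>n. real n * ((2 * 2 ^ (r - 1) * a) ^ Suc (log_degree n) / fact (Suc (log_degree n))))"
    using a by (intro rapidly_vanishing_power_div_fact) simp
  show "eventually (\<lambda>n. 0 \<le> pr n (\<lambda>F. \<not> low_degree (log_degree n) F)
    \<and> pr n (\<lambda>F. \<not> low_degree (log_degree n) F)
    \<le> real n * ((2 * 2 ^ (r - 1) * a) ^ Suc (log_degree n) / fact (Suc (log_degree n)))) sequentially"
    using eventually_p_le_1
  proof eventually_elim
    case (elim n)
    let ?m = "Suc (log_degree n)"
    have p: "0 \<le> p n" "p n \<le> 1" using elim by auto
    have "pr n (\<lambda>F. \<not> low_degree (log_degree n) F) \<le> real n * ((2 * (2 * real n) ^ (r - 1) * p n) ^ ?m / fact ?m)"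
      using r by (intro rs_prob_degree_gt p) auto
    also have "2 * (2 * real n) ^ (r - 1) * p n = 2 * 2 ^ (r - 1) * (real n ^ (r - 1) * p n)"
      by (simp add: power_mult_distrib mult_ac)
    also have "real n * ((2 * 2 ^ (r - 1) * (real n ^ (r - 1) * p n)) ^ ?m / fact ?m) \<le> real n * ((2 * 2 ^ (r - 1) * a) ^ ?m / fact ?m)"
      using power_p_le(1)[of n] elim by (intro mult_left_mono divide_right_mono power_mono) auto
    finally show ?case using rs_prob_nonneg[OF p] by (intro conjI)
  qed
qed

lemma rapidly_vanishing_surv_tail:
  assumes \<eta>: "\<eta> > 0"
  shows "rapidly_vanishing (\<lambda>n. pr n (\<lambda>F. real (surv_count t {..<n} F) \<ge> mean_surv t n + \<eta> * real n))"
proof (rule rapidly_vanishing_mono)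
  \<comment> \<open>2^r a n bounds the expected number of clauses; the summand \<eta> ensures s c
    \<le> 1 below, as the exponential bound requires.\<close>
  define A where "A = 2 ^ r * a + \<eta>"
  have A: "A > 0" "A \<ge> \<eta>" using a \<eta> by (auto simp: A_def intro: add_pos_pos)
  define \<gamma> where "\<gamma> = \<eta>\<^sup>2 / (4 * A)"
  have "\<gamma> > 0" using A \<eta> by (simp add: \<gamma>_def)
  then show "rapidly_vanishing (\<lambda>n. pr n (\<lambda>F. \<not> low_degree (log_degree n) F)
      + exp (- (\<gamma> * real n / (lipschitz_bound r t n)\<^sup>2)))"
    using r by (intro rapidly_vanishing_add rapidly_vanishing_high_degree rapidly_vanishing_exp_lipschitz) auto
  show "eventually (\<lambda>n. 0 \<le> pr n (\<lambda>F. real (surv_count t {..<n} F) \<ge> mean_surv t n + \<eta> * real n)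
    \<and> pr n (\<lambda>F. real (surv_count t {..<n} F) \<ge> mean_surv t n + \<eta> * real n)
    \<le> pr n (\<lambda>F. \<not> low_degree (log_degree n) F)
      + exp (- (\<gamma> * real n / (lipschitz_bound r t n)\<^sup>2))) sequentially"
    using eventually_p_le_1
  proof eventually_elim
    case (elim n)
    let ?\<Omega> = "possible_clauses r {..<n}"
    define c where "c = lipschitz_bound r t n"
    \<comment> \<open>The minimiser of A n (sc)^2 - s \<eta> n; its value is - \<eta>^2 n / (4 A
      c^2), which explains \<gamma>.\<close>
    define s where "s = \<eta> / (2 * A * c\<^sup>2)"
    have p: "0 \<le> p n" "p n \<le> 1" using elim by auto
    have c1: "c \<ge> 1" unfolding c_def using r by (intro lipschitz_bound_ge_1) simp
    have s0: "0 \<le> s" using \<eta> A by (simp add: s_def)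
    have "s * c = \<eta> / (2 * A * c)" using c1 by (simp add: s_def power2_eq_square)
    also have "\<dots> \<le> 1"
    proof -
      have "A * 1 \<le> A * (2 * c)" using A c1 by (intro mult_left_mono) auto
      then have "\<eta> \<le> 2 * A * c" using A(2) by (simp add: mult_ac)
      then show ?thesis using A c1 by simp
    qed
    finally have sc: "s * c \<le> 1" .
    have 1: "pr n (\<lambda>F. real (surv_count t {..<n} F) \<ge> mean_surv t n + \<eta> * real n)
      \<le> pr n (\<lambda>F. \<not> low_degree (log_degree n) F) + exp (card ?\<Omega> * (p n * s\<^sup>2 * c\<^sup>2) - s * (\<eta> * real n))"
      using r s0 sc by (intro surv_count_upper_tail p) (auto simp: c_def lipschitz_bound_def)
    have 2: "exp (card ?\<Omega> * (p n * s\<^sup>2 * c\<^sup>2) - s * (\<eta> * real n)) \<le> exp (- (\<gamma> * real n / c\<^sup>2))"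
    proof -
      have "real (card ?\<Omega>) \<le> real ((2 * n) ^ r)"
        using card_possible_clauses_le[of "{..<n}" r] by (simp only: of_nat_le_iff card_lessThan finite_lessThan)
      then have "real (card ?\<Omega>) * p n \<le> (2 * real n) ^ r * p n" using p by (intro mult_right_mono) auto
      also have "\<dots> = 2 ^ r * (real n ^ r * p n)" by (simp add: power_mult_distrib mult_ac)
      also have "\<dots> \<le> 2 ^ r * (a * real n)" using power_p_le(3)[of n] elim by (intro mult_left_mono) auto
      also have "\<dots> \<le> A * real n" using \<eta> by (simp add: A_def algebra_simps)
      finally have "real (card ?\<Omega>) * p n * (s * c)\<^sup>2 \<le> A * real n * (s * c)\<^sup>2" by (intro mult_right_mono) auto
      moreover have "A * real n * (s * c)\<^sup>2 - s * (\<eta> * real n) = - (\<gamma> * real n / c\<^sup>2)"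
        using A c1 unfolding s_def \<gamma>_def by (simp add: field_simps power2_eq_square)
      ultimately have "card ?\<Omega> * (p n * s\<^sup>2 * c\<^sup>2) - s * (\<eta> * real n) \<le> - (\<gamma> * real n / c\<^sup>2)"
        by (simp add: power_mult_distrib mult_ac)
      then show ?thesis by simp
    qed
    show ?case
      using rs_prob_nonneg[OF p] order_trans[OF 1 add_left_mono[OF 2]] unfolding c_def by (intro conjI)
  qed
qed

text \<open>One round of elimination. The mean fraction of survivors falls from x to at most x -
  3\<eta>/4 for large n; concentration gives back \<eta>/4, so a bound x becomes x - \<eta>/2 and
  the exceptional probability stays superpolynomially small.\<close>

lemma rapidly_vanishing_surv_step:
  assumes neg: "rapidly_vanishing (\<lambda>n. pr n (\<lambda>F. real (surv_count t {..<n} F) > 2 * real n * x))"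
    and x: "0 \<le> x" and \<eta>: "\<eta> > 0" and b: "a < b"
    and \<phi>: "1 - exp (- (2 ^ (r - 1) * b / fact (r - 1) * x ^ (r - 1))) \<le> x - \<eta>"
  shows "rapidly_vanishing (\<lambda>n. pr n (\<lambda>F. real (surv_count (Suc t) {..<n} F) > 2 * real n * (x - \<eta> / 2)))"
proof (rule rapidly_vanishing_mono)
  let ?y = "2 ^ (r - 1) * b / fact (r - 1) * x ^ (r - 1)"
  obtain K where K: "K \<ge> 0"
    "eventually (\<lambda>n. \<forall>m u. pr n (\<lambda>F. u \<in> reach (Suc t) F m) \<le> K / real n) sequentially"
    using reach_prob_bound[of "Suc t"] by blast
  have "(\<lambda>n. K / real n) \<longlonglongrightarrow> 0" by real_asymp
  then have K8: "eventually (\<lambda>n. K / real n < \<eta> / 8) sequentially" using \<eta> by (intro order_tendstoD(2)) auto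
  have big8: "eventually (\<lambda>n. pr n (\<lambda>F. real (surv_count t {..<n} F) > 2 * real n * x) < \<eta> / 8) sequentially"
    using rapidly_vanishing_tendsto_0[OF neg] \<eta> by (intro order_tendstoD(2)) auto
  \<comment> \<open>p < (b - a)/b means a \<le> b (1 - p), so b absorbs the factor 1/(1-p) of the
    one-step bound.\<close>
  have \<delta>: "(b - a) / b > 0" using a b by simp
  show "rapidly_vanishing (\<lambda>n. pr n (\<lambda>F. real (surv_count (Suc t) {..<n} F) \<ge> mean_surv (Suc t) n + \<eta> / 2 * real n))"
    using \<eta> by (intro rapidly_vanishing_surv_tail) simp
  show "eventually (\<lambda>n. 0 \<le> pr n (\<lambda>F. real (surv_count (Suc t) {..<n} F) > 2 * real n * (x - \<eta> / 2))
    \<and> pr n (\<lambda>F. real (surv_count (Suc t) {..<n} F) > 2 * real n * (x - \<eta> / 2))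
    \<le> pr n (\<lambda>F. real (surv_count (Suc t) {..<n} F) \<ge> mean_surv (Suc t) n + \<eta> / 2 * real n)) sequentially"
    using K(2) K8 big8 eventually_p_less[OF \<delta>] eventually_p_less[of 1, simplified]
  proof eventually_elim
    case (elim n)
    have n: "n \<ge> 1" and p: "0 \<le> p n" "p n < 1" "p n \<le> 1" using elim by auto
    have "p n * b \<le> b - a" using elim(4) a b by (simp add: pos_less_divide_eq)
    then have "a \<le> b * (1 - p n)" by (simp add: algebra_simps)
    then have "real n ^ (r - 1) * p n \<le> b * (1 - p n)" using power_p_le(1)[OF n] by linarith
    then have pb: "real n ^ (r - 1) * (p n / (1 - p n)) \<le> b" using p by (simp add: pos_divide_le_eq)
    have "(2 * real n * x) ^ (r - 1) / fact (r - 1) * (p n / (1 - p n))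
        = 2 ^ (r - 1) * x ^ (r - 1) / fact (r - 1) * (real n ^ (r - 1) * (p n / (1 - p n)))"
      by (simp add: power_mult_distrib mult_ac)
    also have "\<dots> \<le> 2 ^ (r - 1) * x ^ (r - 1) / fact (r - 1) * b"
      using pb x by (intro mult_left_mono) auto
    also have "\<dots> = ?y" by (simp add: mult_ac)
    finally have y: "(2 * real n * x) ^ (r - 1) / fact (r - 1) * (p n / (1 - p n)) \<le> ?y" .
    have "mean_surv (Suc t) n \<le> 2 * real n * (\<eta> / 8 + (1 - exp (- ?y))
      + pr n (\<lambda>F. real (surv_count t {..<n} F) > 2 * real n * x))"
    proof (rule rs_mean_surv_count_step[OF p(1,2) _ x y])
      fix m u
      show "pr n (\<lambda>F. u \<in> reach (Suc t) F m) \<le> \<eta> / 8"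
        using elim(1,2) by (meson less_imp_le order_trans)
    qed (use r in simp)
    \<comment> \<open>The two summands \<eta>/8 pay for walks that return to their start and for an
      excessive number of survivors in the previous round.\<close>
    also have "\<dots> \<le> 2 * real n * (\<eta> / 8 + (x - \<eta>) + \<eta> / 8)"
      using elim(3) \<phi> by (intro mult_left_mono add_mono) auto
    finally have "mean_surv (Suc t) n + \<eta> / 2 * real n \<le> 2 * real n * (x - \<eta> / 2)"
      by (simp add: algebra_simps)
    then have "pr n (\<lambda>F. real (surv_count (Suc t) {..<n} F) > 2 * real n * (x - \<eta> / 2))
      \<le> pr n (\<lambda>F. real (surv_count (Suc t) {..<n} F) \<ge> mean_surv (Suc t) n + \<eta> / 2 * real n)"
      by (intro rs_prob_mono p) linarith
    then show ?case using rs_prob_nonneg[OF p(1,3)] by (intro conjI)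
  qed
qed

text \<open>By compactness x - \<phi>(x) has a positive minimum \<eta> on an interval bounded away
  from 0, so a number of rounds independent of n brings the fraction of survivors below \<epsilon>.
  A full subformula on \<epsilon> n variables would keep 2 \<epsilon> n literals alive.\<close>

lemma rapidly_vanishing_large_full:
  assumes b: "a < b" and \<epsilon>: "\<epsilon> > 0" "\<epsilon> \<le> 1"
    and \<phi>: "\<And>x. 0 < x \<Longrightarrow> x \<le> 1 \<Longrightarrow> 1 - exp (- (2 ^ (r - 1) * b / fact (r - 1) * x ^ (r - 1))) < x"
  shows "rapidly_vanishing (\<lambda>n. pr n (\<lambda>F. \<exists>H. subformula H ({..<n}, F) \<and> full r H \<and> real (card (vars H)) \<ge> \<epsilon> * real n))"
proof -
  let ?\<phi> = "\<lambda>x. 1 - exp (- (2 ^ (r - 1) * b / fact (r - 1) * x ^ (r - 1)))"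
  \<comment> \<open>The interval must stay away from the fixed point 0, where the gap vanishes; half
    of \<epsilon> leaves the strict inequality needed at the end.\<close>
  define e where "e = \<epsilon> / 2"
  have e: "0 < e" "e < \<epsilon>" "e \<le> 1" using \<epsilon> by (auto simp: e_def)
  have "continuous_on {e..1} (\<lambda>x. x - ?\<phi> x)" by (intro continuous_intros)
  then obtain x0 where x0: "x0 \<in> {e..1}" "\<And>x. x \<in> {e..1} \<Longrightarrow> x0 - ?\<phi> x0 \<le> x - ?\<phi> x"
    using continuous_attains_inf[of "{e..1}" "\<lambda>x. x - ?\<phi> x"] e by auto
  define \<eta> where "\<eta> = x0 - ?\<phi> x0"
  have \<eta>: "\<eta> > 0" using \<phi>[of x0] x0(1) e by (auto simp: \<eta>_def)
  have gap: "?\<phi> x \<le> x - \<eta>" if "e \<le> x" "x \<le> 1" for x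
    using x0(2)[of x] that by (simp add: \<eta>_def)
  \<comment> \<open>The number of rounds is left existential: once x \<le> e no further round is
    run, since the gap is available only above e.\<close>
  have "\<exists>t x. 0 \<le> x \<and> x \<le> 1 \<and> x \<le> max e (1 - real k * (\<eta> / 2)) \<and>
      rapidly_vanishing (\<lambda>n. pr n (\<lambda>F. real (surv_count t {..<n} F) > 2 * real n * x))" for k
  proof (induction k)
    case 0
    have "\<not> (real (surv_count 0 {..<n} F) > 2 * real n * 1)" for n F
      using surv_count_le[of "{..<n}" 0 F] by simp
    then have "rapidly_vanishing (\<lambda>n. pr n (\<lambda>F. real (surv_count 0 {..<n} F) > 2 * real n * 1))"
      by (simp add: rs_prob_def rapidly_vanishing_def)
    then show ?case by (intro exI[of _ 0] exI[of _ 1]) auto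
  next
    case (Suc k)
    then obtain t x where tx: "0 \<le> x" "x \<le> 1" "x \<le> max e (1 - real k * (\<eta> / 2))"
      "rapidly_vanishing (\<lambda>n. pr n (\<lambda>F. real (surv_count t {..<n} F) > 2 * real n * x))" by blast
    show ?case
    proof (cases "x \<le> e")
      case True
      then show ?thesis using tx by (intro exI[of _ t] exI[of _ x]) auto
    next
      case False
      then have g: "?\<phi> x \<le> x - \<eta>" using gap tx by simp
      have "0 \<le> ?\<phi> x" using a b tx by simp
      then have "0 \<le> x - \<eta> / 2" using g \<eta> by linarith
      moreover have "x - \<eta> / 2 \<le> max e (1 - real (Suc k) * (\<eta> / 2))"
        using tx(3) False \<eta> unfolding of_nat_Suc distrib_right by linarith
      ultimately show ?thesis using tx(2) \<eta> rapidly_vanishing_surv_step[OF tx(4,1) \<eta> b g]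
        by (intro exI[of _ "Suc t"] exI[of _ "x - \<eta> / 2"]) auto
    qed
  qed
  \<comment> \<open>For such k the linear term is negative, so the maximum is e.\<close>
  moreover obtain k where "1 < real k * (\<eta> / 2)" using reals_Archimedean3[of "\<eta> / 2"] \<eta> by (metis half_gt_zero)
  ultimately obtain t x where tx: "0 \<le> x" "x \<le> max e (1 - real k * (\<eta> / 2))"
      "rapidly_vanishing (\<lambda>n. pr n (\<lambda>F. real (surv_count t {..<n} F) > 2 * real n * x))" by blast
  have xe: "x < \<epsilon>" using tx(2) \<open>1 < real k * (\<eta> / 2)\<close> e by auto
  show ?thesis
  proof (rule rapidly_vanishing_mono[OF tx(3)])
    show "eventually (\<lambda>n. 0 \<le> pr n (\<lambda>F. \<exists>H. subformula H ({..<n}, F) \<and> full r H \<and> real (card (vars H)) \<ge> \<epsilon> * real n)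
    \<and> pr n (\<lambda>F. \<exists>H. subformula H ({..<n}, F) \<and> full r H \<and> real (card (vars H)) \<ge> \<epsilon> * real n)
    \<le> pr n (\<lambda>F. real (surv_count t {..<n} F) > 2 * real n * x)) sequentially"
      using eventually_p_le_1
    proof eventually_elim
      case (elim n)
      have p: "0 \<le> p n" "p n \<le> 1" and n: "n \<ge> 1" using elim by auto
      have "pr n (\<lambda>F. \<exists>H. subformula H ({..<n}, F) \<and> full r H \<and> real (card (vars H)) \<ge> \<epsilon> * real n)
        \<le> pr n (\<lambda>F. real (surv_count t {..<n} F) > 2 * real n * x)"
      proof (rule rs_prob_mono[OF p])
        fix F assume "\<exists>H. subformula H ({..<n}, F) \<and> full r H \<and> real (card (vars H)) \<ge> \<epsilon> * real n"
        then obtain H where H: "subformula H ({..<n}, F)" "full r H" "real (card (vars H)) \<ge> \<epsilon> * real n" by blast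
        have sub: "vars H \<subseteq> {..<n}" "clauses H \<subseteq> F" using H(1) by (simp_all add: subformula_def)
        have "vars H \<times> UNIV \<subseteq> surv t F \<inter> {..<n} \<times> UNIV"
          using full_literals_surv[OF H(2) sub(2), of t] sub(1) by blast
        then have "card (vars H \<times> (UNIV :: bool set)) \<le> surv_count t {..<n} F"
          unfolding surv_count_def by (intro card_mono) auto
        then have "2 * card (vars H) \<le> surv_count t {..<n} F" by (simp add: card_cartesian_product)
        then have "2 * real (card (vars H)) \<le> real (surv_count t {..<n} F)" by linarith
        moreover have "real n * x < real n * \<epsilon>" using xe n by (intro mult_strict_left_mono) auto
        ultimately show "real (surv_count t {..<n} F) > 2 * real n * x" using H(3) by (simp add: mult.commute)
      qed
      then show ?case using rs_prob_nonneg[OF p] by (intro conjI)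
    qed
  qed
qed

end

text \<open>Evaluate the function under the infimum at the very y in the exponent. With z = 1 -
  exp(-y) its value is b x^(r-1) / z^(r-1), and as b is below the infimum, z < x follows. The
  threshold is thus exactly the point up to which the recursion has no positive fixed point.\<close>

lemma below_threshold_contraction:
  assumes "r \<ge> 3" "0 < b" "b < pure_literal_threshold r" "0 < x"
  shows "1 - exp (- (2 ^ (r - 1) * b / fact (r - 1) * x ^ (r - 1))) < x"
proof -
  define y where "y = 2 ^ (r - 1) * b / fact (r - 1) * x ^ (r - 1)"
  define z where "z = 1 - exp (- y)"
  have y: "y > 0" using assms by (simp add: y_def)
  then have z: "z > 0" by (simp add: z_def)
  let ?f = "\<lambda>y::real. fact (r - 1) * y / (2 ^ (r - 1) * (1 - exp (- y)) ^ (r - 1))"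
  have "pure_literal_threshold r \<le> ?f y"
    unfolding pure_literal_threshold_def
  proof (rule cINF_lower)
    \<comment> \<open>Boundedness from below makes the real infimum a lower bound for its
      values.\<close>
    show "bdd_below (?f ` {0<..})"
      by (rule bdd_belowI[of _ 0]) auto
  qed (use y in simp)
  then have "b < fact (r - 1) * y / (2 ^ (r - 1) * z ^ (r - 1))" using assms by (simp add: z_def)
  also have "\<dots> = b * x ^ (r - 1) / z ^ (r - 1)" by (simp add: y_def)
  finally have "b * z ^ (r - 1) < b * x ^ (r - 1)" using z by (simp add: pos_less_divide_eq)
  then have "z ^ (r - 1) < x ^ (r - 1)" using assms by simp
  then have "z < x" by (rule power_less_imp_less_base) (use assms in simp)
  then show ?thesis by (simp add: z_def y_def)
qed

subsection \<open>First moment of medium-size minimal full subformulas\<close>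

lemma binomial_le_power_div_fact: "real (n choose k) \<le> real n ^ k / fact k"
proof -
  have "real ((n choose k) * fact k) \<le> real (n ^ k)" by (rule of_nat_mono, rule binomial_fact_pow)
  then show ?thesis by (simp add: field_simps)
qed

text \<open>Expected number of m-variable, k-clause candidates. Stirling-type bounds give (en/m)^m
  for the variables, and since 2m \<le> rk the clause count (2m)^r/k is O(m^(r-1)), so each clause
  contributes at most \<beta> (m/n)^(r-1). What remains is (m/n) to the excess x = (r-1)k - m, and
  2m \<le> rk with r \<ge> 3 gives x \<ge> m/r.\<close>

lemma first_moment_term_bound:
  fixes p a \<beta> :: real and r m k n :: nat
  assumes m: "m \<ge> 1" "m \<le> n" and k: "2 * m \<le> r * k" "k \<le> 2 * m" and r: "r \<ge> 3"
    and p: "0 \<le> p" "p \<le> a / real n ^ (r - 1)" and a: "a > 0"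
    and \<beta>: "\<beta> \<ge> 1" "exp 1 * (real r * 2 ^ (r - 1) * a) \<le> \<beta>"
  shows "real (n choose m) * ((real ((2 * m) ^ r)) ^ k / fact k * p ^ k)
    \<le> (exp 1 * \<beta>\<^sup>2) ^ m * (real m / real n) ^ ((r - 1) * k - m)"
    "m \<le> r * ((r - 1) * k - m)"
proof -
  let ?x = "(r - 1) * k - m"
  have npos: "real n > 0" "real m > 0" using m by auto
  have k0: "k > 0" using k m by (cases k) auto
  have "r * m + m \<le> r * ((r - 1) * k)"
  proof -
    have "r * m + m \<le> (r - 1) * (2 * m)"
    proof -
      obtain q where "r = q + 3" using r by (metis le_Suc_ex add.commute)
      then show ?thesis by (simp add: algebra_simps)
    qed
    also have "\<dots> \<le> (r - 1) * (r * k)" by (rule mult_le_mono2[OF k(1)])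
    finally show ?thesis by (simp add: mult_ac)
  qed
  then show rx: "m \<le> r * ?x" by (simp add: diff_mult_distrib2)
  have "r * m \<le> r * ((r - 1) * k)" using \<open>r * m + m \<le> r * ((r - 1) * k)\<close> by (rule add_leD1)
  then have mk: "m \<le> (r - 1) * k" using r unfolding mult_le_cancel1 by linarith
  have 1: "real (n choose m) \<le> (real n / real m) ^ m * exp 1 ^ m"
  proof -
    have "real (n choose m) \<le> real n ^ m / fact m" by (rule binomial_le_power_div_fact)
    also have "\<dots> = (real n / real m) ^ m * (real m ^ m / fact m)" using npos by (simp add: power_divide)
    also have "\<dots> \<le> (real n / real m) ^ m * exp (real m)"
      using npos by (intro mult_left_mono power_div_fact_le_exp) auto
    finally show ?thesis using exp_of_nat_mult[of m "1::real"] by simp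
  qed
  have 2: "(real ((2 * m) ^ r)) ^ k / fact k * p ^ k \<le> \<beta> ^ k * (real m / real n) ^ ((r - 1) * k)"
  proof -
    let ?N = "real ((2 * m) ^ r)"
    have "real k ^ k / fact k \<le> exp (real k)" using k0 by (intro power_div_fact_le_exp) simp
    then have f: "1 / fact k \<le> exp 1 ^ k / real k ^ k"
      using k0 exp_of_nat_mult[of k "1::real"] by (simp add: field_simps)
    have "?N ^ k / fact k * p ^ k = (?N * p) ^ k * (1 / fact k)" by (simp add: power_mult_distrib)
    also have "\<dots> \<le> (?N * p) ^ k * (exp 1 ^ k / real k ^ k)" using p f by (intro mult_left_mono) auto
    also have "\<dots> = (exp 1 * (?N / real k * p)) ^ k" by (simp add: power_mult_distrib power_divide)
    also have "\<dots> \<le> (\<beta> * (real m / real n) ^ (r - 1)) ^ k"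
    proof (rule power_mono)
      have "(2 * m) ^ r = (2 * m) * (2 * m) ^ (r - 1)" using r power_Suc[of "2 * m" "r - 1"] by simp
      also have "\<dots> \<le> r * k * (2 * m) ^ (r - 1)" by (rule mult_le_mono1[OF k(1)])
      finally have "?N \<le> real (r * k * (2 * m) ^ (r - 1))" by (simp only: of_nat_le_iff)
      then have "?N / real k \<le> real r * (2 ^ (r - 1) * real m ^ (r - 1))"
        using k0 by (simp add: pos_divide_le_eq power_mult_distrib mult_ac)
      then have "?N / real k * p \<le> real r * (2 ^ (r - 1) * real m ^ (r - 1)) * (a / real n ^ (r - 1))"
        using p by (intro mult_mono) auto
      also have "\<dots> = real r * 2 ^ (r - 1) * a * (real m / real n) ^ (r - 1)" by (simp add: power_divide)
      finally have "exp 1 * (?N / real k * p) \<le> exp 1 * (real r * 2 ^ (r - 1) * a * (real m / real n) ^ (r - 1))"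
        by (intro mult_left_mono) auto
      also have "\<dots> = exp 1 * (real r * 2 ^ (r - 1) * a) * (real m / real n) ^ (r - 1)" by (simp add: mult_ac)
      also have "\<dots> \<le> \<beta> * (real m / real n) ^ (r - 1)" using \<beta> by (intro mult_right_mono) auto
      finally show "exp 1 * (?N / real k * p) \<le> \<beta> * (real m / real n) ^ (r - 1)" .
    qed (use p in simp)
    finally show ?thesis by (simp add: power_mult_distrib power_mult)
  qed
  have "real (n choose m) * ((real ((2 * m) ^ r)) ^ k / fact k * p ^ k)
     \<le> ((real n / real m) ^ m * exp 1 ^ m) * (\<beta> ^ k * (real m / real n) ^ ((r - 1) * k))"
    by (rule mult_mono[OF 1 2]) (use p in simp_all)
  also have "\<dots> \<le> ((real n / real m) ^ m * exp 1 ^ m) * (\<beta> ^ (2 * m) * (real m / real n) ^ ((r - 1) * k))"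
    using \<beta> k(2) by (intro mult_left_mono mult_right_mono power_increasing) auto
  also have "(real m / real n) ^ ((r - 1) * k) = (real m / real n) ^ ?x * (real m / real n) ^ m"
    using mk by (simp flip: power_add)
  also have "((real n / real m) ^ m * exp 1 ^ m) * (\<beta> ^ (2 * m) * ((real m / real n) ^ ?x * (real m / real n) ^ m))
     = (exp 1 ^ m * \<beta> ^ (2 * m)) * (real m / real n) ^ ?x * ((real n / real m) * (real m / real n)) ^ m"
    by (simp only: power_mult_distrib mult_ac)
  also have "(real n / real m) * (real m / real n) = 1" using npos by simp
  also have "exp 1 ^ m * \<beta> ^ (2 * m) = (exp 1 * \<beta>\<^sup>2) ^ m" by (simp add: power_mult_distrib power_mult)
  finally show "real (n choose m) * ((real ((2 * m) ^ r)) ^ k / fact k * p ^ k)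
    \<le> (exp 1 * \<beta>\<^sup>2) ^ m * (real m / real n) ^ ?x" by simp
qed

text \<open>As m \<le> rx, the exponential factor B^m can be paid by the excess: B^m y^x \<le> (B^r
  y)^x. The additional 4^r leaves a decay 4^(-m) besides K factors of y.\<close>

lemma power_exponential_bound:
  fixes B y :: real
  assumes B: "B \<ge> 1" and y: "0 \<le> y" "4 ^ r * (B ^ r * y) \<le> 1" and m: "m \<le> r * x" and K: "K \<le> x"
  shows "B ^ m * y ^ x \<le> (4 ^ r * B ^ r * y) ^ K / 4 ^ m"
proof -
  let ?z = "4 ^ r * (B ^ r * y)"
  have z: "0 \<le> ?z" using B y by simp
  have "B ^ m * y ^ x \<le> B ^ (r * x) * y ^ x"
    using B y m by (intro mult_right_mono power_increasing) auto
  also have "\<dots> = (B ^ r * y) ^ x" by (simp add: power_mult_distrib power_mult)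
  also have "\<dots> = ?z ^ x / 4 ^ (r * x)" by (simp add: power_mult_distrib power_mult)
  also have "\<dots> \<le> ?z ^ K / 4 ^ m"
    using z y(2) K m by (intro frac_le power_decreasing power_increasing) auto
  finally show ?thesis by (simp add: mult_ac)
qed

text \<open>m^K \<le> 4^K K! exp(m/4) and exp(1/4) \<le> 3/2, so the terms decay like (3/4)^m, whose
  sum is 4.\<close>

lemma sum_power_geometric_le:
  assumes "finite (I :: nat set)"
  shows "(\<Sum>m\<in>I. real m ^ K / 2 ^ m) \<le> 4 * (4 ^ K * fact K)"
proof -
  have term_le: "real m ^ K / 2 ^ m \<le> 4 ^ K * fact K * (3 / 4) ^ m" for m
  proof (cases "m = 0")
    case False
    have "exp (1 / 4 :: real) \<le> 1 + 1 / 4 + (1 / 4)\<^sup>2" by (rule exp_bound) auto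
    also have "\<dots> \<le> 3 / 2" by (simp add: power2_eq_square)
    finally have e: "exp (1 / 4 :: real) \<le> 3 / 2" .
    have "(real m / 4) ^ K / fact K \<le> exp (real m / 4)" using False by (intro power_div_fact_le_exp) simp
    also have "exp (real m / 4) = exp (1 / 4) ^ m" using exp_of_nat_mult[of m "1 / 4 :: real"] by simp
    also have "\<dots> \<le> (3 / 2) ^ m" using e by (intro power_mono) auto
    finally have "real m ^ K \<le> 4 ^ K * fact K * (3 / 2) ^ m" by (simp add: power_divide field_simps)
    then have "real m ^ K / 2 ^ m \<le> 4 ^ K * fact K * (3 / 2) ^ m / 2 ^ m" by (intro divide_right_mono) auto
    also have "\<dots> = 4 ^ K * fact K * ((3 / 2) ^ m / 2 ^ m)" by simp
    also have "(3 / 2) ^ m / 2 ^ m = ((3 / 4) ^ m :: real)" by (simp flip: power_divide)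
    finally show ?thesis .
  qed (cases K; simp)
  have "(\<Sum>m\<in>I. real m ^ K / 2 ^ m) \<le> (\<Sum>m\<in>I. 4 ^ K * fact K * (3 / 4) ^ m)"
    by (intro sum_mono term_le)
  also have "\<dots> = 4 ^ K * fact K * (\<Sum>m\<in>I. (3 / 4) ^ m)" by (simp add: sum_distrib_left)
  also have "(\<Sum>m\<in>I. (3 / 4) ^ m :: real) \<le> (\<Sum>m. (3 / 4) ^ m)"
    using assms by (intro sum_le_suminf summable_geometric) auto
  also have "(\<Sum>m. (3 / 4) ^ m :: real) = 4" by (simp add: suminf_geometric)
  finally show ?thesis by (simp add: mult_ac)
qed

context sparse_sat
begin

text \<open>The order of quantifiers matters: \<epsilon> depends on r and a only, so that the
  complementary linear range can be excluded once for all K, while the lower cut-off M grows with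
  K.\<close>

lemma first_moment_medium_mff:
  "\<exists>\<epsilon>. 0 < \<epsilon> \<and> \<epsilon> \<le> 1 \<and> (\<forall>K. \<exists>M. (\<lambda>n. pr n (\<lambda>F. \<exists>H. subformula H ({..<n}, F) \<and> mff r H \<and>
      M \<le> card (vars H) \<and> real (card (vars H)) \<le> \<epsilon> * real n)) \<in> O(\<lambda>n. 1 / real n ^ K))"
proof -
  define \<beta> where "\<beta> = max 1 (exp 1 * (real r * 2 ^ (r - 1) * a))"
  define B where "B = exp 1 * \<beta>\<^sup>2"
  have \<beta>: "\<beta> \<ge> 1" "exp 1 * (real r * 2 ^ (r - 1) * a) \<le> \<beta>" by (auto simp: \<beta>_def)
  have "1 * 1 \<le> exp 1 * \<beta>\<^sup>2" using \<beta>(1) by (intro mult_mono one_le_power) auto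
  then have B: "B \<ge> 1" by (simp add: B_def)
  define D where "D = 4 ^ r * B ^ r"
  have "1 * 1 \<le> 4 ^ r * B ^ r" using B by (intro mult_mono one_le_power) auto
  then have D: "D \<ge> 1" by (simp add: D_def)
  \<comment> \<open>Chosen so that m \<le> \<epsilon> n gives 4^r B^r (m/n) \<le> 1, the condition
    of \<open>power_exponential_bound\<close>.\<close>
  define \<epsilon> where "\<epsilon> = 1 / D"
  have \<epsilon>: "0 < \<epsilon>" "\<epsilon> \<le> 1" using D by (auto simp: \<epsilon>_def)
  \<comment> \<open>The cut-off rK + 1 forces rK < m \<le> rx, so the exponent x exceeds K and at
    least K factors m/n can be extracted.\<close>
  have "(\<lambda>n. pr n (\<lambda>F. \<exists>H. subformula H ({..<n}, F) \<and> mff r H \<and> Suc (r * K) \<le> card (vars H) \<and>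
      real (card (vars H)) \<le> \<epsilon> * real n)) \<in> O(\<lambda>n. 1 / real n ^ K)" for K
  proof (rule bigoI[of _ "2 * D ^ K * (4 * (4 ^ K * fact K))"])
    show "eventually (\<lambda>n. norm (pr n (\<lambda>F. \<exists>H. subformula H ({..<n}, F) \<and> mff r H \<and> Suc (r * K) \<le> card (vars H) \<and>
      real (card (vars H)) \<le> \<epsilon> * real n)) \<le> 2 * D ^ K * (4 * (4 ^ K * fact K)) * norm (1 / real n ^ K)) sequentially"
      using eventually_p_le_1
    proof eventually_elim
      case (elim n)
      let ?E = "\<lambda>F. \<exists>H. subformula H ({..<n}, F) \<and> mff r H \<and> Suc (r * K) \<le> card (vars H) \<and>
        real (card (vars H)) \<le> \<epsilon> * real n"
      let ?\<Omega> = "possible_clauses r {..<n}"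
      have n: "n \<ge> 1" and p: "0 \<le> p n" "p n \<le> 1" using elim by auto
      define I where "I = {m. Suc (r * K) \<le> m \<and> real m \<le> \<epsilon> * real n}"
      let ?Vs = "\<lambda>m. {V. V \<subseteq> {..<n} \<and> card V = m}"
      let ?Ks = "\<lambda>m. {k. 2 * m \<le> r * k \<and> k \<le> 2 * m}"
      let ?Ts = "\<lambda>V k. {T. T \<subseteq> possible_clauses r V \<and> card T = k}"
      have I_le: "m \<le> n" if "m \<in> I" for m
      proof -
        have "real m \<le> \<epsilon> * real n" using that by (simp add: I_def)
        also have "\<dots> \<le> 1 * real n" using \<epsilon> by (intro mult_right_mono) auto
        finally show ?thesis by simp
      qed
      then have finI: "finite I" by (intro finite_subset[of I "{..n}"]) auto
      have finV: "finite (?Vs m)" for m by (rule finite_subset[of _ "Pow {..<n}"]) auto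
      have finK: "finite (?Ks m)" for m by (rule finite_subset[of _ "{..2 * m}"]) auto
      have finT: "finite (?Ts V k)" if "finite V" for V :: "nat set" and k
        using that by (intro finite_subset[of "?Ts V k" "Pow (possible_clauses r V)"]) auto
      have finVm: "finite V" if "V \<in> ?Vs m" for V m using that by (auto intro: finite_subset)
      have "pr n ?E \<le> pr n (\<lambda>F. \<exists>m\<in>I. \<exists>V\<in>?Vs m. \<exists>k\<in>?Ks m. \<exists>T\<in>?Ts V k. T \<subseteq> F)"
      proof (rule rs_prob_mono[OF p])
        fix F assume "?E F"
        then obtain H where H: "subformula H ({..<n}, F)" "mff r H" "Suc (r * K) \<le> card (vars H)"
          "real (card (vars H)) \<le> \<epsilon> * real n" by blast
        have full: "full r H" by (rule mff_full[OF H(2)])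
        have "card (vars H) \<in> I" using H by (simp add: I_def)
        moreover have "vars H \<in> ?Vs (card (vars H))" "clauses H \<subseteq> F" using H(1) by (simp_all add: subformula_def)
        moreover have "card (clauses H) \<in> ?Ks (card (vars H))"
          using full_literals_le[OF full] mff_card_clauses_le[OF r H(2)] by simp
        moreover have "clauses H \<in> ?Ts (vars H) (card (clauses H))"
          using full_sat_formula[OF full] by (simp add: sat_formula_def)
        ultimately show "\<exists>m\<in>I. \<exists>V\<in>?Vs m. \<exists>k\<in>?Ks m. \<exists>T\<in>?Ts V k. T \<subseteq> F" by blast
      qed
      also have "\<dots> \<le> (\<Sum>m\<in>I. \<Sum>V\<in>?Vs m. \<Sum>k\<in>?Ks m. \<Sum>T\<in>?Ts V k. pr n (\<lambda>F. T \<subseteq> F))"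
      proof -
        have 1: "pr n (\<lambda>F. \<exists>k\<in>?Ks m. \<exists>T\<in>?Ts V k. T \<subseteq> F) \<le> (\<Sum>k\<in>?Ks m. \<Sum>T\<in>?Ts V k. pr n (\<lambda>F. T \<subseteq> F))"
          if "V \<in> ?Vs m" for m V
          by (rule order_trans[OF rs_prob_Ex[OF p finK]], rule sum_mono, rule rs_prob_Ex[OF p finT[OF finVm[OF that]]])
        have 2: "pr n (\<lambda>F. \<exists>V\<in>?Vs m. \<exists>k\<in>?Ks m. \<exists>T\<in>?Ts V k. T \<subseteq> F)
            \<le> (\<Sum>V\<in>?Vs m. \<Sum>k\<in>?Ks m. \<Sum>T\<in>?Ts V k. pr n (\<lambda>F. T \<subseteq> F))" for m
          by (rule order_trans[OF rs_prob_Ex[OF p finV]], rule sum_mono, rule 1)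
        show ?thesis by (rule order_trans[OF rs_prob_Ex[OF p finI]], rule sum_mono, rule 2)
      qed
      also have "\<dots> \<le> (\<Sum>m\<in>I. 2 * D ^ K / real n ^ K * (real m ^ K / 2 ^ m))"
      proof (rule sum_mono)
        fix m assume m: "m \<in> I"
        then have m1: "m \<ge> 1" and mK: "Suc (r * K) \<le> m" by (auto simp: I_def)
        \<comment> \<open>A bound on the expected number for one m and one k, all V together. Half
          of 4^(-m) pays for the at most 2 * 2^m values of k, the other half makes the sum over m
          converge.\<close>
        let ?b = "D ^ K / real n ^ K * real m ^ K / 4 ^ m"
        have inner: "real (n choose m) * (\<Sum>T\<in>?Ts V k. pr n (\<lambda>F. T \<subseteq> F)) \<le> ?b"
          if V: "V \<in> ?Vs m" and k: "k \<in> ?Ks m" for V k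
        proof -
          let ?x = "(r - 1) * k - m"
          have Vn: "V \<subseteq> {..<n}" "card V = m" using V by auto
          have "(\<Sum>T\<in>?Ts V k. pr n (\<lambda>F. T \<subseteq> F)) = (\<Sum>T\<in>?Ts V k. p n ^ k)"
          proof (intro sum.cong refl)
            fix T assume "T \<in> ?Ts V k"
            then have "T \<subseteq> ?\<Omega>" "card T = k" using possible_clauses_mono[OF Vn(1), of r] by auto
            then show "pr n (\<lambda>F. T \<subseteq> F) = p n ^ k" using rs_prob_superset[of ?\<Omega> T "p n"] by simp
          qed
          also have "\<dots> = (card (possible_clauses r V) choose k) * p n ^ k"
            using finVm[OF V] by (simp add: n_subsets)
          also have "\<dots> \<le> (real ((2 * m) ^ r)) ^ k / fact k * p n ^ k"
          proof (rule mult_right_mono)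
            have "card (possible_clauses r V) \<le> (2 * m) ^ r"
              using card_possible_clauses_le[OF finVm[OF V], of r] Vn(2) by simp
            then have "real (card (possible_clauses r V) choose k) \<le> real ((2 * m) ^ r choose k)"
              by (intro of_nat_mono binomial_right_mono)
            also have "\<dots> \<le> (real ((2 * m) ^ r)) ^ k / fact k" by (rule binomial_le_power_div_fact)
            finally show "real (card (possible_clauses r V) choose k) \<le> (real ((2 * m) ^ r)) ^ k / fact k" .
          qed (use p in simp)
          finally have "real (n choose m) * (\<Sum>T\<in>?Ts V k. pr n (\<lambda>F. T \<subseteq> F))
              \<le> real (n choose m) * ((real ((2 * m) ^ r)) ^ k / fact k * p n ^ k)"
            by (intro mult_left_mono) auto
          also have "\<dots> \<le> B ^ m * (real m / real n) ^ ?x"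
            unfolding B_def using k first_moment_term_bound(1)[OF m1 I_le[OF m] _ _ r p(1) p_le[OF n] a \<beta>] by blast
          also have "\<dots> \<le> (4 ^ r * B ^ r * (real m / real n)) ^ K / 4 ^ m"
          proof (rule power_exponential_bound[OF B])
            show rx: "m \<le> r * ?x"
              using k first_moment_term_bound(2)[OF m1 I_le[OF m] _ _ r p(1) p_le[OF n] a \<beta>] by simp
            have "r * K < r * ?x" using rx mK by linarith
            then show "K \<le> ?x" by simp
            have "real m \<le> \<epsilon> * real n" using m by (simp add: I_def)
            then have "D * (real m / real n) \<le> 1" using n D by (simp add: \<epsilon>_def field_simps)
            then show "4 ^ r * (B ^ r * (real m / real n)) \<le> 1" by (simp add: D_def mult.assoc)
          qed simp
          also have "\<dots> = ?b" by (simp add: D_def power_mult_distrib power_divide)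
          finally show ?thesis .
        qed
        have b0: "0 \<le> ?b" using D by simp
        have cV: "card (?Vs m) = n choose m" by (simp add: n_subsets)
        have "(\<Sum>V\<in>?Vs m. \<Sum>k\<in>?Ks m. \<Sum>T\<in>?Ts V k. pr n (\<lambda>F. T \<subseteq> F)) \<le> (\<Sum>V\<in>?Vs m. \<Sum>k\<in>?Ks m. ?b / real (n choose m))"
        proof (intro sum_mono)
          fix V k assume Vk: "V \<in> ?Vs m" "k \<in> ?Ks m"
          have "n choose m > 0" using I_le[OF m] by simp
          then show "(\<Sum>T\<in>?Ts V k. pr n (\<lambda>F. T \<subseteq> F)) \<le> ?b / real (n choose m)"
            using inner[OF Vk] by (subst pos_le_divide_eq) (simp_all add: mult.commute)
        qed
        also have "\<dots> = card (?Ks m) * ?b"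
          using I_le[OF m] by (simp add: cV)
        also have "\<dots> \<le> (2 * 2 ^ m) * ?b"
        proof (rule mult_right_mono[OF _ b0])
          have "card (?Ks m) \<le> card {..2 * m}" by (rule card_mono) auto
          also have "\<dots> = 2 * m + 1" by simp
          also have "2 * m + 1 \<le> 2 * 2 ^ m" using less_exp[of m] by linarith
          finally have "real (card (?Ks m)) \<le> real (2 * 2 ^ m)" by (simp only: of_nat_le_iff)
          then show "real (card (?Ks m)) \<le> 2 * 2 ^ m" by simp
        qed
        also have "\<dots> = 2 * D ^ K / real n ^ K * (real m ^ K / 2 ^ m)"
        proof -
          have "(4::real) ^ m = 2 ^ m * 2 ^ m" by (simp flip: power_mult_distrib)
          then show ?thesis by (simp add: mult_ac)
        qed
        finally show "(\<Sum>V\<in>?Vs m. \<Sum>k\<in>?Ks m. \<Sum>T\<in>?Ts V k. pr n (\<lambda>F. T \<subseteq> F)) \<le> 2 * D ^ K / real n ^ K * (real m ^ K / 2 ^ m)" .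
      qed
      also have "\<dots> = 2 * D ^ K / real n ^ K * (\<Sum>m\<in>I. real m ^ K / 2 ^ m)" by (rule sum_distrib_left[symmetric])
      also have "\<dots> \<le> 2 * D ^ K / real n ^ K * (4 * (4 ^ K * fact K))"
        using D by (intro mult_left_mono sum_power_geometric_le finI) auto
      finally have le: "pr n ?E \<le> 2 * D ^ K / real n ^ K * (4 * (4 ^ K * fact K))" .
      have "norm x \<le> c * (4 * d) * norm (1 / y)" if "0 \<le> x" "x \<le> c / y * (4 * d)" "0 < y" for x y c d :: real
        using that by simp
      from this[OF rs_prob_nonneg[OF p] le] show ?case using n by simp
    qed
  qed
  then show ?thesis using \<epsilon> by blast
qed

lemma mff_size_tail:
  assumes "a < b" "b < pure_literal_threshold r"
  shows "\<exists>M. (\<lambda>n. pr n (\<lambda>F. \<exists>H. subformula H ({..<n}, F) \<and> mff r H \<and> M \<le> card (vars H))) \<in> O(\<lambda>n. 1 / real n ^ K)"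
proof -
  obtain \<epsilon> where \<epsilon>: "0 < \<epsilon>" "\<epsilon> \<le> 1" and "\<exists>M. (\<lambda>n. pr n (\<lambda>F. \<exists>H. subformula H ({..<n}, F) \<and> mff r H \<and>
      M \<le> card (vars H) \<and> real (card (vars H)) \<le> \<epsilon> * real n)) \<in> O(\<lambda>n. 1 / real n ^ K)"
    using first_moment_medium_mff by blast
  then obtain M where M: "(\<lambda>n. pr n (\<lambda>F. \<exists>H. subformula H ({..<n}, F) \<and> mff r H \<and>
      M \<le> card (vars H) \<and> real (card (vars H)) \<le> \<epsilon> * real n)) \<in> O(\<lambda>n. 1 / real n ^ K)" by blast
  have "rapidly_vanishing (\<lambda>n. pr n (\<lambda>F. \<exists>H. subformula H ({..<n}, F) \<and> full r H \<and> real (card (vars H)) \<ge> \<epsilon> * real n))"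
    using assms a \<epsilon> below_threshold_contraction[OF r, of b] by (intro rapidly_vanishing_large_full[of b]) auto
  then have L: "(\<lambda>n. pr n (\<lambda>F. \<exists>H. subformula H ({..<n}, F) \<and> full r H \<and> real (card (vars H)) \<ge> \<epsilon> * real n)) \<in> O(\<lambda>n. 1 / real n ^ K)"
    unfolding rapidly_vanishing_def by blast
  have "(\<lambda>n. pr n (\<lambda>F. \<exists>H. subformula H ({..<n}, F) \<and> mff r H \<and> M \<le> card (vars H)))
    \<in> O(\<lambda>n. pr n (\<lambda>F. \<exists>H. subformula H ({..<n}, F) \<and> mff r H \<and> M \<le> card (vars H) \<and> real (card (vars H)) \<le> \<epsilon> * real n)
      + pr n (\<lambda>F. \<exists>H. subformula H ({..<n}, F) \<and> full r H \<and> real (card (vars H)) \<ge> \<epsilon> * real n))"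
  proof (intro landau_o.big_mono eventually_mono[OF eventually_p_le_1])
    fix n assume "1 \<le> n \<and> 0 \<le> p n \<and> p n \<le> 1"
    then have p: "0 \<le> p n" "p n \<le> 1" by auto
    have "pr n (\<lambda>F. \<exists>H. subformula H ({..<n}, F) \<and> mff r H \<and> M \<le> card (vars H))
      \<le> pr n (\<lambda>F. (\<exists>H. subformula H ({..<n}, F) \<and> mff r H \<and> M \<le> card (vars H) \<and> real (card (vars H)) \<le> \<epsilon> * real n)
      \<or> (\<exists>H. subformula H ({..<n}, F) \<and> full r H \<and> real (card (vars H)) \<ge> \<epsilon> * real n))"
    proof (rule rs_prob_mono[OF p])
      fix F assume "\<exists>H. subformula H ({..<n}, F) \<and> mff r H \<and> M \<le> card (vars H)"
      then obtain H where "subformula H ({..<n}, F)" "mff r H" "M \<le> card (vars H)" by blast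
      then show "(\<exists>H. subformula H ({..<n}, F) \<and> mff r H \<and> M \<le> card (vars H) \<and> real (card (vars H)) \<le> \<epsilon> * real n)
        \<or> (\<exists>H. subformula H ({..<n}, F) \<and> full r H \<and> real (card (vars H)) \<ge> \<epsilon> * real n)"
        using mff_full[of r H] linear[of "real (card (vars H))" "\<epsilon> * real n"] by blast
    qed
    also note rs_prob_disj[OF p]
    finally have le: "pr n (\<lambda>F. \<exists>H. subformula H ({..<n}, F) \<and> mff r H \<and> M \<le> card (vars H))
      \<le> pr n (\<lambda>F. \<exists>H. subformula H ({..<n}, F) \<and> mff r H \<and> M \<le> card (vars H) \<and> real (card (vars H)) \<le> \<epsilon> * real n)
        + pr n (\<lambda>F. \<exists>H. subformula H ({..<n}, F) \<and> full r H \<and> real (card (vars H)) \<ge> \<epsilon> * real n)" .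
    have "norm x \<le> norm y" if "0 \<le> x" "x \<le> y" for x y :: real using that by simp
    from this[OF rs_prob_nonneg[OF p] le] show "norm (pr n (\<lambda>F. \<exists>H. subformula H ({..<n}, F) \<and> mff r H \<and> M \<le> card (vars H)))
      \<le> norm (pr n (\<lambda>F. \<exists>H. subformula H ({..<n}, F) \<and> mff r H \<and> M \<le> card (vars H) \<and> real (card (vars H)) \<le> \<epsilon> * real n)
        + pr n (\<lambda>F. \<exists>H. subformula H ({..<n}, F) \<and> full r H \<and> real (card (vars H)) \<ge> \<epsilon> * real n))"
      .
  qed
  then show ?thesis using landau_o.big_trans sum_in_bigo(1)[OF M L] by blast
qed

end

subsection \<open>Overlapping copies and the exceptional events\<close>

text \<open>Witnesses of too large excess. Fullness is not demanded, since the first moment sees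
  only size and excess. With L = 2M and excess at least e + 1 they include the union of two distinct
  minimal full formulas on at most M variables, the first of excess at least e, and any single one
  of excess above e.\<close>

definition small_formulas :: "nat \<Rightarrow> nat \<Rightarrow> nat \<Rightarrow> nat \<Rightarrow> nat formula set" where
  "small_formulas r n L e = {U. vars U \<subseteq> {..<n} \<and> card (vars U) \<le> L \<and>
     clauses U \<subseteq> possible_clauses r (vars U) \<and> int e \<le> excess r U}"

lemma small_formulas_bounds:
  assumes "U \<in> small_formulas r n L e"
  shows "finite (vars U)" "clauses U \<subseteq> possible_clauses r {..<n}" "card (clauses U) \<le> (2 * L) ^ r"
    "finite (clauses U)"
proof -
  have U: "vars U \<subseteq> {..<n}" "card (vars U) \<le> L" "clauses U \<subseteq> possible_clauses r (vars U)"
    using assms by (auto simp: small_formulas_def)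
  show fin: "finite (vars U)" using U(1) by (rule finite_subset) simp
  show "clauses U \<subseteq> possible_clauses r {..<n}" using U(3) possible_clauses_mono[OF U(1), of r] by blast
  show "finite (clauses U)" by (rule finite_subset[OF U(3)]) (simp add: fin)
  have "card (clauses U) \<le> card (possible_clauses r (vars U))" by (rule card_mono[OF _ U(3)]) (simp add: fin)
  also have "\<dots> \<le> (2 * card (vars U)) ^ r" by (rule card_possible_clauses_le[OF fin])
  also have "\<dots> \<le> (2 * L) ^ r" using U(2) by (intro power_mono) auto
  finally show "card (clauses U) \<le> (2 * L) ^ r" .
qed

lemma finite_small_formulas: "finite (small_formulas r n L e)"
proof (rule finite_subset)
  show "small_formulas r n L e \<subseteq> Pow {..<n} \<times> Pow (possible_clauses r {..<n})"
  proof
    fix U assume U: "U \<in> small_formulas r n L e"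
    then have "vars U \<in> Pow {..<n}" by (simp add: small_formulas_def)
    moreover have "clauses U \<in> Pow (possible_clauses r {..<n})" using small_formulas_bounds(2)[OF U] by simp
    ultimately show "U \<in> Pow {..<n} \<times> Pow (possible_clauses r {..<n})" by (simp add: mem_Times_iff)
  qed
qed simp

lemma formula_union_small:
  assumes r: "r \<ge> 3" and H: "subformula H ({..<n}, F)" "mff r H" "card (vars H) \<le> M" "int e \<le> excess r H"
    and K: "subformula K ({..<n}, F)" "mff r K" "card (vars K) \<le> M" "H \<noteq> K"
  shows "formula_union H K \<in> {U \<in> small_formulas r n (2 * M) (Suc e). clauses U \<subseteq> F}"
proof -
  have "full r (formula_union H K)" by (rule full_union[OF mff_full[OF H(2)] mff_full[OF K(2)]])
  then have "clauses (formula_union H K) \<subseteq> possible_clauses r (vars (formula_union H K))"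
    by (simp add: full_def sat_formula_def)
  moreover have "card (vars H \<union> vars K) \<le> 2 * M" using card_Un_le[of "vars H" "vars K"] H(3) K(3) by linarith
  moreover have "int (Suc e) \<le> excess r (formula_union H K)"
    using excess_union_mff[OF r H(2) K(2,4)] H(4) by simp
  ultimately show ?thesis using H(1) K(1) by (simp add: small_formulas_def subformula_def)
qed

definition unique_mff :: "nat \<Rightarrow> nat \<Rightarrow> nat formula \<Rightarrow> nat literal set set \<Rightarrow> bool" where
  "unique_mff r n H F \<longleftrightarrow> (\<exists>F\<^sub>0. mff_subformulas r ({..<n}, F) = {F\<^sub>0} \<and> F\<^sub>0 \<simeq>\<^sub>f H)"

definition large_mff :: "nat \<Rightarrow> nat \<Rightarrow> nat \<Rightarrow> nat literal set set \<Rightarrow> bool" where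
  "large_mff r n M F \<longleftrightarrow> (\<exists>H. subformula H ({..<n}, F) \<and> mff r H \<and> M \<le> card (vars H))"

definition small_count :: "nat \<Rightarrow> nat \<Rightarrow> nat \<Rightarrow> nat \<Rightarrow> nat literal set set \<Rightarrow> nat" where
  "small_count r n L e F = card {U \<in> small_formulas r n L e. clauses U \<subseteq> F}"

definition copy_count :: "nat \<Rightarrow> nat formula \<Rightarrow> nat literal set set \<Rightarrow> nat" where
  "copy_count n H F = card {K \<in> copies n H. clauses K \<subseteq> F}"

lemma copiesD:
  assumes "mff r H" "K \<in> copies n H"
  shows "mff r K" "card (vars K) = card (vars H)" "card (clauses K) = card (clauses H)" "excess r K = excess r H"
    "vars K \<subseteq> {..<n}" "clauses K \<subseteq> possible_clauses r {..<n}"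
proof -
  have K: "closed_formula K" "K \<simeq>\<^sub>f H" and v: "vars K \<subseteq> {..<n}" using assms by (auto simp: copies_def)
  then have "H \<simeq>\<^sub>f K" using isomorphic_sym by blast
  note iso = isomorphic_mff[OF assms(1) this]
  show "mff r K" "card (vars K) = card (vars H)" "card (clauses K) = card (clauses H)" "excess r K = excess r H"
    by (fact iso)+
  show "vars K \<subseteq> {..<n}" by (fact v)
  have "clauses K \<subseteq> possible_clauses r (vars K)"
    using mff_full[OF iso(1)] by (simp add: full_def sat_formula_def)
  then show "clauses K \<subseteq> possible_clauses r {..<n}" using possible_clauses_mono[OF v, of r] by blast
qed

lemma unique_mff_le_copy_count:
  assumes "mff r H"
  shows "of_bool (unique_mff r n H F) \<le> copy_count n H F"
proof (cases "unique_mff r n H F")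
  case True
  then obtain K where K: "mff_subformulas r ({..<n}, F) = {K}" "K \<simeq>\<^sub>f H" by (auto simp: unique_mff_def)
  then have "K \<in> mff_subformulas r ({..<n}, F)" by blast
  then have "subformula K ({..<n}, F)" "mff r K" by (simp_all add: mff_subformulas_def)
  then have "K \<in> {K \<in> copies n H. clauses K \<subseteq> F}"
    using K(2) mff_closed[of r K] by (simp add: copies_def subformula_def)
  moreover have "finite {K \<in> copies n H. clauses K \<subseteq> F}"
    using card_copies(2)[OF mff_closed[OF assms] mff_finite_vars[OF assms]] by simp
  ultimately have "copy_count n H F > 0" unfolding copy_count_def card_gt_0_iff by blast
  then show ?thesis by simp
qed simp

text \<open>Without a witness any two copies coincide, and the only copy is the only minimal full
  subformula unless a large one exists. With a witness, fix one copy K: every other copy lies inside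
  its union with K, which is a witness, and a witness has a bounded number of subformulas. The
  summand 1 accounts for K. Taking means, the probability of a unique copy agrees with the expected
  number of copies up to O(n^(-e-1)), without a second moment.\<close>

lemma copy_count_le:
  assumes r: "r \<ge> 3" and H: "mff r H" "excess r H = int e" "card (vars H) \<le> M"
  shows "copy_count n H F \<le> of_bool (unique_mff r n H F)
    + (1 + 2 ^ (2 * M) * 2 ^ ((4 * M) ^ r)) * small_count r n (2 * M) (Suc e) F + of_bool (large_mff r n M F)"
proof -
  let ?Cs = "{K \<in> copies n H. clauses K \<subseteq> F}"
  let ?Ws = "{U \<in> small_formulas r n (2 * M) (Suc e). clauses U \<subseteq> F}"
  \<comment> \<open>A witness has at most 2M variables and at most (4M)^r clauses; each subset of
    either may give a subformula.\<close>
  let ?c = "2 ^ (2 * M) * 2 ^ ((4 * M) ^ r) :: nat"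
  have finW: "finite ?Ws" using finite_small_formulas by simp
  have finC: "finite ?Cs"
    using card_copies(2)[OF mff_closed[OF H(1)] mff_finite_vars[OF H(1)]] by simp
  have C: "subformula K ({..<n}, F)" "mff r K" "card (vars K) \<le> M" "int e \<le> excess r K" if "K \<in> ?Cs" for K
    using that copiesD[OF H(1), of K n] H by (auto simp: subformula_def)
  have union: "formula_union K L \<in> ?Ws" if "K \<in> ?Cs" "subformula L ({..<n}, F)" "mff r L" "card (vars L) \<le> M" "K \<noteq> L" for K L
    by (rule formula_union_small[OF r C[OF that(1)] that(2-5)])
  show ?thesis
  proof (cases "?Cs = {}")
    case True
    then show ?thesis unfolding copy_count_def by (simp only: card.empty zero_le)
  next
    case False
    then obtain K where K: "K \<in> ?Cs" by blast
    show ?thesis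
    proof (cases "?Ws = {}")
      case True
      have single: "?Cs = {K}"
      proof (rule ccontr)
        assume "?Cs \<noteq> {K}"
        then obtain L where "L \<in> ?Cs" "K \<noteq> L" using K by blast
        then show False using union[OF K C(1-3)[of L]] True by blast
      qed
      have "unique_mff r n H F \<or> large_mff r n M F"
      proof (cases "large_mff r n M F")
        case False
        have "mff_subformulas r ({..<n}, F) = {K}"
        proof (intro equalityI subsetI)
          fix L assume "L \<in> mff_subformulas r ({..<n}, F)"
          then have L: "subformula L ({..<n}, F)" "mff r L" by (simp_all add: mff_subformulas_def)
          then have "card (vars L) \<le> M" using False unfolding large_mff_def by (meson linear)
          then show "L \<in> {K}" using union[OF K L] True by blast
        next
          fix L assume "L \<in> {K}"
          then show "L \<in> mff_subformulas r ({..<n}, F)" using C(1,2)[OF K] by (simp add: mff_subformulas_def)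
        qed
        moreover have "K \<simeq>\<^sub>f H" using K by (simp add: copies_def)
        ultimately show ?thesis unfolding unique_mff_def by blast
      qed simp
      moreover have "copy_count n H F = 1" unfolding copy_count_def single by simp
      ultimately show ?thesis by auto
    next
      case False
      have W1: "small_count r n (2 * M) (Suc e) F \<ge> 1"
        unfolding small_count_def using False finW by (simp add: Suc_le_eq card_gt_0_iff)
      have sub: "card {L. subformula L U} \<le> ?c" "finite {L. subformula L U}" if U: "U \<in> ?Ws" for U
      proof -
        have Us: "U \<in> small_formulas r n (2 * M) (Suc e)" using U by blast
        note b = small_formulas_bounds[OF Us]
        have eq: "{L. subformula L U} = Pow (vars U) \<times> Pow (clauses U)"
          by (auto simp: subformula_def mem_Times_iff)
        show "finite {L. subformula L U}" unfolding eq using b by simp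
        have "card (vars U) \<le> 2 * M" using Us by (simp add: small_formulas_def)
        moreover have "card (clauses U) \<le> (4 * M) ^ r" using b(3) by (simp add: mult.assoc[symmetric])
        ultimately show "card {L. subformula L U} \<le> ?c" unfolding eq
          using b by (simp only: card_cartesian_product card_Pow) (intro mult_le_mono power_increasing, simp_all)
      qed
      have "?Cs - {K} \<subseteq> (\<Union>U\<in>?Ws. {L. subformula L U})"
      proof
        fix L assume L: "L \<in> ?Cs - {K}"
        then have "L \<in> ?Cs" "K \<noteq> L" by auto
        then have "formula_union K L \<in> ?Ws" by (intro union[OF K C(1-3)])
        moreover have "subformula L (formula_union K L)" by (simp add: subformula_def)
        ultimately show "L \<in> (\<Union>U\<in>?Ws. {L. subformula L U})" by blast
      qed
      then have "card (?Cs - {K}) \<le> card (\<Union>U\<in>?Ws. {L. subformula L U})"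
        using finW sub(2) by (intro card_mono finite_UN_I) auto
      also have "\<dots> \<le> (\<Sum>U\<in>?Ws. card {L. subformula L U})" by (rule card_UN_le[OF finW])
      also have "\<dots> \<le> (\<Sum>U\<in>?Ws. ?c)" by (rule sum_mono) (rule sub(1))
      also have "\<dots> = ?c * small_count r n (2 * M) (Suc e) F" by (simp add: small_count_def)
      finally have "card (?Cs - {K}) \<le> ?c * small_count r n (2 * M) (Suc e) F" .
      moreover have "copy_count n H F = Suc (card (?Cs - {K}))"
        unfolding copy_count_def by (rule card.remove[OF finC K])
      ultimately show ?thesis using W1 by (simp add: algebra_simps)
    qed
  qed
qed

lemma full_subformula_contains_mff:
  assumes "r \<ge> 3" "subformula H F" "full r H"
  shows "\<exists>K. subformula K F \<and> mff r K \<and> excess r K \<le> excess r H"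
proof -
  obtain K where K: "subformula K H" "mff r K" using full_contains_mff[OF assms(3)] by blast
  then have "excess r K \<le> excess r H" by (intro excess_mono_full assms mff_full)
  then show ?thesis using K subformula_trans assms(2) by blast
qed

text \<open>Every full subformula contains a minimal one of no larger excess, and there is only one
  to contain.\<close>

lemma unique_mff_min_excess:
  assumes "r \<ge> 3" "mff r H" "excess r H = mff_excess r i" "unique_mff r n H F"
  shows "min_excess_event r i ({..<n}, F)"
proof -
  obtain K where K: "mff_subformulas r ({..<n}, F) = {K}" "K \<simeq>\<^sub>f H" using assms(4) by (auto simp: unique_mff_def)
  then have "K \<in> mff_subformulas r ({..<n}, F)" by blast
  then have Km: "subformula K ({..<n}, F)" "mff r K" by (simp_all add: mff_subformulas_def)
  have ex: "excess r K = mff_excess r i" using isomorphic_mff(4)[OF Km(2) K(2)] assms(3) by simp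
  have "mff_excess r i \<le> excess r L" if L: "subformula L ({..<n}, F)" "full r L" for L
  proof -
    obtain K' where K': "subformula K' ({..<n}, F)" "mff r K'" "excess r K' \<le> excess r L"
      using full_subformula_contains_mff[OF assms(1) L] by blast
    then have "K' \<in> mff_subformulas r ({..<n}, F)" by (simp add: mff_subformulas_def)
    then show ?thesis using K'(3) ex unfolding K(1) by simp
  qed
  then show ?thesis unfolding min_excess_event_def using Km mff_full[OF Km(2)] by (meson not_le)
qed

definition good_event :: "nat \<Rightarrow> nat \<Rightarrow> nat \<Rightarrow> nat literal set set \<Rightarrow> bool" where
  "good_event r i n F \<longleftrightarrow>
     (\<exists>F\<^sub>0. mff_subformulas r ({..<n}, F) = {F\<^sub>0} \<and> F\<^sub>0 \<in> \<Union>(mff_classes r i))"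

text \<open>Suppose all minimal full subformulas are small and there is no witness. One of them, K,
  has excess at least e by the event and less than e + 1, else it would be a witness itself; a
  second one would make the union with K a witness. So the formula is good.\<close>

lemma min_excess_not_good:
  assumes r: "r \<ge> 3" and e: "mff_excess r i = int e"
    and E: "min_excess_event r i ({..<n}, F)" "\<not> good_event r i n F"
  shows "large_mff r n M F \<or> small_count r n (2 * M) (Suc e) F \<ge> 1"
proof (rule disjCI)
  let ?Ws = "{U \<in> small_formulas r n (2 * M) (Suc e). clauses U \<subseteq> F}"
  assume "\<not> small_count r n (2 * M) (Suc e) F \<ge> 1"
  then have "card ?Ws = 0" by (simp add: small_count_def)
  moreover have "finite ?Ws" using finite_small_formulas by simp
  ultimately have W: "?Ws = {}" by simp
  show "large_mff r n M F"
  proof (rule ccontr)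
    assume "\<not> large_mff r n M F"
    then have small: "card (vars L) \<le> M" if "subformula L ({..<n}, F)" "mff r L" for L
      using that unfolding large_mff_def by (meson linear)
    obtain H where "subformula H ({..<n}, F)" "full r H" using E(1) by (auto simp: min_excess_event_def)
    then obtain K where K: "subformula K ({..<n}, F)" "mff r K"
      using full_subformula_contains_mff[OF r] by blast
    have lo: "int e \<le> excess r K" using E(1) K mff_full[OF K(2)] unfolding min_excess_event_def e by (meson not_le)
    have "K \<notin> ?Ws" using W by blast
    then have "\<not> int (Suc e) \<le> excess r K"
      using small[OF K] K mff_full[OF K(2)] by (auto simp: small_formulas_def subformula_def full_def sat_formula_def)
    then have "excess r K = mff_excess r i" using lo e by simp
    then have rank: "K \<in> \<Union>(mff_classes r i)" unfolding Union_mff_classes using K by (simp add: mffs_of_rank_def)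
    have "mff_subformulas r ({..<n}, F) = {K}"
    proof (intro equalityI subsetI)
      fix L assume "L \<in> mff_subformulas r ({..<n}, F)"
      then have L: "subformula L ({..<n}, F)" "mff r L" by (simp_all add: mff_subformulas_def)
      show "L \<in> {K}"
        using formula_union_small[OF r K small[OF K] lo L small[OF L]] W by blast
    next
      fix L assume "L \<in> {K}"
      then show "L \<in> mff_subformulas r ({..<n}, F)" using K by (simp add: mff_subformulas_def)
    qed
    then show False using E(2) rank unfolding good_event_def by blast
  qed
qed

text \<open>The classes are disjoint, so at most one summand is nonzero. Stated for indicators, it
  turns the probability into a finite sum over classes.\<close>

lemma good_event_iff:
  assumes "r \<ge> 3"
  shows "(of_bool (good_event r i n F) :: real) = (\<Sum>c\<in>mff_classes r i. of_bool (unique_mff r n (SOME H. H \<in> c) F))"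
proof -
  let ?rep = "\<lambda>c. SOME H. H \<in> c"
  have rep: "?rep c \<in> c" if "c \<in> mff_classes r i" for c
    using mff_class_nonempty[OF that] by (metis someI)
  have iso_iff: "K \<simeq>\<^sub>f ?rep c \<longleftrightarrow> K \<in> c" if c: "c \<in> mff_classes r i" and K: "mff r K" for c K
  proof -
    note eq = mff_class_eq[OF c rep[OF c]]
    have "K \<in> mffs_of_rank r i" if iso: "K \<simeq>\<^sub>f ?rep c"
    proof -
      have "excess r (?rep c) = mff_excess r i" using eq(2) by (simp add: mffs_of_rank_def)
      then show ?thesis using isomorphic_mff(4)[OF K iso] K by (simp add: mffs_of_rank_def)
    qed
    then show ?thesis using eq(1) by blast
  qed
  show ?thesis
  proof (cases "\<exists>K. mff_subformulas r ({..<n}, F) = {K}")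
    case False
    then show ?thesis by (simp add: good_event_def unique_mff_def)
  next
    case True
    then obtain K where K: "mff_subformulas r ({..<n}, F) = {K}" by blast
    then have "K \<in> mff_subformulas r ({..<n}, F)" by blast
    then have Km: "mff r K" by (simp add: mff_subformulas_def)
    have u: "unique_mff r n (?rep c) F \<longleftrightarrow> K \<in> c" if "c \<in> mff_classes r i" for c
      unfolding unique_mff_def K using iso_iff[OF that Km] by auto
    have g: "good_event r i n F \<longleftrightarrow> K \<in> \<Union>(mff_classes r i)" unfolding good_event_def K by auto
    have "(\<Sum>c\<in>mff_classes r i. of_bool (unique_mff r n (?rep c) F)) = (\<Sum>c\<in>mff_classes r i. of_bool (K \<in> c) :: real)"
      using u by (intro sum.cong) auto
    also have "\<dots> = of_bool (K \<in> \<Union>(mff_classes r i))"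
    proof (cases "K \<in> \<Union>(mff_classes r i)")
      case False
      then show ?thesis by (auto intro!: sum.neutral)
    next
      case True
      then obtain c where c: "c \<in> mff_classes r i" "K \<in> c" by blast
      have "K \<notin> d" if "d \<in> mff_classes r i - {c}" for d
        using that c quotient_disj[OF equiv_iso_rel, of c r i d] unfolding mff_classes_alt by blast
      then have "(\<Sum>d\<in>mff_classes r i. of_bool (K \<in> d) :: real) = (\<Sum>d\<in>{c}. of_bool (K \<in> d))"
        using c by (intro sum.mono_neutral_right finite_mff_classes[OF assms]) auto
      then show ?thesis using c by auto
    qed
    finally show ?thesis unfolding g by simp
  qed
qed

context sparse_sat
begin

lemma mean_small_count:
  assumes "n \<ge> 1" "p n \<le> 1"
  shows "rs_mean (p n) (possible_clauses r {..<n}) (\<lambda>F. real (small_count r n L e F))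
    = (\<Sum>U\<in>small_formulas r n L e. p n ^ card (clauses U))"
proof -
  let ?\<Omega> = "possible_clauses r {..<n}"
  have "real (small_count r n L e F) = (\<Sum>U\<in>small_formulas r n L e. of_bool (clauses U \<subseteq> F))" for F
    using finite_small_formulas[of r n L e] by (simp add: small_count_def sum.If_cases of_bool_def Int_def)
  then have "rs_mean (p n) ?\<Omega> (\<lambda>F. real (small_count r n L e F))
      = (\<Sum>U\<in>small_formulas r n L e. pr n (\<lambda>F. clauses U \<subseteq> F))"
    unfolding rs_prob_def by (simp only: rs_mean_sum)
  also have "\<dots> = (\<Sum>U\<in>small_formulas r n L e. p n ^ card (clauses U))"
    by (intro sum.cong refl rs_prob_superset small_formulas_bounds(2)) auto
  finally show ?thesis .
qed

text \<open>There are at most n^m times a constant formulas on m variables, and each is present with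
  probability O(n^(-(e+m))) by the bound on its excess.\<close>

lemma small_first_moment:
  "(\<lambda>n. rs_mean (p n) (possible_clauses r {..<n}) (\<lambda>F. real (small_count r n L e F))) \<in> O(\<lambda>n. 1 / real n ^ e)"
proof -
  define Q where "Q = (2 * L) ^ r"
  \<comment> \<open>Q bounds the number of clauses, and the maximum with 1 makes a^k \<le> A valid
    for a < 1 as well.\<close>
  define A where "A = (max 1 a) ^ Q"
  have A: "A \<ge> 1" unfolding A_def by (intro one_le_power) simp
  show ?thesis
  proof (rule bigoI[of _ "real (Suc L) * 2 ^ Q * A"], rule eventually_mono[OF eventually_p_le_1])
    fix n assume "1 \<le> n \<and> 0 \<le> p n \<and> p n \<le> 1"
    then have n: "n \<ge> 1" and p: "0 \<le> p n" "p n \<le> 1" by auto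
    have npos: "real n > 0" "real n \<ge> 1" using n by auto
    let ?S = "\<lambda>m. Sigma {V. V \<subseteq> {..<n} \<and> card V = m} (\<lambda>V. Pow (possible_clauses r V))"
    let ?g = "\<lambda>U :: nat formula. A / real n ^ (e + card (vars U))"
    have finV: "finite {V. V \<subseteq> {..<n} \<and> card V = m}" for m by (rule finite_subset[of _ "Pow {..<n}"]) auto
    have finS: "finite (?S m)" for m
    proof (intro finite_SigmaI finV)
      fix V assume "V \<in> {V. V \<subseteq> {..<n} \<and> card V = m}"
      then have "finite V" by (auto intro: finite_subset)
      then show "finite (Pow (possible_clauses r V))" by simp
    qed
    have le: "p n ^ card (clauses U) \<le> ?g U" if U: "U \<in> small_formulas r n L e" for U
    proof -
      let ?k = "card (clauses U)" and ?m = "card (vars U)"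
      have kQ: "?k \<le> Q" using small_formulas_bounds(3)[OF U] by (simp add: Q_def)
      have "int e \<le> (int r - 1) * int ?k - int ?m" using U by (simp add: small_formulas_def excess_def)
      moreover have "(int r - 1) * int ?k = int ((r - 1) * ?k)" using r by (simp add: of_nat_diff)
      ultimately have em: "e + ?m \<le> (r - 1) * ?k" by linarith
      have "p n ^ ?k \<le> (a / real n ^ (r - 1)) ^ ?k" using p p_le[OF n] by (intro power_mono) auto
      also have "\<dots> = a ^ ?k / real n ^ ((r - 1) * ?k)" by (simp add: power_divide power_mult)
      also have "\<dots> \<le> A / real n ^ (e + ?m)"
      proof (rule frac_le)
        have "a ^ ?k \<le> (max 1 a) ^ ?k" using a by (intro power_mono) auto
        also have "\<dots> \<le> A" unfolding A_def using kQ by (intro power_increasing) auto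
        finally show "a ^ ?k \<le> A" .
        show "real n ^ (e + ?m) \<le> real n ^ ((r - 1) * ?k)" using em npos by (intro power_increasing) auto
      qed (use A npos in auto)
      finally show ?thesis .
    qed
    have "(\<Sum>U\<in>small_formulas r n L e. p n ^ card (clauses U)) \<le> (\<Sum>U\<in>small_formulas r n L e. ?g U)"
      by (rule sum_mono) (rule le)
    also have "\<dots> \<le> (\<Sum>U\<in>(\<Union>m\<in>{..L}. ?S m). ?g U)"
    proof (rule sum_mono2)
      show "finite (\<Union>m\<in>{..L}. ?S m)" using finS by blast
      show "small_formulas r n L e \<subseteq> (\<Union>m\<in>{..L}. ?S m)"
      proof
        fix U assume U: "U \<in> small_formulas r n L e"
        then have "U \<in> ?S (card (vars U))" by (cases U) (simp add: small_formulas_def)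
        moreover have "card (vars U) \<in> {..L}" using U by (simp add: small_formulas_def)
        ultimately show "U \<in> (\<Union>m\<in>{..L}. ?S m)" by blast
      qed
    qed (use A in auto)
    also have "\<dots> = (\<Sum>m\<in>{..L}. \<Sum>U\<in>?S m. ?g U)"
      using finS by (intro sum.UNION_disjoint) auto
    also have "\<dots> \<le> (\<Sum>m\<in>{..L}. 2 ^ Q * A / real n ^ e)"
    proof (rule sum_mono)
      fix m assume m: "m \<in> {..L}"
      have "(\<Sum>U\<in>?S m. ?g U) = (\<Sum>U\<in>?S m. A / real n ^ (e + m))"
        by (intro sum.cong) auto
      also have "\<dots> = real (card (?S m)) * (A / real n ^ (e + m))" by simp
      also have "\<dots> \<le> (real n ^ m * 2 ^ Q) * (A / real n ^ (e + m))"
      proof (rule mult_right_mono)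
        have "card (?S m) = (\<Sum>V\<in>{V. V \<subseteq> {..<n} \<and> card V = m}. card (Pow (possible_clauses r V)))"
        proof (intro card_SigmaI finV ballI)
          fix V assume "V \<in> {V. V \<subseteq> {..<n} \<and> card V = m}"
          then have "finite V" by (auto intro: finite_subset)
          then show "finite (Pow (possible_clauses r V))" by simp
        qed
        also have "\<dots> \<le> (\<Sum>V\<in>{V. V \<subseteq> {..<n} \<and> card V = m}. 2 ^ Q)"
        proof (rule sum_mono)
          fix V assume "V \<in> {V. V \<subseteq> {..<n} \<and> card V = m}"
          then have V: "finite V" "card V = m" by (auto intro: finite_subset)
          have "card (possible_clauses r V) \<le> (2 * card V) ^ r" by (rule card_possible_clauses_le[OF V(1)])
          also have "\<dots> \<le> Q" unfolding Q_def using V m by (intro power_mono) auto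
          finally show "card (Pow (possible_clauses r V)) \<le> 2 ^ Q"
            using V by (simp add: card_Pow)
        qed
        also have "\<dots> = (n choose m) * 2 ^ Q" by (simp add: n_subsets)
        also have "\<dots> \<le> n ^ m * 2 ^ Q"
        proof (rule mult_le_mono1)
          have "(n choose m) * 1 \<le> (n choose m) * fact m" by (intro mult_le_mono2 fact_ge_1)
          then show "n choose m \<le> n ^ m" using binomial_fact_pow[of n m] unfolding mult_1_right by (rule order_trans)
        qed
        finally have "real (card (?S m)) \<le> real (n ^ m * 2 ^ Q)" by (simp only: of_nat_le_iff)
        then show "real (card (?S m)) \<le> real n ^ m * 2 ^ Q" by simp
      qed (use A in simp)
      also have "\<dots> = 2 ^ Q * A / real n ^ e" using npos by (simp add: power_add field_simps)
      finally show "(\<Sum>U\<in>?S m. ?g U) \<le> 2 ^ Q * A / real n ^ e" .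
    qed
    also have "\<dots> = real (Suc L) * 2 ^ Q * A * (1 / real n ^ e)" by simp
    finally have "(\<Sum>U\<in>small_formulas r n L e. p n ^ card (clauses U)) \<le> real (Suc L) * 2 ^ Q * A * (1 / real n ^ e)" .
    moreover have "0 \<le> (\<Sum>U\<in>small_formulas r n L e. p n ^ card (clauses U))" using p by (intro sum_nonneg) auto
    ultimately show "norm (rs_mean (p n) (possible_clauses r {..<n}) (\<lambda>F. real (small_count r n L e F)))
      \<le> real (Suc L) * 2 ^ Q * A * norm (1 / real n ^ e)"
      unfolding mean_small_count[OF n p(2)] by simp
  qed
qed

lemma mean_copy_count:
  assumes "mff r H"
  shows "rs_mean (p n) (possible_clauses r {..<n}) (\<lambda>F. real (copy_count n H F))
    = real (card (copies n H)) * p n ^ card (clauses H)"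
proof -
  let ?\<Omega> = "possible_clauses r {..<n}"
  have fin: "finite (copies n H)" by (rule card_copies(2)[OF mff_closed[OF assms] mff_finite_vars[OF assms]])
  have "real (copy_count n H F) = (\<Sum>K\<in>copies n H. of_bool (clauses K \<subseteq> F))" for F
    using fin by (simp add: copy_count_def sum.If_cases of_bool_def Int_def)
  then have "rs_mean (p n) ?\<Omega> (\<lambda>F. real (copy_count n H F)) = (\<Sum>K\<in>copies n H. pr n (\<lambda>F. clauses K \<subseteq> F))"
    unfolding rs_prob_def by (simp only: rs_mean_sum)
  also have "\<dots> = (\<Sum>K\<in>copies n H. p n ^ card (clauses H))"
  proof (intro sum.cong refl)
    fix K assume K: "K \<in> copies n H"
    have "pr n (\<lambda>F. clauses K \<subseteq> F) = p n ^ card (clauses K)"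
      by (rule rs_prob_superset[OF _ copiesD(6)[OF assms K]]) simp
    then show "pr n (\<lambda>F. clauses K \<subseteq> F) = p n ^ card (clauses H)" using copiesD(3)[OF assms K] by simp
  qed
  finally show ?thesis by simp
qed

end

subsection \<open>Asymptotics of the conditional probabilities\<close>

lemma of_bool_small_count_le: "(of_bool (small_count r n L e F \<ge> 1) :: real) \<le> real (small_count r n L e F)"
  by (cases "small_count r n L e F") auto

text \<open>Each factor is at least 1 - m/n; Bernoulli's inequality then gives the rate 1/n, not
  only convergence.\<close>

lemma falling_power_ratio:
  fixes m n :: nat
  assumes "m \<le> n" "n \<ge> 1"
  shows "\<bar>real (\<Prod>i<m. n - i) / real n ^ m - 1\<bar> \<le> real (m * m) / real n"
proof -
  have n: "real n > 0" using assms by simp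
  have eq: "real (\<Prod>i<m. n - i) / real n ^ m = (\<Prod>i<m. real (n - i) / real n)"
    by (simp add: prod_dividef)
  have up: "(\<Prod>i<m. real (n - i) / real n) \<le> 1"
    using n by (intro prod_le_1) (auto simp: divide_le_eq)
  have "1 - real m * (real m / real n) \<le> (1 + - (real m / real n)) ^ m"
    using Bernoulli_inequality[of "- (real m / real n)" m] assms n by (simp add: divide_le_eq)
  also have "\<dots> = (\<Prod>i<m. 1 - real m / real n)" by simp
  also have "\<dots> \<le> (\<Prod>i<m. real (n - i) / real n)"
    using assms n by (intro prod_mono) (auto simp: of_nat_diff field_simps)
  finally show ?thesis unfolding eq using up by simp
qed

lemma asymp_equiv_of_bigo:
  fixes f g :: "nat \<Rightarrow> real"
  assumes "(\<lambda>n. f n - g n) \<in> O(\<lambda>n. 1 / real n)" "c > 0" "eventually (\<lambda>n. c \<le> g n) sequentially"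
  shows "f \<sim>[sequentially] g"
  unfolding asymp_equiv_altdef
proof -
  have "(\<lambda>n. 1 / real n) \<in> o(\<lambda>_. 1 :: real)" by real_asymp
  with assms(1) have "(\<lambda>n. f n - g n) \<in> o(\<lambda>_. 1 :: real)" by (rule landau_o.big_small_trans)
  moreover have "(\<lambda>_. 1 :: real) \<in> O(g)"
  proof (rule bigoI[of _ "1 / c"])
    show "eventually (\<lambda>n. norm (1 :: real) \<le> 1 / c * norm (g n)) sequentially"
      using assms(3) by eventually_elim (use assms(2) in \<open>simp add: field_simps\<close>)
  qed
  ultimately show "(\<lambda>n. f n - g n) \<in> o(g)" by (rule landau_o.small_big_trans)
qed

lemma bigo_times_power:
  fixes f :: "nat \<Rightarrow> real"
  assumes "f \<in> O(\<lambda>n. 1 / real n ^ Suc e)"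
  shows "(\<lambda>n. real n ^ e * f n) \<in> O(\<lambda>n. 1 / real n)"
proof -
  have "(\<lambda>n. real n ^ e * f n) \<in> O(\<lambda>n. real n ^ e * (1 / real n ^ Suc e))"
    using assms by (rule landau_o.big.mult_left)
  moreover have "eventually (\<lambda>n. real n ^ e * (1 / real n ^ Suc e) = 1 / real n) sequentially"
    using eventually_gt_at_top[of 0] by eventually_elim (simp add: field_simps)
  ultimately show ?thesis by (simp add: landau_o.big.cong)
qed

text \<open>The strict gaps below and above b serve the factor 1/(1-p) and the contraction,
  respectively. The excess of rank i is named as a natural number e so that probabilities can be
  scaled by n^e.\<close>

locale subcritical_sat = sparse_sat +
  fixes b :: real and \<alpha> :: "nat \<Rightarrow> real" and i e :: nat
  assumes ab: "a < b" and b_less: "b < pure_literal_threshold r"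
    and p_eq: "\<And>n. n \<ge> 1 \<Longrightarrow> p n = \<alpha> n / real n ^ (r - 1)"
    and rank_excess: "mff_excess r i = int e"
begin

lemma \<alpha>_bounds:
  assumes "n \<ge> 1"
  shows "0 \<le> \<alpha> n" "\<alpha> n \<le> a"
proof -
  have eq: "real n ^ (r - 1) * p n = \<alpha> n" using assms by (simp add: p_eq)
  show "0 \<le> \<alpha> n" unfolding eq[symmetric] using p_nonneg[OF assms] by simp
  show "\<alpha> n \<le> a" unfolding eq[symmetric] by (rule power_p_le(1)[OF assms])
qed

lemma large_mff_bigo:
  "\<exists>M\<ge>m. (\<lambda>n. pr n (large_mff r n M)) \<in> O(\<lambda>n. 1 / real n ^ K)"
proof -
  obtain M where M: "(\<lambda>n. pr n (large_mff r n M)) \<in> O(\<lambda>n. 1 / real n ^ K)"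
    using mff_size_tail[OF ab b_less, of K] unfolding large_mff_def by blast
  have "(\<lambda>n. pr n (large_mff r n (max m M))) \<in> O(\<lambda>n. pr n (large_mff r n M))"
  proof (intro landau_o.big_mono eventually_mono[OF eventually_p_le_1])
    fix n assume "1 \<le> n \<and> 0 \<le> p n \<and> p n \<le> 1"
    then have p: "0 \<le> p n" "p n \<le> 1" by auto
    have "pr n (large_mff r n (max m M)) \<le> pr n (large_mff r n M)"
      by (intro rs_prob_mono p) (auto simp: large_mff_def)
    then show "norm (pr n (large_mff r n (max m M))) \<le> norm (pr n (large_mff r n M))"
      using rs_prob_nonneg[OF p, of _ "large_mff r n (max m M)"] by simp
  qed
  then have "(\<lambda>n. pr n (large_mff r n (max m M))) \<in> O(\<lambda>n. 1 / real n ^ K)" using M by (rule landau_o.big_trans)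
  then show ?thesis by (intro exI[of _ "max m M"]) simp
qed

text \<open>Because (r-1) e(H) = e + |H|, the powers of n in n^e n^|H| p^e(H) cancel and leave
  \<alpha>^e(H); the only error is the falling factorial in place of n^|H|.\<close>

lemma expected_copies_asymp:
  assumes H: "mff r H" "excess r H = int e"
  shows "(\<lambda>n. real n ^ e * rs_mean (p n) (possible_clauses r {..<n}) (\<lambda>F. real (copy_count n H F))
     - iso_weight (\<alpha> n) H) \<in> O(\<lambda>n. 1 / real n)"
proof -
  let ?m = "card (vars H)" and ?k = "card (clauses H)"
  define A where "A = a ^ ?k * 2 ^ ?m / real (card (aut H))"
  have aut: "card (aut H) > 0" by (rule card_aut_pos[OF mff_finite_vars[OF H(1)]])
  have em: "(r - 1) * ?k = e + ?m"
  proof -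
    have "int ((r - 1) * ?k) = (int r - 1) * int ?k" using r by (simp add: of_nat_diff)
    also have "\<dots> = int (e + ?m)" using H(2) by (simp add: excess_def)
    finally show ?thesis by (simp only: of_nat_eq_iff)
  qed
  show ?thesis
  proof (rule bigoI[of _ "A * real (?m * ?m)"], rule eventually_mono[OF eventually_conj[OF eventually_ge_at_top[of ?m] eventually_ge_at_top[of 1]]])
    fix n assume "?m \<le> n \<and> 1 \<le> n"
    then have mn: "?m \<le> n" and n: "1 \<le> n" by auto
    have npos: "real n > 0" using n by simp
    let ?P = "real (\<Prod>i<?m. n - i)"
    have "real (card (copies n H) * card (aut H)) = real ((\<Prod>i<?m. n - i) * 2 ^ ?m)"
      by (simp only: card_copies(1)[OF mff_closed[OF H(1)] mff_finite_vars[OF H(1)]])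
    then have cc: "real (card (copies n H)) = ?P * 2 ^ ?m / real (card (aut H))"
      using aut by (simp add: field_simps)
    have pk: "p n ^ ?k = \<alpha> n ^ ?k / (real n ^ e * real n ^ ?m)"
      unfolding p_eq[OF n] by (simp only: power_divide power_mult[symmetric] em power_add)
    have "real n ^ e * rs_mean (p n) (possible_clauses r {..<n}) (\<lambda>F. real (copy_count n H F))
      = iso_weight (\<alpha> n) H * (?P / real n ^ ?m)"
      unfolding mean_copy_count[OF H(1)] cc pk iso_weight_def using npos by (simp add: field_simps)
    then have "real n ^ e * rs_mean (p n) (possible_clauses r {..<n}) (\<lambda>F. real (copy_count n H F)) - iso_weight (\<alpha> n) H
      = iso_weight (\<alpha> n) H * (?P / real n ^ ?m - 1)" by (simp add: algebra_simps)
    moreover have "\<bar>iso_weight (\<alpha> n) H * (?P / real n ^ ?m - 1)\<bar> \<le> A * (real (?m * ?m) / real n)"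
      unfolding abs_mult
    proof (rule mult_mono[OF _ falling_power_ratio[OF mn n]])
      have "0 \<le> iso_weight (\<alpha> n) H" unfolding iso_weight_def using \<alpha>_bounds[OF n] by simp
      moreover have "iso_weight (\<alpha> n) H \<le> A" unfolding iso_weight_def A_def
        using \<alpha>_bounds[OF n] by (intro divide_right_mono mult_right_mono power_mono) auto
      ultimately show "\<bar>iso_weight (\<alpha> n) H\<bar> \<le> A" by simp
    qed (use a in \<open>auto simp: A_def\<close>)
    ultimately show "norm (real n ^ e * rs_mean (p n) (possible_clauses r {..<n}) (\<lambda>F. real (copy_count n H F)) - iso_weight (\<alpha> n) H)
      \<le> A * real (?m * ?m) * norm (1 / real n)" by simp
  qed
qed

text \<open>The probability is squeezed between the expected number of copies and that number minus
  an error made of witnesses and large minimal full subformulas, both O(n^(-e-1)).\<close>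

lemma unique_mff_prob_asymp:
  assumes H: "mff r H" "excess r H = int e"
  shows "(\<lambda>n. real n ^ e * pr n (unique_mff r n H) - iso_weight (\<alpha> n) H) \<in> O(\<lambda>n. 1 / real n)"
proof -
  obtain M where M: "card (vars H) \<le> M" "(\<lambda>n. pr n (large_mff r n M)) \<in> O(\<lambda>n. 1 / real n ^ Suc e)"
    using large_mff_bigo by blast
  define c where "c = real (1 + 2 ^ (2 * M) * 2 ^ ((4 * M) ^ r))"
  let ?small = "\<lambda>n. rs_mean (p n) (possible_clauses r {..<n}) (\<lambda>F. real (small_count r n (2 * M) (Suc e) F))"
  let ?copy = "\<lambda>n. rs_mean (p n) (possible_clauses r {..<n}) (\<lambda>F. real (copy_count n H F))"
  let ?err = "\<lambda>n. c * ?small n + pr n (large_mff r n M)"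
  have "c \<ge> 1" unfolding c_def by linarith
  then have "(\<lambda>n. c * ?small n) \<in> O(\<lambda>n. 1 / real n ^ Suc e)"
    by (subst landau_o.big.cmult_in_iff) (simp, rule small_first_moment)
  then have err: "(\<lambda>n. real n ^ e * ?err n) \<in> O(\<lambda>n. 1 / real n)"
    using M(2) by (intro bigo_times_power sum_in_bigo(1))
  have "(\<lambda>n. real n ^ e * pr n (unique_mff r n H) - real n ^ e * ?copy n) \<in> O(\<lambda>n. real n ^ e * ?err n)"
  proof (intro landau_o.big_mono eventually_mono[OF eventually_p_le_1])
    fix n assume "1 \<le> n \<and> 0 \<le> p n \<and> p n \<le> 1"
    then have p: "0 \<le> p n" "p n \<le> 1" by auto
    have "pr n (unique_mff r n H) \<le> ?copy n"
      unfolding rs_prob_def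
    proof (rule rs_mean_mono[OF p])
      fix F show "of_bool (unique_mff r n H F) \<le> real (copy_count n H F)"
        using unique_mff_le_copy_count[OF H(1), of n F] by (cases "unique_mff r n H F") auto
    qed
    moreover have "?copy n \<le> pr n (unique_mff r n H) + ?err n"
    proof -
      have "?copy n \<le> rs_mean (p n) (possible_clauses r {..<n}) (\<lambda>F. of_bool (unique_mff r n H F)
        + (c * real (small_count r n (2 * M) (Suc e) F) + of_bool (large_mff r n M F)))"
      proof (rule rs_mean_mono[OF p])
        fix F
        have "real (copy_count n H F) \<le> real (of_bool (unique_mff r n H F)
          + (1 + 2 ^ (2 * M) * 2 ^ ((4 * M) ^ r)) * small_count r n (2 * M) (Suc e) F + of_bool (large_mff r n M F))"
          using copy_count_le[OF r H M(1)] by (simp only: of_nat_le_iff)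
        also have "\<dots> = of_bool (unique_mff r n H F)
          + (c * real (small_count r n (2 * M) (Suc e) F) + of_bool (large_mff r n M F))"
          unfolding c_def by (simp only: of_nat_add of_nat_mult of_nat_of_bool add.assoc)
        finally show "real (copy_count n H F) \<le> of_bool (unique_mff r n H F)
          + (c * real (small_count r n (2 * M) (Suc e) F) + of_bool (large_mff r n M F))" .
      qed
      then show ?thesis by (simp only: rs_mean_add rs_mean_cmult rs_prob_def)
    qed
    ultimately have "\<bar>pr n (unique_mff r n H) - ?copy n\<bar> \<le> ?err n" by linarith
    then have "real n ^ e * \<bar>pr n (unique_mff r n H) - ?copy n\<bar> \<le> real n ^ e * ?err n"
      by (rule mult_left_mono) simp
    moreover have "norm (x * y - x * z) = x * \<bar>y - z\<bar>" if "0 \<le> x" for x y z :: real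
      using that by (simp flip: right_diff_distrib add: abs_mult)
    ultimately show "norm (real n ^ e * pr n (unique_mff r n H) - real n ^ e * ?copy n) \<le> norm (real n ^ e * ?err n)"
      by (simp only: zero_le_power of_nat_0_le_iff real_norm_def)
  qed
  then have "(\<lambda>n. real n ^ e * pr n (unique_mff r n H) - real n ^ e * ?copy n) \<in> O(\<lambda>n. 1 / real n)"
    using err by (rule landau_o.big_trans)
  from sum_in_bigo(1)[OF this expected_copies_asymp[OF H]] show ?thesis by simp
qed

lemma bad_prob_bigo:
  "(\<lambda>n. real n ^ e * pr n (\<lambda>F. min_excess_event r i ({..<n}, F) \<and> \<not> good_event r i n F)) \<in> O(\<lambda>n. 1 / real n)"
proof (rule bigo_times_power)
  obtain M where M: "(\<lambda>n. pr n (large_mff r n M)) \<in> O(\<lambda>n. 1 / real n ^ Suc e)"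
    using large_mff_bigo by blast
  let ?small = "\<lambda>n. rs_mean (p n) (possible_clauses r {..<n}) (\<lambda>F. real (small_count r n (2 * M) (Suc e) F))"
  let ?bad = "\<lambda>n F. min_excess_event r i ({..<n}, F) \<and> \<not> good_event r i n F"
  have "(\<lambda>n. pr n (?bad n)) \<in> O(\<lambda>n. pr n (large_mff r n M) + ?small n)"
  proof (intro landau_o.big_mono eventually_mono[OF eventually_p_le_1])
    fix n assume "1 \<le> n \<and> 0 \<le> p n \<and> p n \<le> 1"
    then have p: "0 \<le> p n" "p n \<le> 1" by auto
    have "pr n (?bad n) \<le> pr n (\<lambda>F. large_mff r n M F \<or> small_count r n (2 * M) (Suc e) F \<ge> 1)"
      using min_excess_not_good[OF r rank_excess] by (intro rs_prob_mono p) blast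
    also have "\<dots> \<le> pr n (large_mff r n M) + pr n (\<lambda>F. small_count r n (2 * M) (Suc e) F \<ge> 1)"
      by (rule rs_prob_disj[OF p])
    also have "pr n (\<lambda>F. small_count r n (2 * M) (Suc e) F \<ge> 1) \<le> ?small n"
      unfolding rs_prob_def by (intro rs_mean_mono p of_bool_small_count_le)
    finally have le: "pr n (?bad n) \<le> pr n (large_mff r n M) + ?small n" by simp
    have "norm x \<le> norm y" if "0 \<le> x" "x \<le> y" for x y :: real using that by simp
    from this[OF rs_prob_nonneg[OF p] le] show "norm (pr n (?bad n)) \<le> norm (pr n (large_mff r n M) + ?small n)" .
  qed
  then show "(\<lambda>n. pr n (?bad n)) \<in> O(\<lambda>n. 1 / real n ^ Suc e)"
    using sum_in_bigo(1)[OF M small_first_moment] by (rule landau_o.big_trans)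
qed

lemma class_representative:
  assumes "c \<in> mff_classes r i"
  shows "mff r (SOME H. H \<in> c)" "excess r (SOME H. H \<in> c) = int e"
proof -
  have "(SOME H. H \<in> c) \<in> c" using mff_class_nonempty[OF assms] by (metis someI)
  then have "(SOME H. H \<in> c) \<in> mffs_of_rank r i" by (rule mff_class_eq(2)[OF assms])
  then show "mff r (SOME H. H \<in> c)" "excess r (SOME H. H \<in> c) = int e"
    by (simp_all add: mffs_of_rank_def rank_excess)
qed

lemma good_imp_min_excess:
  assumes "good_event r i n F"
  shows "min_excess_event r i ({..<n}, F)"
proof -
  obtain K where K: "mff_subformulas r ({..<n}, F) = {K}" "K \<in> mffs_of_rank r i"
    using assms unfolding good_event_def Union_mff_classes by blast
  then have "unique_mff r n K F" unfolding unique_mff_def using isomorphic_refl[of K] by blast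
  then show ?thesis using K(2) by (intro unique_mff_min_excess[OF r]) (auto simp: mffs_of_rank_def)
qed

text \<open>The conditioning event is the disjoint union, over the classes of rank i, of "this class
  is the unique one", together with the bad part of relative order 1/n.\<close>

lemma event_prob_asymp:
  "(\<lambda>n. real n ^ e * pr n (\<lambda>F. min_excess_event r i ({..<n}, F)) - total_weight r i (\<alpha> n)) \<in> O(\<lambda>n. 1 / real n)"
proof -
  let ?rep = "\<lambda>c. SOME H. H \<in> c"
  let ?bad = "\<lambda>n F. min_excess_event r i ({..<n}, F) \<and> \<not> good_event r i n F"
  have split: "pr n (\<lambda>F. min_excess_event r i ({..<n}, F))
      = (\<Sum>c\<in>mff_classes r i. pr n (unique_mff r n (?rep c))) + pr n (?bad n)" for n
  proof -
    have "(of_bool (min_excess_event r i ({..<n}, F)) :: real)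
        = (\<Sum>c\<in>mff_classes r i. of_bool (unique_mff r n (?rep c) F)) + of_bool (?bad n F)" for F
      unfolding good_event_iff[OF r, symmetric] using good_imp_min_excess[of n F]
      by (cases "good_event r i n F") auto
    then show ?thesis unfolding rs_prob_def by (simp only: rs_mean_add rs_mean_sum)
  qed
  have "(\<lambda>n. (\<Sum>c\<in>mff_classes r i. real n ^ e * pr n (unique_mff r n (?rep c)) - iso_weight (\<alpha> n) (?rep c))
      + real n ^ e * pr n (?bad n)) \<in> O(\<lambda>n. 1 / real n)"
    by (intro sum_in_bigo(1) big_sum_in_bigo bad_prob_bigo unique_mff_prob_asymp class_representative)
  then show ?thesis
    unfolding split total_weight_def by (simp add: sum_subtractf sum_distrib_left algebra_simps)
qed

text \<open>The total weight is a sum of non-negative terms over a nonempty set of classes, so a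
  single class bounded below through \<open>\<alpha>0\<close> suffices; this is where the lower half
  of \<alpha> = \<Theta>(1) enters.\<close>

lemma weights_bounded_below:
  fixes H :: "nat formula"
  assumes \<alpha>0: "\<alpha>0 > 0" "eventually (\<lambda>n. \<alpha>0 \<le> \<alpha> n) sequentially"
  shows "iso_weight \<alpha>0 H > 0 \<or> infinite (vars H)"
    "eventually (\<lambda>n. iso_weight \<alpha>0 H \<le> iso_weight (\<alpha> n) H) sequentially"
    "\<exists>z>0. eventually (\<lambda>n. z \<le> total_weight r i (\<alpha> n)) sequentially"
proof -
  show "iso_weight \<alpha>0 H > 0 \<or> infinite (vars H)"
    using card_aut_pos[of H] \<alpha>0 by (auto simp: iso_weight_def)
  have mono: "eventually (\<lambda>n. iso_weight \<alpha>0 H \<le> iso_weight (\<alpha> n) H) sequentially" for H :: "nat formula"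
    using \<alpha>0(2)
  proof eventually_elim
    case (elim n)
    then show ?case unfolding iso_weight_def using \<alpha>0(1)
      by (intro divide_right_mono mult_right_mono power_mono) auto
  qed
  then show "eventually (\<lambda>n. iso_weight \<alpha>0 H \<le> iso_weight (\<alpha> n) H) sequentially" .
  obtain H :: "nat formula" where "mff r H" "excess r H = mff_excess r i" using mff_excess_attained[OF r] by blast
  then have "H \<in> \<Union>(mff_classes r i)" unfolding Union_mff_classes by (simp add: mffs_of_rank_def)
  then obtain c where c: "c \<in> mff_classes r i" by blast
  let ?K = "SOME H. H \<in> c"
  have "finite (vars ?K)" by (rule mff_finite_vars[OF class_representative(1)[OF c]])
  then have "iso_weight \<alpha>0 ?K > 0" using card_aut_pos[of ?K] \<alpha>0 by (simp add: iso_weight_def)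
  moreover have "eventually (\<lambda>n. iso_weight \<alpha>0 ?K \<le> total_weight r i (\<alpha> n)) sequentially"
    using mono[of ?K] \<alpha>0(2)
  proof eventually_elim
    case (elim n)
    have "iso_weight (\<alpha> n) ?K \<le> total_weight r i (\<alpha> n)"
      unfolding total_weight_def using c elim(2) \<alpha>0(1)
      by (intro member_le_sum[of c] finite_mff_classes[OF r]) (auto simp: iso_weight_def)
    then show ?case using elim(1) by linarith
  qed
  ultimately show "\<exists>z>0. eventually (\<lambda>n. z \<le> total_weight r i (\<alpha> n)) sequentially" by blast
qed

text \<open>The failure probability is a quotient of the bad probability and that of the event;
  after scaling both by n^e the numerator is O(1/n) and the denominator stays above z/2.\<close>

lemma cond_prob_good:
  assumes \<alpha>0: "\<alpha>0 > 0" "eventually (\<lambda>n. \<alpha>0 \<le> \<alpha> n) sequentially"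
  shows "(\<lambda>n. 1 - \<P>(F in random_formula r n (p n).
             (\<exists>F\<^sub>0. mff_subformulas r F = {F\<^sub>0} \<and> F\<^sub>0 \<in> \<Union>(mff_classes r i))
             \<bar> min_excess_event r i F)) \<in> O(\<lambda>n. 1 / real n)"
proof -
  obtain z where z: "z > 0" "eventually (\<lambda>n. z \<le> total_weight r i (\<alpha> n)) sequentially"
    using weights_bounded_below(3)[OF \<alpha>0] by blast
  let ?E = "\<lambda>n F. min_excess_event r i ({..<n}, F)"
  let ?bad = "\<lambda>n F. ?E n F \<and> \<not> good_event r i n F"
  have "eventually (\<lambda>n. \<bar>real n ^ e * pr n (?E n) - total_weight r i (\<alpha> n)\<bar> < z / 2) sequentially"
    using tendsto_rabs_zero[OF bigo_inverse_tendsto_0[OF event_prob_asymp]] z(1) by (intro order_tendstoD(2)) auto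
  then have "eventually (\<lambda>n. norm (1 - \<P>(F in random_formula r n (p n).
             (\<exists>F\<^sub>0. mff_subformulas r F = {F\<^sub>0} \<and> F\<^sub>0 \<in> \<Union>(mff_classes r i))
             \<bar> min_excess_event r i F)) \<le> 2 / z * norm (real n ^ e * pr n (?bad n))) sequentially"
    using z(2) eventually_p_le_1
  proof eventually_elim
    case (elim n)
    have p: "0 \<le> p n" "p n \<le> 1" and n: "real n ^ e > 0" using elim by auto
    have Ez: "z / 2 \<le> real n ^ e * pr n (?E n)" using elim(1,2) by linarith
    then have "0 < real n ^ e * pr n (?E n)" using z(1) by linarith
    then have Epos: "pr n (?E n) > 0" using n by (simp add: zero_less_mult_iff)
    have sum: "pr n (?E n) = pr n (\<lambda>F. good_event r i n F \<and> ?E n F) + pr n (?bad n)"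
      unfolding rs_prob_def rs_mean_add[symmetric] by (intro rs_mean_cong) auto
    have "1 - \<P>(F in random_formula r n (p n).
             (\<exists>F\<^sub>0. mff_subformulas r F = {F\<^sub>0} \<and> F\<^sub>0 \<in> \<Union>(mff_classes r i)) \<bar> min_excess_event r i F)
        = 1 - pr n (\<lambda>F. good_event r i n F \<and> ?E n F) / pr n (?E n)"
      unfolding cond_prob_def prob_random_formula[OF p] good_event_def by simp
    also have "\<dots> = pr n (?bad n) / pr n (?E n)" using sum Epos by (simp add: field_simps)
    also have "\<dots> = (real n ^ e * pr n (?bad n)) / (real n ^ e * pr n (?E n))"
      by (rule mult_divide_mult_cancel_left[symmetric]) (use n in linarith)
    also have "norm \<dots> \<le> (real n ^ e * pr n (?bad n)) / (z / 2)"
    proof -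
      have "0 \<le> real n ^ e * pr n (?bad n)" by (intro mult_nonneg_nonneg rs_prob_nonneg p) simp
      moreover have "(real n ^ e * pr n (?bad n)) / (real n ^ e * pr n (?E n)) \<le> (real n ^ e * pr n (?bad n)) / (z / 2)"
        using z(1) Ez calculation by (intro frac_le) auto
      moreover have "0 \<le> (real n ^ e * pr n (?bad n)) / (real n ^ e * pr n (?E n))"
        by (intro divide_nonneg_nonneg mult_nonneg_nonneg rs_prob_nonneg p) simp_all
      ultimately show ?thesis by simp
    qed
    also have "\<dots> \<le> 2 / z * norm (real n ^ e * pr n (?bad n))"
      using rs_prob_nonneg[OF p, of _ "?bad n"] z(1) by (simp add: field_simps)
    finally show ?case .
  qed
  from landau_o.big_trans[OF bigoI[OF this] bad_prob_bigo] show ?thesis .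
qed

text \<open>A unique minimal full subformula of rank i already implies the conditioning event, so
  the conditional probability is a plain quotient of two quantities with known asymptotics.\<close>

lemma cond_prob_isomorphic:
  fixes H :: "nat formula"
  assumes \<alpha>0: "\<alpha>0 > 0" "eventually (\<lambda>n. \<alpha>0 \<le> \<alpha> n) sequentially"
    and H: "mff r H" "excess r H = int e"
  shows "(\<lambda>n. \<P>(F in random_formula r n (p n).
             (\<exists>F\<^sub>0. mff_subformulas r F = {F\<^sub>0} \<and> F\<^sub>0 \<simeq>\<^sub>f H) \<bar> min_excess_event r i F))
           \<sim>[sequentially] (\<lambda>n. 1 / total_weight r i (\<alpha> n) * iso_weight (\<alpha> n) H)"
proof -
  obtain z where z: "z > 0" "eventually (\<lambda>n. z \<le> total_weight r i (\<alpha> n)) sequentially"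
    using weights_bounded_below(3)[OF \<alpha>0] by blast
  have w: "iso_weight \<alpha>0 H > 0" using weights_bounded_below(1)[OF \<alpha>0, of H] mff_finite_vars[OF H(1)] by blast
  let ?E = "\<lambda>n F. min_excess_event r i ({..<n}, F)"
  have ratio: "(\<lambda>n. (real n ^ e * pr n (unique_mff r n H)) / (real n ^ e * pr n (?E n)))
    \<sim>[sequentially] (\<lambda>n. iso_weight (\<alpha> n) H / total_weight r i (\<alpha> n))"
    using asymp_equiv_of_bigo[OF unique_mff_prob_asymp[OF H] w weights_bounded_below(2)[OF \<alpha>0]]
      asymp_equiv_of_bigo[OF event_prob_asymp z]
    by (rule asymp_equiv_divide)
  have "eventually (\<lambda>n. \<P>(F in random_formula r n (p n).
             (\<exists>F\<^sub>0. mff_subformulas r F = {F\<^sub>0} \<and> F\<^sub>0 \<simeq>\<^sub>f H) \<bar> min_excess_event r i F)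
      = (real n ^ e * pr n (unique_mff r n H)) / (real n ^ e * pr n (?E n))) sequentially"
    using eventually_p_le_1
  proof eventually_elim
    case (elim n)
    have p: "0 \<le> p n" "p n \<le> 1" and n: "real n ^ e > 0" using elim by auto
    have "pr n (\<lambda>F. unique_mff r n H F \<and> ?E n F) = pr n (unique_mff r n H)"
      using unique_mff_min_excess[OF r H(1), of i n] H(2) rank_excess
      unfolding rs_prob_def by (intro rs_mean_cong) auto
    then have "\<P>(F in random_formula r n (p n).
             (\<exists>F\<^sub>0. mff_subformulas r F = {F\<^sub>0} \<and> F\<^sub>0 \<simeq>\<^sub>f H) \<bar> min_excess_event r i F)
        = pr n (unique_mff r n H) / pr n (?E n)"
      unfolding cond_prob_def prob_random_formula[OF p] unique_mff_def[symmetric] by (simp only:)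
    also have "\<dots> = (real n ^ e * pr n (unique_mff r n H)) / (real n ^ e * pr n (?E n))"
      by (rule mult_divide_mult_cancel_left[symmetric]) (use n in linarith)
    finally show ?case .
  qed
  then have "(\<lambda>n. \<P>(F in random_formula r n (p n).
             (\<exists>F\<^sub>0. mff_subformulas r F = {F\<^sub>0} \<and> F\<^sub>0 \<simeq>\<^sub>f H) \<bar> min_excess_event r i F))
    \<sim>[sequentially] (\<lambda>n. iso_weight (\<alpha> n) H / total_weight r i (\<alpha> n))"
    by (rule asymp_equiv_cong[OF _ always_eventually, THEN iffD2]) (rule allI, rule refl, rule ratio)
  moreover have "1 / total_weight r i (\<alpha> n) * iso_weight (\<alpha> n) H = iso_weight (\<alpha> n) H / total_weight r i (\<alpha> n)" for n
    by simp
  ultimately show ?thesis by (simp only:)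
qed

end

theorem theorem11:
  fixes i r :: nat and \<alpha> p :: "nat \<Rightarrow> real"
  assumes "i > 0" and "r \<ge> 3"
    and "\<And>n. n \<ge> 1 \<Longrightarrow> 0 \<le> \<alpha> n"
    and "\<alpha> \<in> \<Theta>(\<lambda>_. 1)"
    and "(SUP n\<in>{1..}. \<alpha> n) < pure_literal_threshold r"
    and "\<And>n. n \<ge> 1 \<Longrightarrow> p n = \<alpha> n / real n ^ (r - 1)"
  shows "(\<lambda>n. 1 - \<P>(F in random_formula r n (p n).
             (\<exists>F\<^sub>0. mff_subformulas r F = {F\<^sub>0} \<and> F\<^sub>0 \<in> \<Union>(mff_classes r i))
             \<bar> min_excess_event r i F)) \<in> O(\<lambda>n. 1 / real n)
       \<and> (\<forall>c\<in>mff_classes r i. \<forall>F'\<in>c.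
           (\<lambda>n. \<P>(F in random_formula r n (p n).
             (\<exists>F\<^sub>0. mff_subformulas r F = {F\<^sub>0} \<and> F\<^sub>0 \<simeq>\<^sub>f F')
             \<bar> min_excess_event r i F))
           \<sim>[sequentially]
           (\<lambda>n. 1 / total_weight r i (\<alpha> n) * iso_weight (\<alpha> n) F'))"
proof -
  obtain C where C: "eventually (\<lambda>n. norm (\<alpha> n) \<le> C * norm (1 :: real)) sequentially"
    using assms(4) by (auto dest!: bigthetaD1 elim: landau_o.bigE)
  obtain \<alpha>0 where \<alpha>0: "\<alpha>0 > 0" "eventually (\<lambda>n. norm (\<alpha> n) \<ge> \<alpha>0 * norm (1 :: real)) sequentially"
    using assms(4) by (auto dest!: bigthetaD2 elim: landau_omega.bigE)
  have low: "eventually (\<lambda>n. \<alpha>0 \<le> \<alpha> n) sequentially"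
    using \<alpha>0(2) eventually_ge_at_top[of 1] by eventually_elim (use assms(3) in auto)
  obtain N where "\<forall>n\<ge>N. norm (\<alpha> n) \<le> C * norm (1 :: real)" using C by (auto simp: eventually_sequentially)
  then have N: "\<alpha> n \<le> C" if "n \<ge> N" for n using that by force
  \<comment> \<open>The supremum bounds its values only for a bounded family. \<Theta>(1) bounds
    \<alpha> only from some N on, and the finitely many earlier values are covered by a
    maximum.\<close>
  have "\<alpha> n \<le> max C (Max (\<alpha> ` {..N}))" for n
  proof (cases "n \<ge> N")
    case False
    then have "\<alpha> n \<le> Max (\<alpha> ` {..N})" by (intro Max_ge) auto
    then show ?thesis by simp
  qed (use N in force)
  then have bdd: "bdd_above (\<alpha> ` {1..})" by (intro bdd_aboveI2)
  define s where "s = (SUP n\<in>{1..}. \<alpha> n)"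
  let ?t = "pure_literal_threshold r"
  have \<alpha>s: "\<alpha> n \<le> s" if "n \<ge> 1" for n unfolding s_def using bdd that by (intro cSUP_upper) auto
  have s: "0 \<le> s" "s < ?t" using \<alpha>s[of 1] assms(3)[of 1] assms(5) by (auto simp: s_def)
  \<comment> \<open>s < a < b < ?t are equally spaced, and a is positive even if s were 0.\<close>
  define a where "a = (2 * s + ?t) / 3"
  define b where "b = (s + 2 * ?t) / 3"
  obtain H :: "nat formula" where H: "mff r H" "excess r H = mff_excess r i"
    using mff_excess_attained[OF assms(2)] by blast
  \<comment> \<open>Harmless truncation: the excess is positive, being attained by a full
    formula.\<close>
  define e where "e = nat (mff_excess r i)"
  have e: "mff_excess r i = int e" using full_excess_pos[OF assms(2) mff_full[OF H(1)]] H(2) by (simp add: e_def)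
  interpret subcritical_sat r p a b \<alpha> i e
  proof
    show "p n \<le> a / real n ^ (r - 1)" if "n \<ge> 1" for n
    proof -
      have "\<alpha> n \<le> a" using \<alpha>s[OF that] s by (simp add: a_def)
      then show ?thesis unfolding assms(6)[OF that] by (rule divide_right_mono) simp
    qed
  qed (use assms s e in \<open>auto simp: a_def b_def\<close>)
  have "mff r F'" "excess r F' = int e" if "c \<in> mff_classes r i" "F' \<in> c" for c F'
    using mff_class_eq(2)[OF that] by (simp_all add: mffs_of_rank_def rank_excess)
  then show ?thesis using cond_prob_good[OF \<alpha>0(1) low] cond_prob_isomorphic[OF \<alpha>0(1) low] by blast
qed

end
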